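(* Let $n\ge1$, $\alpha\in(\mathbb{N}\cup\{0\})^n$, let $x^0\in\mathbb{G}^{n+1}_\alpha$ be a Riemannian point and let $x(t)$ be the non-trivial arc-length geodesic starting at $x^0$ with initial covector $p^0(\phi)$, $\phi\in\mathcal{R}^0_\alpha$. Then its cut time satisfies $0\le t_{\operatorname{cut}}\le\tau$, where $\tau:=\min_{j\in J}\tau_j(\phi)$; i.e. the geodesic is not length minimizing past $t=\tau$.
   Context: Grushin space: for $n\ge1$ and $\alpha\in(\mathbb{N}\cup\{0\})^n$, $\mathbb{G}^{n+1}_\alpha$ is $\mathbb{R}^{n+1}$ with the sub-Riemannian structure generated by $X_j=\xi_j\partial_{x_j}$, $j=1,\dots,n+1$, $\xi_j(x)=\prod_{i=1}^{j-1}x_i^{\alpha_i}$, with its Carnot–Carathéodory distance. $H(x,p)=\tfrac12\sum_j\xi_j(x)^2p_j^2$; a geodesic with initial point $x^0$ and covector $p^0$ is the projection of the solution of Hamilton's equations $x_j'=\xi_j^2p_j$, $p_j'=-\partial H/\partial x_j$ with $x(0)=x^0$, $p(0)=p^0$. Cut time: $t_{\operatorname{cut}}=\sup\{t>0: x|_{[0,t]}\text{ is length minimizing}\}$. $J:=\{j:\alpha_j\neq0\}$; $x^0$ Riemannian means $x^0_j\neq0$ for $j\in J$. For real $a\ge1$: $\pi_a=2\int_0^1(1-t^{2a})^{-1/2}dt$; $\sin_a$ is the inverse of $s\mapsto\int_0^s(1-t^{2a})^{-1/2}dt$ on $[0,\pi_a/2]$, extended by $\sin_a(s)=\sin_a(\pi_a-s)$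 on $[0,\pi_a]$, oddly and $2\pi_a$-periodically; $\cos_a=\sin_a'$; $\rho_\theta(s)=|s|^{\theta-1}s$. Spherical coordinates: $\tilde\alpha_j=\alpha_j$ ($j\in J$), $=1$ otherwise; $\tilde x^0_j=x^0_j$ ($j\in J$), $=1$ otherwise; for $\phi\in\mathcal{R}_\alpha=\prod_{j\le n-1}[0,\pi_{\tilde\alpha_j}]\times[0,2\pi_{\tilde\alpha_n})$, $\delta_j=\rho_{\tilde\alpha_j}(\sin_{\tilde\alpha_j}(\phi_j)/\tilde x^0_j)$, $p^0_j(\phi)=\cos_{\tilde\alpha_j}(\phi_j)\prod_{i<j}\delta_i$ ($j\le n$), $p^0_{n+1}=\prod_{i\le n}\delta_i$. $\mathcal{R}^0_\alpha=\{\phi:\sin_{\tilde\alpha_j}(\phi_j)\neq0\ \forall j\}$ (covectors of non-trivial geodesics). For $j\in J$: $\omega_j=\frac{\sin_{\alpha_j}(\phi_j)}{x^0_j}\prod_{i<j}\delta_i$ and $\tau_j(\phi)=\min\{t>0:|\omega_j|\int_0^t\xi_j(x(s))^2ds=\pi_{\alpha_j}\}$. *)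

theory Defs
  imports "HOL-Analysis.Analysis"
begin

text \<open>Conventions: points of R^(n+1) and covectors are functions nat \<Rightarrow> real, of which only
the coordinates 1..n+1 are relevant; alpha :: nat \<Rightarrow> nat, only entries 1..n relevant.\<close>

definition xi :: "(nat \<Rightarrow> nat) \<Rightarrow> nat \<Rightarrow> (nat \<Rightarrow> real) \<Rightarrow> real" where
  "xi \<alpha> j x = (\<Prod>i\<in>{1..<j}. x i ^ \<alpha> i)"

definition ham :: "nat \<Rightarrow> (nat \<Rightarrow> nat) \<Rightarrow> (nat \<Rightarrow> real) \<Rightarrow> (nat \<Rightarrow> real) \<Rightarrow> real" where
  "ham n \<alpha> x p = (\<Sum>j\<in>{1..n+1}. (xi \<alpha> j x)\<^sup>2 * (p j)\<^sup>2) / 2"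

definition dham_dx :: "nat \<Rightarrow> (nat \<Rightarrow> nat) \<Rightarrow> nat \<Rightarrow> (nat \<Rightarrow> real) \<Rightarrow> (nat \<Rightarrow> real) \<Rightarrow> real" where
  "dham_dx n \<alpha> k x p = deriv (\<lambda>y. ham n \<alpha> (x(k := y)) p) (x k)"

definition hamilton_solution ::
  "nat \<Rightarrow> (nat \<Rightarrow> nat) \<Rightarrow> (nat \<Rightarrow> real) \<Rightarrow> (nat \<Rightarrow> real) \<Rightarrow>
   (real \<Rightarrow> nat \<Rightarrow> real) \<Rightarrow> (real \<Rightarrow> nat \<Rightarrow> real) \<Rightarrow> bool" where
  "hamilton_solution n \<alpha> x0 p0 x p \<longleftrightarrow>
     (\<forall>j\<in>{1..n+1}. x 0 j = x0 j \<and> p 0 j = p0 j) \<and>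
     (\<forall>t\<ge>0. \<forall>j\<in>{1..n+1}.
        ((\<lambda>s. x s j) has_real_derivative ((xi \<alpha> j (x t))\<^sup>2 * p t j)) (at t within {0..}) \<and>
        ((\<lambda>s. p s j) has_real_derivative (- dham_dx n \<alpha> j (x t) (p t))) (at t within {0..}))"

definition horizontal ::
  "nat \<Rightarrow> (nat \<Rightarrow> nat) \<Rightarrow> real \<Rightarrow> (real \<Rightarrow> nat \<Rightarrow> real) \<Rightarrow> (nat \<Rightarrow> real \<Rightarrow> real) \<Rightarrow> bool" where
  "horizontal n \<alpha> T \<gamma> u \<longleftrightarrow> 0 \<le> T \<and>
     (\<forall>j\<in>{1..n+1}. u j absolutely_integrable_on {0..T} \<and>
        (\<forall>t\<in>{0..T}. ((\<lambda>s. u j s * xi \<alpha> j (\<gamma> s)) has_integral (\<gamma> t j - \<gamma> 0 j)) {0..t}))"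

definition ctrl_length :: "nat \<Rightarrow> real \<Rightarrow> (nat \<Rightarrow> real \<Rightarrow> real) \<Rightarrow> real" where
  "ctrl_length n T u = integral {0..T} (\<lambda>s. sqrt (\<Sum>j\<in>{1..n+1}. (u j s)\<^sup>2))"

definition cc_dist :: "nat \<Rightarrow> (nat \<Rightarrow> nat) \<Rightarrow> (nat \<Rightarrow> real) \<Rightarrow> (nat \<Rightarrow> real) \<Rightarrow> real" where
  "cc_dist n \<alpha> a b = Inf {L. \<exists>T \<gamma> u. horizontal n \<alpha> T \<gamma> u \<and>
      (\<forall>j\<in>{1..n+1}. \<gamma> 0 j = a j \<and> \<gamma> T j = b j) \<and> L = ctrl_length n T u}"

definition minimizing_on :: "nat \<Rightarrow> (nat \<Rightarrow> nat) \<Rightarrow> (real \<Rightarrow> nat \<Rightarrow> real) \<Rightarrow> real \<Rightarrow> bool" where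
  "minimizing_on n \<alpha> x t \<longleftrightarrow>
     (\<exists>u. horizontal n \<alpha> t x u \<and> ctrl_length n t u = cc_dist n \<alpha> (x 0) (x t))"

definition cut_time :: "nat \<Rightarrow> (nat \<Rightarrow> nat) \<Rightarrow> (real \<Rightarrow> nat \<Rightarrow> real) \<Rightarrow> ereal" where
  "cut_time n \<alpha> x = Sup (ereal ` {t. t > 0 \<and> minimizing_on n \<alpha> x t})"

definition gF :: "real \<Rightarrow> real \<Rightarrow> real" where
  "gF a s = integral {0..s} (\<lambda>t. 1 / sqrt (1 - t powr (2*a)))"

definition gpi :: "real \<Rightarrow> real" where
  "gpi a = 2 * integral {0..1} (\<lambda>t. 1 / sqrt (1 - t powr (2*a)))"

text \<open>inverse of gF a on [0, gpi a / 2]\<close>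
definition gsin0 :: "real \<Rightarrow> real \<Rightarrow> real" where
  "gsin0 a s = (THE y. 0 \<le> y \<and> y \<le> 1 \<and> gF a y = s)"

definition gsin_half :: "real \<Rightarrow> real \<Rightarrow> real" where
  "gsin_half a s = (if s \<le> gpi a / 2 then gsin0 a s else gsin0 a (gpi a - s))"

definition gsin :: "real \<Rightarrow> real \<Rightarrow> real" where
  "gsin a s = (let r = s - 2 * gpi a * of_int \<lfloor>s / (2 * gpi a)\<rfloor> in
     if r \<le> gpi a then gsin_half a r else - gsin_half a (2 * gpi a - r))"

definition gcos :: "real \<Rightarrow> real \<Rightarrow> real" where
  "gcos a s = deriv (gsin a) s"

definition rho :: "nat \<Rightarrow> real \<Rightarrow> real" where
  "rho \<theta> s = \<bar>s\<bar> ^ (\<theta> - 1) * s"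

definition Jset :: "nat \<Rightarrow> (nat \<Rightarrow> nat) \<Rightarrow> nat set" where
  "Jset n \<alpha> = {j\<in>{1..n}. \<alpha> j \<noteq> 0}"

definition riemannian_point :: "nat \<Rightarrow> (nat \<Rightarrow> nat) \<Rightarrow> (nat \<Rightarrow> real) \<Rightarrow> bool" where
  "riemannian_point n \<alpha> x0 \<longleftrightarrow> (\<forall>j\<in>Jset n \<alpha>. x0 j \<noteq> 0)"

definition alpha_t :: "(nat \<Rightarrow> nat) \<Rightarrow> nat \<Rightarrow> nat" where
  "alpha_t \<alpha> j = (if \<alpha> j \<noteq> 0 then \<alpha> j else 1)"

definition x0_t :: "(nat \<Rightarrow> nat) \<Rightarrow> (nat \<Rightarrow> real) \<Rightarrow> nat \<Rightarrow> real" where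
  "x0_t \<alpha> x0 j = (if \<alpha> j \<noteq> 0 then x0 j else 1)"

definition R_alpha :: "nat \<Rightarrow> (nat \<Rightarrow> nat) \<Rightarrow> (nat \<Rightarrow> real) set" where
  "R_alpha n \<alpha> = {\<phi>. (\<forall>j\<in>{1..<n}. 0 \<le> \<phi> j \<and> \<phi> j \<le> gpi (alpha_t \<alpha> j)) \<and>
                      0 \<le> \<phi> n \<and> \<phi> n < 2 * gpi (alpha_t \<alpha> n)}"

definition R0_alpha :: "nat \<Rightarrow> (nat \<Rightarrow> nat) \<Rightarrow> (nat \<Rightarrow> real) set" where
  "R0_alpha n \<alpha> = {\<phi>\<in>R_alpha n \<alpha>. \<forall>j\<in>{1..n}. gsin (alpha_t \<alpha> j) (\<phi> j) \<noteq> 0}"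

definition delta :: "(nat \<Rightarrow> nat) \<Rightarrow> (nat \<Rightarrow> real) \<Rightarrow> (nat \<Rightarrow> real) \<Rightarrow> nat \<Rightarrow> real" where
  "delta \<alpha> x0 \<phi> j = rho (alpha_t \<alpha> j) (gsin (alpha_t \<alpha> j) (\<phi> j) / x0_t \<alpha> x0 j)"

definition p0_sph :: "nat \<Rightarrow> (nat \<Rightarrow> nat) \<Rightarrow> (nat \<Rightarrow> real) \<Rightarrow> (nat \<Rightarrow> real) \<Rightarrow> nat \<Rightarrow> real" where
  "p0_sph n \<alpha> x0 \<phi> j =
     (if j \<le> n then gcos (alpha_t \<alpha> j) (\<phi> j) * (\<Prod>i\<in>{1..<j}. delta \<alpha> x0 \<phi> i)
      else (\<Prod>i\<in>{1..n}. delta \<alpha> x0 \<phi> i))"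

definition omega :: "(nat \<Rightarrow> nat) \<Rightarrow> (nat \<Rightarrow> real) \<Rightarrow> (nat \<Rightarrow> real) \<Rightarrow> nat \<Rightarrow> real" where
  "omega \<alpha> x0 \<phi> j = gsin (\<alpha> j) (\<phi> j) / x0 j * (\<Prod>i\<in>{1..<j}. delta \<alpha> x0 \<phi> i)"

text \<open>tau_j as an extended real: the minimum of the set (Inf; = \<infinity> if the set were empty).\<close>
definition tau_j :: "(nat \<Rightarrow> nat) \<Rightarrow> (nat \<Rightarrow> real) \<Rightarrow> (nat \<Rightarrow> real) \<Rightarrow> (real \<Rightarrow> nat \<Rightarrow> real) \<Rightarrow> nat \<Rightarrow> ereal" where
  "tau_j \<alpha> x0 \<phi> x j = Inf (ereal ` {t. t > 0 \<and>
      \<bar>omega \<alpha> x0 \<phi> j\<bar> * integral {0..t} (\<lambda>s. (xi \<alpha> j (x s))\<^sup>2) = gpi (\<alpha> j)})"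

end

theory Submission
  imports Defs
begin

text \<open>With \<open>tail_energy j = p_j\<^sup>2 + x_j ^ (2 * \<alpha>_j) * tail_energy (j+1)\<close> the Hamiltonian is \<open>tail_energy 1 / 2\<close>, and every
  \<open>tail_energy j\<close> is conserved. In the clock \<open>s_j = \<integral> \<xi>_j\<^sup>2 dt\<close> the coordinate \<open>x_j\<close> is therefore a one-dimensional
  oscillator \<open>Y s = A * gsin (\<phi>_j + \<omega>_j * s)\<close>, and \<open>\<tau>_j\<close> is the time at which its half period \<open>S\<close> has elapsed.

  Since \<open>Sup {} = - \<infinity>\<close> in the extended reals, \<open>0 \<le> cut_time\<close> requires that short arcs are minimizing.
  The metric is an iterated warped product, and the length of a competitor is bounded below level by level, from
  \<open>n + 1\<close> down to \<open>1\<close>: at each level a subsolution of the one-dimensional Hamilton-Jacobi equation of the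
  oscillator calibrates the geodesic.

  Past \<open>\<tau>_j\<close>, choose \<open>b\<close> slightly larger than \<open>S\<close>. As \<open>Y (s + S) = - Y s\<close>, the mirror image \<open>Y (2 * b - s)\<close> meets
  \<open>Y\<close> at \<open>s = b - S\<close> and at \<open>s = b\<close>. Following it in between, while the coordinates after \<open>x_j\<close> run through
  the same curve with a changed time, gives a curve of the same length and with the same ends, but with a corner at \<open>b\<close>;
  cutting the corner makes it strictly shorter.\<close>

section \<open>The generalized sine\<close>

text \<open>The controls of a competitor are only absolutely integrable, so all estimates along it
  compare increments over short subintervals. A second obstacle: \<open>xi\<close> vanishes wherever
  an earlier coordinate with positive exponent crosses zero. There a clock has speed zero, its
  inverse is not differentiable, and the control cannot be read off the velocity. The clocks still
  increase strictly, because a nonzero energy level does not let such a coordinate rest at zero. Why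
  cutting the corner pays: the coordinates after \<open>x_j\<close> run through their own curve,
  parametrized by the reading of clock \<open>j + 1\<close>, whose total advance must not change. It
  survives the reflection because the integral of \<open>Y ^ (2 * \<alpha>_j)\<close> over a half
  period does not depend on where the half period starts. This needs \<open>Y b \<noteq> 0\<close>
  and \<open>Y' b \<noteq> 0\<close>.\<close>

lemma period_reduce:
  fixes s P :: real
  assumes "P > 0"
  obtains k :: int and r where "s = r + P * of_int k" "0 \<le> r" "r < P"
proof
  show "s = (s - P * of_int \<lfloor>s / P\<rfloor>) + P * of_int \<lfloor>s / P\<rfloor>" by simp
  have "of_int \<lfloor>s / P\<rfloor> \<le> s / P" "s / P < of_int \<lfloor>s / P\<rfloor> + 1" by linarith+
  then have "of_int \<lfloor>s / P\<rfloor> * P \<le> s" "s < (of_int \<lfloor>s / P\<rfloor> + 1) * P"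
    using pos_le_divide_eq[OF assms, of "of_int \<lfloor>s / P\<rfloor>" s] pos_divide_less_eq[OF assms, of s "of_int \<lfloor>s / P\<rfloor> + 1"] by simp_all
  then show "0 \<le> s - P * of_int \<lfloor>s / P\<rfloor>" "s - P * of_int \<lfloor>s / P\<rfloor> < P"
    by (simp_all add: algebra_simps)
qed

text \<open>The difference quotient is a 0/0 form whose quotient of derivatives tends to
  \<open>L\<close>, so l'Hopital's rule applies. Needed at the maximum of \<open>gsin\<close>, where
  its inverse \<open>gasin\<close> has infinite slope and the inverse function rule fails.\<close>

lemma DERIV_from_limit:
  fixes f :: "real \<Rightarrow> real"
  assumes "isCont f c" "eventually (\<lambda>x. DERIV f x :> f' x) (at c)" "(f' \<longlongrightarrow> L) (at c)"
  shows "DERIV f c :> L"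
proof -
  have "((\<lambda>x. (f x - f c) / (x - c)) \<longlongrightarrow> L) (at c)"
  proof (rule lhopital)
    show "((\<lambda>x. f x - f c) \<longlongrightarrow> 0) (at c)"
      using assms(1) unfolding isCont_def by (rule LIM_zero)
    show "((\<lambda>x. x - c) \<longlongrightarrow> 0) (at c)" by (intro LIM_zero tendsto_ident_at)
    show "eventually (\<lambda>x. x - c \<noteq> 0) (at c)" by (simp add: eventually_at_filter)
    show "eventually (\<lambda>x. (1::real) \<noteq> 0) (at c)" by simp
    show "eventually (\<lambda>x. DERIV (\<lambda>x. f x - f c) x :> f' x) (at c)"
      using assms(2) by eventually_elim (auto intro!: derivative_eq_intros)
    show "eventually (\<lambda>x. DERIV (\<lambda>x. x - c) x :> 1) (at c)"
      by (intro always_eventually allI) (auto intro!: derivative_eq_intros)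
    show "((\<lambda>x. f' x / 1) \<longlongrightarrow> L) (at c)" using assms(3) by simp
  qed
  then show ?thesis by (simp add: has_field_derivative_iff)
qed

section \<open>The generalized arcsine on [-1, 1]\<close>

definition arc_integrand :: "nat \<Rightarrow> real \<Rightarrow> real" where
  "arc_integrand a t = 1 / sqrt (1 - t ^ (2 * a))"

text \<open>The odd extension of \<open>gF\<close> to [-1, 1]. Integration starts at -1 because
  \<open>{0..y}\<close> is empty, and the integral over it zero, for negative
  \<open>y\<close>.\<close>

definition gasin :: "nat \<Rightarrow> real \<Rightarrow> real" where
  "gasin a y = integral {-1..y} (arc_integrand a) - integral {-1..0} (arc_integrand a)"

lemma even_power_less_1:
  fixes t :: real
  assumes "a \<ge> 1" "\<bar>t\<bar> < 1"
  shows "t ^ (2 * a) < 1"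
proof -
  have "\<bar>t\<bar> ^ (2*a) < 1" using assms by (intro power_less_one_iff[THEN iffD2]) auto
  then show ?thesis by (simp add: power_even_abs)
qed

lemma arc_integrand_le:
  assumes "a \<ge> 1" "\<bar>t\<bar> \<le> 1"
  shows "\<bar>arc_integrand a t\<bar> \<le> inverse (sqrt (1 - t\<^sup>2))"
proof (cases "\<bar>t\<bar> = 1")
  \<comment> \<open>At the endpoints both sides are zero, by the value of division by 0.\<close>
  case True
  then have t: "t^2 = 1" by (metis one_power2 power2_abs)
  then have "t ^ (2*a) = 1" by (simp add: power_mult)
  with t show ?thesis by (simp add: arc_integrand_def)
next
  case False
  then have lt: "\<bar>t\<bar> < 1" using assms by simp
  have t2: "t^2 < 1" using lt by (simp add: abs_square_less_1)
  have "(t^2) ^ a \<le> (t^2) ^ 1" using assms t2 by (intro power_decreasing) auto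
  then have le: "t^(2*a) \<le> t^2" by (simp add: power_mult)
  have "0 < sqrt (1 - t^2)" using t2 by simp
  moreover have "sqrt (1 - t^2) \<le> sqrt (1 - t^(2*a))" using le by simp
  ultimately show ?thesis
    by (simp add: arc_integrand_def inverse_eq_divide frac_le)
qed

text \<open>The endpoint singularities are dominated by the derivative of \<open>arcsin\<close>, the
  case \<open>a = 1\<close>. That derivative is integrable by the fundamental theorem with
  derivatives in the open interval only.\<close>

lemma arc_integrand_integrable:
  assumes "a \<ge> 1"
  shows "arc_integrand a integrable_on {-1..1}"
proof (rule measurable_bounded_by_integrable_imp_integrable)
  have "arc_integrand a \<in> borel_measurable borel"
    unfolding arc_integrand_def by measurable
  then have "arc_integrand a \<in> borel_measurable lebesgue"
    by (metis measurable_completion measurable_lborel2)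
  then show "arc_integrand a \<in> borel_measurable (lebesgue_on {-1..1})"
    by (rule measurable_restrict_space1)
  have "((\<lambda>t. inverse (sqrt (1 - t\<^sup>2))) has_integral (arcsin 1 - arcsin (-1))) {-1..1}"
  proof (rule fundamental_theorem_of_calculus_interior)
    show "continuous_on {-1..1} arcsin" by (rule continuous_on_arcsin')
    show "(arcsin has_vector_derivative inverse (sqrt (1 - t\<^sup>2))) (at t)" if "t \<in> {-1<..<1}" for t
      using that DERIV_arcsin[of t] by (simp add: has_real_derivative_iff_has_vector_derivative)
  qed simp
  then show "(\<lambda>t. inverse (sqrt (1 - t\<^sup>2))) integrable_on {-1..1}" by blast
  show "norm (arc_integrand a t) \<le> inverse (sqrt (1 - t\<^sup>2))" if "t \<in> {-1..1}" for t
    using arc_integrand_le[of a t] assms that by auto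
qed auto

lemma gasin_0 [simp]: "gasin a 0 = 0"
  by (simp add: gasin_def)

lemma continuous_on_gasin:
  assumes "a \<ge> 1"
  shows "continuous_on {-1..1} (gasin a)"
  unfolding gasin_def
  by (intro continuous_intros indefinite_integral_continuous_1 arc_integrand_integrable assms)

lemma gasin_has_derivative:
  assumes "a \<ge> 1" "\<bar>y\<bar> < 1"
  shows "(gasin a has_real_derivative 1 / sqrt (1 - y ^ (2 * a))) (at y)"
proof -
  have p: "y ^ (2*a) < 1" by (rule even_power_less_1) (use assms in auto)
  have "continuous (at y within {-1..1}) (arc_integrand a)"
    unfolding arc_integrand_def using p
    by (intro continuous_intros) auto
  then have "((\<lambda>u. integral {-1..u} (arc_integrand a)) has_vector_derivative arc_integrand a y) (at y within {-1..1})"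
    using integral_has_vector_derivative_continuous_at[of "arc_integrand a" "-1" 1 y "{}"]
      arc_integrand_integrable[OF assms(1)] assms(2) by (simp add: abs_less_iff)
  then have "((\<lambda>u. integral {-1..u} (arc_integrand a)) has_real_derivative arc_integrand a y) (at y within {-1..1})"
    by (simp add: has_real_derivative_iff_has_vector_derivative)
  moreover have "at y within {-1..1} = at y"
    using assms by (intro at_within_interior) auto
  ultimately have "((\<lambda>u. integral {-1..u} (arc_integrand a)) has_real_derivative arc_integrand a y) (at y)"
    by simp
  from DERIV_diff[OF this DERIV_const[of "integral {-1..0} (arc_integrand a)"]]
  show ?thesis
    by (simp add: arc_integrand_def gasin_def[abs_def])
qed

lemma gasin_strict_mono:
  assumes "a \<ge> 1"
  shows "strict_mono_on {-1..1} (gasin a)"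
proof (rule strict_mono_onI)
  fix r s :: real assume rs: "r \<in> {-1..1}" "s \<in> {-1..1}" "r < s"
  show "gasin a r < gasin a s"
  proof (rule DERIV_pos_imp_increasing_open[OF rs(3)])
    fix y assume y: "r < y" "y < s"
    then have "\<bar>y\<bar> < 1" using rs by auto
    then show "\<exists>z. (gasin a has_real_derivative z) (at y) \<and> 0 < z"
      using gasin_has_derivative[OF assms, of y] even_power_less_1[OF assms, of y]
      by (intro exI[of _ "1 / sqrt (1 - y ^ (2 * a))"]) auto
  next
    show "continuous_on {r..s} (gasin a)"
      using continuous_on_gasin[OF assms] by (rule continuous_on_subset) (use rs in auto)
  qed
qed

lemma gF_eq_gasin:
  assumes "a \<ge> 1" "0 \<le> s" "s \<le> 1"
  shows "gF (real a) s = gasin a s"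
proof -
  have "gF (real a) s = integral {0..s} (arc_integrand a)"
    unfolding gF_def arc_integrand_def
  proof (rule integral_cong)
    fix t :: real assume t: "t \<in> {0..s}"
    show "1 / sqrt (1 - t powr (2 * real a)) = 1 / sqrt (1 - t ^ (2 * a))"
    proof (cases "t = 0")
      case True
      with assms(1) show ?thesis by (simp add: zero_power)
    next
      case False
      then have "t powr (real (2*a)) = t ^ (2*a)" using t by (intro powr_realpow) auto
      then show ?thesis by simp
    qed
  qed
  moreover have "integral {-1..0} (arc_integrand a) + integral {0..s} (arc_integrand a) = integral {-1..s} (arc_integrand a)"
    by (rule Henstock_Kurzweil_Integration.integral_combine)
       (use assms in \<open>auto intro: integrable_on_subinterval[OF arc_integrand_integrable]\<close>)
  ultimately show ?thesis by (simp add: gasin_def)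
qed

lemma gpi_eq_gasin:
  assumes "a \<ge> 1"
  shows "gpi (real a) = 2 * gasin a 1"
  using gF_eq_gasin[OF assms, of 1] by (simp add: gpi_def gF_def)

lemma gasin_minus:
  assumes "a \<ge> 1" "\<bar>y\<bar> \<le> 1"
  shows "gasin a (- y) = - gasin a y"
proof -
  have *: "gasin a (-y) = - gasin a y" if y: "0 \<le> y" "y \<le> 1" for y
  proof -
    have "integral {-1..-y} (arc_integrand a) + integral {-y..0} (arc_integrand a) = integral {-1..0} (arc_integrand a)"
      by (rule Henstock_Kurzweil_Integration.integral_combine)
         (use y assms in \<open>auto intro: integrable_on_subinterval[OF arc_integrand_integrable]\<close>)
    moreover have "integral {-1..0} (arc_integrand a) + integral {0..y} (arc_integrand a) = integral {-1..y} (arc_integrand a)"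
      by (rule Henstock_Kurzweil_Integration.integral_combine)
         (use y assms in \<open>auto intro: integrable_on_subinterval[OF arc_integrand_integrable]\<close>)
    moreover have "integral {-y..-0} (\<lambda>t. arc_integrand a (-t)) = integral {0..y} (arc_integrand a)"
      by (rule Henstock_Kurzweil_Integration.integral_reflect_real)
    moreover have "(\<lambda>t. arc_integrand a (-t)) = arc_integrand a"
      by (auto simp: arc_integrand_def fun_eq_iff)
    ultimately show ?thesis by (simp add: gasin_def)
  qed
  show ?thesis
  proof (cases "0 \<le> y")
    case True with *[of y] assms show ?thesis by simp
  next
    case False
    then have "gasin a (- (- y)) = - gasin a (- y)" using *[of "-y"] assms by simp
    then show ?thesis by (metis minus_minus)
  qed
qed

lemma gpi_pos:
  assumes "a \<ge> 1"
  shows "gpi (real a) > 0"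
proof -
  have "gasin a 0 < gasin a 1"
    by (rule strict_mono_onD[OF gasin_strict_mono[OF assms]]) auto
  then show ?thesis using gpi_eq_gasin[OF assms] by simp
qed

lemma gasin_inj:
  assumes "a \<ge> 1" "\<bar>y\<bar> \<le> 1" "\<bar>z\<bar> \<le> 1" "gasin a y = gasin a z"
  shows "y = z"
proof -
  have "y \<in> {-1..1}" "z \<in> {-1..1}" using assms(2,3) by (auto simp: abs_le_iff)
  then have "y < z \<Longrightarrow> gasin a y < gasin a z" "z < y \<Longrightarrow> gasin a z < gasin a y"
    using strict_mono_onD[OF gasin_strict_mono[OF assms(1)]] by blast+
  then show ?thesis using assms(4) by (cases y z rule: linorder_cases) simp_all
qed

text \<open>Gives the definite description in \<open>gsin0\<close> its meaning: a solution exists by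
  the intermediate value theorem and is unique because \<open>gasin\<close> is injective.\<close>

lemma gsin0_props:
  assumes "a \<ge> 1" "0 \<le> s" "s \<le> gpi (real a) / 2"
  shows "0 \<le> gsin0 (real a) s" "gsin0 (real a) s \<le> 1" "gasin a (gsin0 (real a) s) = s"
proof -
  have "continuous_on {0..1} (gasin a)"
    using continuous_on_gasin[OF assms(1)] by (rule continuous_on_subset) auto
  then obtain y where y: "0 \<le> y" "y \<le> 1" "gasin a y = s"
    using IVT'[of "gasin a" 0 s 1] assms gpi_eq_gasin[OF assms(1)] by auto
  have "gsin0 (real a) s = y"
    unfolding gsin0_def
  proof (rule the_equality)
    show "0 \<le> y \<and> y \<le> 1 \<and> gF (real a) y = s" using y gF_eq_gasin[OF assms(1)] by auto
  next
    fix z assume "0 \<le> z \<and> z \<le> 1 \<and> gF (real a) z = s"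
    then show "z = y" using y gF_eq_gasin[OF assms(1)] gasin_inj[OF assms(1), of z y] by auto
  qed
  with y show "0 \<le> gsin0 (real a) s" "gsin0 (real a) s \<le> 1" "gasin a (gsin0 (real a) s) = s" by auto
qed

section \<open>Symmetries and periodicity of \<open>gsin\<close>\<close>

lemma gsin_half_reflect: "gsin_half a (gpi a - s) = gsin_half a s"
proof -
  have "gpi a - s = s" if "gpi a - s \<le> gpi a / 2" "s \<le> gpi a / 2"
    using that by linarith
  moreover have "gpi a - s \<le> gpi a / 2 \<or> s \<le> gpi a / 2" by linarith
  ultimately show ?thesis by (auto simp: gsin_half_def)
qed

lemma gsin_periodic_int:
  assumes "gpi a > 0"
  shows "gsin a (s + 2 * gpi a * of_int k) = gsin a s"
proof -
  have "(s + 2 * gpi a * of_int k) / (2 * gpi a) = s / (2 * gpi a) + of_int k" using assms by (simp add: field_simps)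
  then have "\<lfloor>(s + 2 * gpi a * of_int k) / (2 * gpi a)\<rfloor> = \<lfloor>s / (2 * gpi a)\<rfloor> + k" by simp
  then show ?thesis by (simp add: gsin_def algebra_simps)
qed

lemma gsin_base:
  assumes "gpi a > 0" "0 \<le> s" "s < 2 * gpi a"
  shows "gsin a s = (if s \<le> gpi a then gsin_half a s else - gsin_half a (2 * gpi a - s))"
proof -
  have "\<lfloor>s / (2 * gpi a)\<rfloor> = 0" using assms by (simp add: floor_eq_iff)
  then show ?thesis by (simp add: gsin_def)
qed

lemma gsin_half_0: "a \<ge> 1 \<Longrightarrow> gsin_half (real a) 0 = 0"
  using gsin0_props[of a 0] gpi_pos[of a] gasin_inj[of a "gsin0 (real a) 0" 0]
  by (simp add: gsin_half_def)

lemma gsin_half_gpi: "a \<ge> 1 \<Longrightarrow> gsin_half (real a) (gpi (real a)) = 0"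
  using gsin_half_reflect[of "real a" 0] gsin_half_0[of a] by simp

text \<open>Source of the half-period symmetry of the oscillator. On the second half of the period
  \<open>gsin\<close> is minus the first half read backwards, and \<open>gsin_half_reflect\<close>
  turns it forwards.\<close>

lemma gsin_antiperiodic:
  assumes "a \<ge> 1"
  shows "gsin (real a) (s + gpi (real a)) = - gsin (real a) s"
proof -
  let ?p = "gpi (real a)"
  have p: "?p > 0" using gpi_pos[OF assms] .
  obtain k r where r: "s = r + 2 * ?p * of_int k" "0 \<le> r" "r < 2 * ?p"
    using period_reduce[of "2 * ?p" s] p by (metis zero_less_mult_iff zero_less_numeral)
  have e: "gsin (real a) (s + ?p) = gsin (real a) (r + ?p)" "gsin (real a) s = gsin (real a) r"
    using gsin_periodic_int[OF p, of "r + ?p" k] gsin_periodic_int[OF p, of r k] r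
    by (simp_all add: algebra_simps)
  have "gsin (real a) (r + ?p) = - gsin (real a) r"
  proof (cases "r < ?p")
    case True
    then show ?thesis
      using r p gsin_base[OF p, of r] gsin_base[OF p, of "r + ?p"] gsin_half_0[OF assms] gsin_half_gpi[OF assms]
        gsin_half_reflect[of "real a" r]
      by auto
  next
    case False
    have "gsin (real a) (r + ?p) = gsin (real a) (r - ?p)"
      using gsin_periodic_int[OF p, of "r - ?p" 1] by (simp add: algebra_simps)
    then show ?thesis
      using r p gsin_base[OF p, of r] gsin_base[OF p, of "r - ?p"] gsin_half_0[OF assms] gsin_half_gpi[OF assms]
        gsin_half_reflect[of "real a" "r - ?p"] False
      by auto
  qed
  with e show ?thesis by simp
qed

lemma gsin_gpi_minus:
  assumes "a \<ge> 1"
  shows "gsin (real a) (gpi (real a) - s) = gsin (real a) s"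
proof -
  let ?p = "gpi (real a)"
  have p: "?p > 0" using gpi_pos[OF assms] .
  have *: "gsin (real a) (?p - r) = gsin (real a) r" if "0 \<le> r" "r < ?p" for r
  proof (cases "r = 0")
    case True
    then show ?thesis using p gsin_base[OF p, of 0] gsin_base[OF p, of ?p] gsin_half_0[OF assms] gsin_half_gpi[OF assms] by simp
  next
    case False
    then show ?thesis
      using that p gsin_base[OF p, of r] gsin_base[OF p, of "?p - r"] gsin_half_reflect[of "real a" r]
      by auto
  qed
  obtain k r where r: "s = r + 2 * ?p * of_int k" "0 \<le> r" "r < 2 * ?p"
    using period_reduce[of "2 * ?p" s] p by (metis zero_less_mult_iff zero_less_numeral)
  have e: "gsin (real a) (?p - s) = gsin (real a) (?p - r)" "gsin (real a) s = gsin (real a) r"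
    using gsin_periodic_int[OF p, of "?p - s" k] gsin_periodic_int[OF p, of r k] r
    by (simp_all add: algebra_simps)
  show ?thesis
  proof (cases "r < ?p")
    case True with e * r show ?thesis by simp
  next
    case False
    have "gsin (real a) r = - gsin (real a) (r - ?p)"
      using gsin_antiperiodic[OF assms, of "r - ?p"] by simp
    also have "\<dots> = - gsin (real a) (2 * ?p - r)" using *[of "r - ?p"] r False by simp
    also have "\<dots> = gsin (real a) (?p - r)"
      using gsin_antiperiodic[OF assms, of "?p - r"] by (simp add: algebra_simps)
    finally show ?thesis using e by simp
  qed
qed

lemma gsin_minus:
  assumes "a \<ge> 1"
  shows "gsin (real a) (- s) = - gsin (real a) s"
proof -
  have "gsin (real a) (gpi (real a) - s) = - gsin (real a) (-s)"
    using gsin_antiperiodic[OF assms, of "-s"] by (simp only: add.commute[of "-s"] diff_conv_add_uminus)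
  then show ?thesis using gsin_gpi_minus[OF assms, of s] by linarith
qed

lemma gasin_gsin:
  assumes "a \<ge> 1" "\<bar>s\<bar> \<le> gpi (real a) / 2"
  shows "\<bar>gsin (real a) s\<bar> \<le> 1" "gasin a (gsin (real a) s) = s"
proof -
  let ?p = "gpi (real a)"
  have p: "?p > 0" using gpi_pos[OF assms(1)] .
  have *: "\<bar>gsin (real a) s\<bar> \<le> 1 \<and> gasin a (gsin (real a) s) = s" if "0 \<le> s" "s \<le> ?p / 2" for s
  proof -
    have "gsin (real a) s = gsin0 (real a) s"
      using that p gsin_base[OF p, of s] by (auto simp: gsin_half_def)
    with gsin0_props[OF assms(1), of s] that show ?thesis by auto
  qed
  have "\<bar>gsin (real a) s\<bar> \<le> 1 \<and> gasin a (gsin (real a) s) = s"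
  proof (cases "0 \<le> s")
    case True with * assms show ?thesis by auto
  next
    case False
    with *[of "-s"] assms gsin_minus[OF assms(1), of s] gasin_minus[OF assms(1), of "gsin (real a) s"]
    show ?thesis by auto
  qed
  then show "\<bar>gsin (real a) s\<bar> \<le> 1" "gasin a (gsin (real a) s) = s" by auto
qed


lemma gsin_gasin:
  assumes "a \<ge> 1" "\<bar>y\<bar> \<le> 1"
  shows "gsin (real a) (gasin a y) = y" "\<bar>gasin a y\<bar> \<le> gpi (real a) / 2"
proof -
  have y: "y \<in> {-1..1}" using assms(2) by (simp add: abs_le_iff)
  have "gasin a y \<le> gasin a 1"
    by (rule strict_mono_on_leD[OF gasin_strict_mono[OF assms(1)] y]) (use y in simp_all)
  moreover have "gasin a (-1) \<le> gasin a y"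
    by (rule strict_mono_on_leD[OF gasin_strict_mono[OF assms(1)] _ y]) (use y in simp_all)
  ultimately show *: "\<bar>gasin a y\<bar> \<le> gpi (real a) / 2"
    using gasin_minus[of a 1] gpi_eq_gasin[of a] assms by (simp add: abs_le_iff)
  show "gsin (real a) (gasin a y) = y"
    by (rule gasin_inj[OF assms(1) gasin_gsin(1)[OF assms(1) *] assms(2) gasin_gsin(2)[OF assms(1) *]])
qed

section \<open>Continuity and derivatives of \<open>gsin\<close> and \<open>gcos\<close>\<close>

lemma gsin_half_gpi_eq_1:
  assumes "a \<ge> 1"
  shows "gsin (real a) (gpi (real a) / 2) = 1"
  using gsin_gasin(1)[OF assms, of 1] gpi_eq_gasin[OF assms] by simp

text \<open>This period has the maximum \<open>gpi / 2\<close> in its interior. On its left half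
  \<open>gsin\<close> inverts a continuous injection of a compact interval; reflection about the
  maximum gives the right half.\<close>

lemma continuous_on_gsin_period:
  assumes "a \<ge> 1"
  shows "continuous_on {- gpi (real a) / 2..3 * gpi (real a) / 2} (gsin (real a))"
proof -
  let ?p = "gpi (real a)"
  have p: "?p > 0" using gpi_pos[OF assms] .
  have "gasin a ` {-1..1} = {- ?p / 2..?p / 2}"
  proof (intro equalityI subsetI)
    fix s assume "s \<in> gasin a ` {-1..1}"
    then obtain y where "s = gasin a y" "\<bar>y\<bar> \<le> 1" by (auto simp: abs_le_iff)
    with gsin_gasin(2)[OF assms, of y] have "\<bar>s\<bar> \<le> ?p / 2" by simp
    then show "s \<in> {- ?p / 2..?p / 2}" by (auto simp: abs_le_iff)
  next
    fix s assume "s \<in> {- ?p / 2..?p / 2}"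
    then have "\<bar>s\<bar> \<le> ?p / 2" by auto
    from gasin_gsin[OF assms this] show "s \<in> gasin a ` {-1..1}"
      by (intro image_eqI[of _ _ "gsin (real a) s"]) (auto simp: abs_le_iff)
  qed
  moreover have "continuous_on (gasin a ` {-1..1}) (gsin (real a))"
  proof (rule continuous_on_inv[OF continuous_on_gasin[OF assms]])
    show "\<forall>y\<in>{-1..1}. gsin (real a) (gasin a y) = y"
    proof
      fix y :: real assume "y \<in> {-1..1}"
      then have "\<bar>y\<bar> \<le> 1" by (auto simp: abs_le_iff)
      then show "gsin (real a) (gasin a y) = y" by (rule gsin_gasin(1)[OF assms])
    qed
  qed simp
  ultimately have c: "continuous_on {- ?p / 2..?p / 2} (gsin (real a))" by simp
  have "continuous_on {?p / 2..3 * ?p / 2} (\<lambda>s. gsin (real a) (?p - s))"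
    by (rule continuous_on_compose2[OF c]) (auto intro!: continuous_intros)
  then have "continuous_on {?p / 2..3 * ?p / 2} (gsin (real a))"
    using gsin_gpi_minus[OF assms] by simp
  with c have "continuous_on ({- ?p / 2..?p / 2} \<union> {?p / 2..3 * ?p / 2}) (gsin (real a))"
    by (intro continuous_on_closed_Un) auto
  moreover have "{- ?p / 2..?p / 2} \<union> {?p / 2..3 * ?p / 2} = {- ?p / 2..3 * ?p / 2}"
    using p by auto
  ultimately show ?thesis by simp
qed

lemma isCont_gsin_period:
  assumes "a \<ge> 1" "- gpi (real a) / 2 < s" "s < 3 * gpi (real a) / 2"
  shows "isCont (gsin (real a)) s"
  using continuous_on_interior[OF continuous_on_gsin_period[OF assms(1)], of s] assms by simp

lemma gsin_abs_less_1:
  assumes "a \<ge> 1" "\<bar>s\<bar> < gpi (real a) / 2"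
  shows "\<bar>gsin (real a) s\<bar> < 1"
proof -
  have "\<bar>gsin (real a) s\<bar> \<le> 1" "gasin a (gsin (real a) s) = s"
    using gasin_gsin[OF assms(1), of s] assms(2) by auto
  moreover have "\<bar>gsin (real a) s\<bar> \<noteq> 1"
  proof
    assume "\<bar>gsin (real a) s\<bar> = 1"
    then have "gsin (real a) s = 1 \<or> gsin (real a) s = -1" by linarith
    then show False using calculation(2) gpi_eq_gasin[OF assms(1)] gasin_minus[OF assms(1), of 1] assms(2) by auto
  qed
  ultimately show ?thesis by linarith
qed

lemma DERIV_gsin_inner:
  assumes "a \<ge> 1" "\<bar>s\<bar> < gpi (real a) / 2"
  shows "DERIV (gsin (real a)) s :> sqrt (1 - gsin (real a) s ^ (2 * a))"
proof -
  let ?p = "gpi (real a)"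
  have p: "?p > 0" using gpi_pos[OF assms(1)] .
  have l: "gsin (real a) s ^ (2 * a) < 1"
    by (rule even_power_less_1[OF assms(1) gsin_abs_less_1[OF assms]])
  have "DERIV (gsin (real a)) s :> inverse (1 / sqrt (1 - gsin (real a) s ^ (2 * a)))"
  proof (rule DERIV_inverse_function[where f = "gasin a" and a = "- ?p / 2" and b = "?p / 2"])
    show "DERIV (gasin a) (gsin (real a) s) :> 1 / sqrt (1 - gsin (real a) s ^ (2 * a))"
      by (rule gasin_has_derivative[OF assms(1) gsin_abs_less_1[OF assms]])
    show "isCont (gsin (real a)) s" using assms p by (intro isCont_gsin_period) auto
    show "gasin a (gsin (real a) y) = y" if "- ?p / 2 < y" "y < ?p / 2" for y
      using that by (intro gasin_gsin(2)[OF assms(1)]) auto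
  qed (use l assms in auto)
  then show ?thesis by simp
qed

lemma DERIV_gsin_top:
  assumes "a \<ge> 1"
  shows "DERIV (gsin (real a)) (gpi (real a) / 2) :> 0"
proof -
  let ?p = "gpi (real a)" and ?S = "gsin (real a)"
  \<comment> \<open>Right of the top, reflection about \<open>?p / 2\<close> reverses the sign of
    the derivative; both one-sided limits are zero.\<close>
  let ?f' = "\<lambda>s. (if s < ?p / 2 then 1 else -1) * sqrt (1 - ?S s ^ (2 * a))"
  have p: "?p > 0" using gpi_pos[OF assms] .
  show ?thesis
  proof (rule DERIV_from_limit[where f' = ?f'])
    show c: "isCont ?S (?p / 2)" using p by (intro isCont_gsin_period assms) auto
    have "eventually (\<lambda>s. s \<in> {-?p/2<..<3*?p/2}) (nhds (?p/2))"
      by (rule eventually_nhds_in_open) (use p in auto)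
    then have "eventually (\<lambda>s. s \<in> {-?p/2<..<3*?p/2} \<and> s \<noteq> ?p/2) (at (?p/2))"
      by (auto simp: eventually_at_filter elim: eventually_mono)
    then show "\<forall>\<^sub>F s in at (?p/2). DERIV ?S s :> ?f' s"
    proof eventually_elim
      case (elim s)
      show ?case
      proof (cases "s < ?p / 2")
        case True
        then show ?thesis using DERIV_gsin_inner[OF assms, of s] elim by (auto simp: abs_less_iff)
      next
        case False
        then have "\<bar>?p - s\<bar> < ?p / 2" using elim unfolding abs_less_iff by auto
        from DERIV_gsin_inner[OF assms this]
        have "DERIV (\<lambda>s. ?S (?p - s)) s :> sqrt (1 - ?S (?p - s) ^ (2 * a)) * (-1)"
          by (rule DERIV_chain2) (auto intro!: derivative_eq_intros)
        then show ?thesis using gsin_gpi_minus[OF assms] False by simp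
      qed
    qed
    have "isCont (\<lambda>s. sqrt (1 - ?S s ^ (2 * a))) (?p/2)"
      using c by (intro continuous_intros)
    then have "((\<lambda>s. sqrt (1 - ?S s ^ (2 * a))) \<longlongrightarrow> 0) (at (?p/2))"
      by (simp add: isCont_def gsin_half_gpi_eq_1[OF assms])
    then have "((\<lambda>s. \<bar>sqrt (1 - ?S s ^ (2 * a))\<bar>) \<longlongrightarrow> 0) (at (?p/2))"
      by (rule tendsto_rabs_zero)
    then show "(?f' \<longlongrightarrow> 0) (at (?p/2))"
      by (rule Lim_null_comparison[rotated]) (intro always_eventually allI, simp add: abs_mult)
  qed
qed

lemma power_even_le_1:
  fixes t :: real
  assumes "\<bar>t\<bar> \<le> 1"
  shows "t ^ (2 * a) \<le> 1"
  using power_le_one[of "\<bar>t\<bar>" "2*a"] assms by (simp add: power_even_abs)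

lemma gcos_inner:
  assumes "a \<ge> 1" "\<bar>s\<bar> < gpi (real a) / 2"
  shows "gcos (real a) s = sqrt (1 - gsin (real a) s ^ (2 * a))"
  unfolding gcos_def by (rule DERIV_imp_deriv[OF DERIV_gsin_inner[OF assms]])

lemma gcos_top: "a \<ge> 1 \<Longrightarrow> gcos (real a) (gpi (real a) / 2) = 0"
  unfolding gcos_def by (rule DERIV_imp_deriv[OF DERIV_gsin_top])

lemma DERIV_gsin_shift:
  assumes "a \<ge> 1" "DERIV (gsin (real a)) s :> D"
  shows "DERIV (gsin (real a)) (s + gpi (real a)) :> - D" "gcos (real a) (s + gpi (real a)) = - gcos (real a) s"
proof -
  have "DERIV (\<lambda>s. gsin (real a) (s + gpi (real a))) s :> - D"
    using DERIV_minus[OF assms(2)] gsin_antiperiodic[OF assms(1)] by simp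
  then show "DERIV (gsin (real a)) (s + gpi (real a)) :> - D"
    by (simp add: DERIV_shift)
  with assms(2) show "gcos (real a) (s + gpi (real a)) = - gcos (real a) s"
    by (simp add: gcos_def DERIV_imp_deriv)
qed

lemma DERIV_gcos_inner:
  assumes "a \<ge> 1" "\<bar>s\<bar> < gpi (real a) / 2"
  shows "DERIV (gcos (real a)) s :> - (real a * gsin (real a) s ^ (2 * a - 1))"
proof -
  let ?S = "gsin (real a)"
  have l: "?S s ^ (2 * a) < 1"
    by (rule even_power_less_1[OF assms(1) gsin_abs_less_1[OF assms]])
  have "DERIV (\<lambda>s. sqrt (1 - ?S s ^ (2 * a))) s :>
     - (real (2 * a) * sqrt (1 - ?S s ^ (2 * a)) * ?S s ^ (2 * a - 1)) * (inverse (sqrt (1 - ?S s ^ (2 * a))) / 2)"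
    by (rule derivative_eq_intros DERIV_gsin_inner[OF assms] refl | use l in simp)+
  also have "- (real (2 * a) * sqrt (1 - ?S s ^ (2 * a)) * ?S s ^ (2 * a - 1)) * (inverse (sqrt (1 - ?S s ^ (2 * a))) / 2)
    = - (real a * ?S s ^ (2 * a - 1))"
    using l by (simp add: field_simps)
  finally have d: "DERIV (\<lambda>s. sqrt (1 - ?S s ^ (2 * a))) s :> - (real a * ?S s ^ (2 * a - 1))" .
  have "eventually (\<lambda>s. s \<in> {-gpi (real a)/2<..<gpi (real a)/2}) (nhds s)"
    by (rule eventually_nhds_in_open) (use assms in auto)
  then have "eventually (\<lambda>s. gcos (real a) s = sqrt (1 - ?S s ^ (2 * a))) (nhds s)"
    by eventually_elim (use gcos_inner[OF assms(1)] in \<open>auto simp: abs_less_iff\<close>)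
  with d show ?thesis by (subst DERIV_cong_ev) auto
qed

lemma DERIV_gsin_half_period:
  assumes "a \<ge> 1" "- gpi (real a) / 2 < s" "s \<le> gpi (real a) / 2"
  shows "DERIV (gsin (real a)) s :> gcos (real a) s"
proof (cases "s = gpi (real a) / 2")
  case True
  show ?thesis unfolding True gcos_top[OF assms(1)] by (rule DERIV_gsin_top[OF assms(1)])
next
  case False
  then have "\<bar>s\<bar> < gpi (real a) / 2" using assms by (auto simp: abs_less_iff)
  then show ?thesis using DERIV_gsin_inner[OF assms(1), of s] gcos_inner[OF assms(1), of s] by simp
qed

lemma gsin_gcos_pythagoras_half_period:
  assumes "a \<ge> 1" "- gpi (real a) / 2 < s" "s \<le> gpi (real a) / 2"
  shows "(gcos (real a) s)\<^sup>2 + gsin (real a) s ^ (2 * a) = 1"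
proof (cases "s = gpi (real a) / 2")
  case True
  show ?thesis unfolding True gcos_top[OF assms(1)] gsin_half_gpi_eq_1[OF assms(1)] by simp
next
  case False
  then have s: "\<bar>s\<bar> < gpi (real a) / 2" using assms by (auto simp: abs_less_iff)
  show ?thesis
    using gcos_inner[OF assms(1) s] power_even_le_1[of "gsin (real a) s" a] gsin_abs_less_1[OF assms(1) s] by simp
qed

text \<open>The formula \<open>gcos = sqrt (1 - gsin ^ (2 * a))\<close> cannot be differentiated
  where the square root vanishes. But \<open>gcos\<close> is continuous there and the claimed
  derivative is correct on both sides, so \<open>DERIV_from_limit\<close> applies once more.\<close>

lemma DERIV_gcos_top:
  assumes "a \<ge> 1"
  shows "DERIV (gcos (real a)) (gpi (real a) / 2) :> - (real a * gsin (real a) (gpi (real a) / 2) ^ (2 * a - 1))"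
proof -
  let ?p = "gpi (real a)" and ?S = "gsin (real a)" and ?C = "gcos (real a)"
  have p: "?p > 0" using gpi_pos[OF assms] .
  have S: "isCont ?S (?p / 2)" using p by (intro isCont_gsin_period assms) auto
  have "eventually (\<lambda>s. s \<in> {-?p/2<..<3*?p/2}) (nhds (?p/2))"
    by (rule eventually_nhds_in_open) (use p in auto)
  then have ev: "eventually (\<lambda>s. s \<in> {-?p/2<..<3*?p/2} \<and> s \<noteq> ?p/2) (at (?p/2))"
    by (auto simp: eventually_at_filter elim: eventually_mono)
  have right: "?C s = - ?C (s - ?p)" "?S s = - ?S (s - ?p)" "DERIV (?C) s :> - (real a * ?S s ^ (2 * a - 1))"
    if s: "?p / 2 < s" "s < 3 * ?p / 2" for s
  proof -
    have *: "\<bar>s - ?p\<bar> < ?p / 2" using s unfolding abs_less_iff by auto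
    show "?C s = - ?C (s - ?p)"
      using DERIV_gsin_shift(2)[OF assms DERIV_gsin_inner[OF assms *]] by simp
    show Sm: "?S s = - ?S (s - ?p)" using gsin_antiperiodic[OF assms, of "s - ?p"] by simp
    have "DERIV (\<lambda>u. - ?C (u + - ?p)) s :> - (- (real a * ?S (s + - ?p) ^ (2 * a - 1)))"
      by (rule DERIV_minus, subst DERIV_shift[symmetric]) (use DERIV_gcos_inner[OF assms *] in simp)
    moreover have "- (- (real a * ?S (s + - ?p) ^ (2 * a - 1))) = - (real a * ?S s ^ (2 * a - 1))"
    proof -
      have "odd (2 * a - 1)" using assms by simp
      then show ?thesis using Sm by (simp add: power_minus_odd)
    qed
    moreover have "eventually (\<lambda>u. ?C u = - ?C (u + - ?p)) (nhds s)"
    proof -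
      have "eventually (\<lambda>u. u \<in> {?p/2<..<3*?p/2}) (nhds s)"
        by (rule eventually_nhds_in_open) (use s in auto)
      then show ?thesis
      proof eventually_elim
        case (elim u)
        then have *: "\<bar>u - ?p\<bar> < ?p / 2" unfolding abs_less_iff by auto
        then show ?case using DERIV_gsin_shift(2)[OF assms DERIV_gsin_inner[OF assms *]] by simp
      qed
    qed
    ultimately show "DERIV (?C) s :> - (real a * ?S s ^ (2 * a - 1))"
      by (subst DERIV_cong_ev[OF refl _ refl]) auto
  qed
  show ?thesis
  proof (rule DERIV_from_limit[where f' = "\<lambda>s. - (real a * ?S s ^ (2 * a - 1))"])
    have "isCont (\<lambda>s. sqrt (1 - ?S s ^ (2 * a))) (?p/2)"
      using S by (intro continuous_intros)
    then have "((\<lambda>s. sqrt (1 - ?S s ^ (2 * a))) \<longlongrightarrow> 0) (at (?p/2))"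
      by (simp add: isCont_def gsin_half_gpi_eq_1[OF assms])
    moreover have "eventually (\<lambda>s. norm (?C s) \<le> sqrt (1 - ?S s ^ (2 * a))) (at (?p/2))"
      using ev
    proof eventually_elim
      case (elim s)
      show ?case
      proof (cases "s < ?p / 2")
        case True
        then have "\<bar>s\<bar> < ?p / 2" using elim by (auto simp: abs_less_iff)
        then show ?thesis using gcos_inner[OF assms, of s] power_even_le_1[of "?S s" a] gsin_abs_less_1[OF assms, of s] by simp
      next
        case False
        then have "?p / 2 < s" "s < 3 * ?p / 2" using elim by auto
        moreover from this have *: "\<bar>s - ?p\<bar> < ?p / 2" unfolding abs_less_iff by auto
        ultimately show ?thesis
          using right(1,2)[of s] gcos_inner[OF assms *] power_even_le_1[of "?S (s - ?p)" a] gsin_abs_less_1[OF assms *] by simp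
      qed
    qed
    ultimately have "(?C \<longlongrightarrow> 0) (at (?p/2))" by (rule Lim_null_comparison[rotated])
    then show "isCont ?C (?p / 2)" by (simp add: isCont_def gcos_top[OF assms])
    show "\<forall>\<^sub>F s in at (?p/2). DERIV ?C s :> - (real a * ?S s ^ (2 * a - 1))"
      using ev
    proof eventually_elim
      case (elim s)
      show ?case
      proof (cases "s < ?p / 2")
        case True
        then show ?thesis using DERIV_gcos_inner[OF assms, of s] elim by (auto simp: abs_less_iff)
      next
        case False
        then show ?thesis using right(3)[of s] elim by auto
      qed
    qed
    have "isCont (\<lambda>s. - (real a * ?S s ^ (2 * a - 1))) (?p / 2)"
      using S by (intro continuous_intros)
    then show "((\<lambda>s. - (real a * ?S s ^ (2 * a - 1))) \<longlongrightarrow> - (real a * ?S (?p/2) ^ (2 * a - 1))) (at (?p / 2))"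
      by (simp add: isCont_def)
  qed
qed

lemma gpi_reduce:
  assumes "a \<ge> 1"
  obtains r and k :: int where "s = r + 2 * gpi (real a) * of_int k"
    "- gpi (real a) / 2 < r" "r \<le> 3 * gpi (real a) / 2"
proof -
  let ?p = "gpi (real a)"
  have "2 * ?p > 0" using gpi_pos[OF assms] by simp
  \<comment> \<open>Reducing \<open>3 * ?p / 2 - s\<close> instead of \<open>s\<close> puts the
    closed end on the right, so that the period splits into \<open>(-p/2, p/2]\<close> and its shift
    by \<open>p\<close>.\<close>
  then obtain k r where "3 * ?p / 2 - s = r + 2 * ?p * of_int k" "0 \<le> r" "r < 2 * ?p"
    using period_reduce[of "2 * ?p"] by metis
  then show thesis by (intro that[of "3 * ?p / 2 - r" "- k"]) (auto simp: algebra_simps)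
qed

lemma DERIV_gsin:
  assumes "a \<ge> 1"
  shows "DERIV (gsin (real a)) s :> gcos (real a) s"
proof -
  let ?p = "gpi (real a)" and ?S = "gsin (real a)"
  have p: "?p > 0" using gpi_pos[OF assms] .
  obtain r k where r: "s = r + 2 * ?p * of_int k" "- ?p / 2 < r" "r \<le> 3 * ?p / 2"
    using gpi_reduce[OF assms] .
  have "\<exists>D. DERIV ?S r :> D"
  proof (cases "r \<le> ?p / 2")
    case True
    then show ?thesis using DERIV_gsin_half_period[OF assms r(2)] by blast
  next
    case False
    then have "DERIV ?S (r - ?p) :> gcos (real a) (r - ?p)"
      using r p by (intro DERIV_gsin_half_period[OF assms]) auto
    from DERIV_gsin_shift(1)[OF assms this] show ?thesis by auto
  qed
  then obtain D where "DERIV ?S r :> D" by blast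
  moreover have "(\<lambda>u. ?S (u + 2 * ?p * of_int k)) = ?S"
    using gsin_periodic_int[OF p] by blast
  ultimately have "DERIV ?S s :> D"
    using DERIV_shift[of ?S D r "2 * ?p * of_int k"] by (simp add: r(1))
  then show ?thesis by (simp add: gcos_def DERIV_imp_deriv)
qed

lemma gcos_antiperiodic: "a \<ge> 1 \<Longrightarrow> gcos (real a) (s + gpi (real a)) = - gcos (real a) s"
  by (rule DERIV_gsin_shift(2)[OF _ DERIV_gsin])

lemma DERIV_gcos_shift:
  assumes "a \<ge> 1"
  shows "DERIV (gcos (real a)) (s + gpi (real a)) :> - (real a * gsin (real a) (s + gpi (real a)) ^ (2 * a - 1))
     \<longleftrightarrow> DERIV (gcos (real a)) s :> - (real a * gsin (real a) s ^ (2 * a - 1))"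
proof -
  let ?p = "gpi (real a)" and ?S = "gsin (real a)" and ?C = "gcos (real a)"
  have odd: "odd (2 * a - 1)" using assms by simp
  have "(\<lambda>u. ?C (u + ?p)) = (\<lambda>u. - ?C u)" using gcos_antiperiodic[OF assms] by blast
  then have "DERIV ?C (s + ?p) :> D \<longleftrightarrow> DERIV (\<lambda>u. - ?C u) s :> D" for D
    using DERIV_shift[of ?C D s ?p] by (simp only:)
  moreover have "DERIV (\<lambda>u. - ?C u) s :> D \<longleftrightarrow> DERIV ?C s :> - D" for D
    using DERIV_minus[of ?C "-D" s UNIV] DERIV_minus[of "\<lambda>u. - ?C u" D s UNIV] by (simp only: minus_minus) blast
  ultimately show ?thesis by (simp only: gsin_antiperiodic[OF assms] power_minus_odd[OF odd] mult_minus_right minus_minus)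
qed

lemma gcos_periodic_int:
  assumes "a \<ge> 1"
  shows "gcos (real a) (s + 2 * gpi (real a) * of_int k) = gcos (real a) s"
proof -
  have "(\<lambda>u. gsin (real a) (u + 2 * gpi (real a) * of_int k)) = gsin (real a)"
    using gsin_periodic_int[OF gpi_pos[OF assms]] by blast
  then have "DERIV (gsin (real a)) s :> gcos (real a) (s + 2 * gpi (real a) * of_int k)"
    using DERIV_gsin[OF assms, of "s + 2 * gpi (real a) * of_int k"]
    by (subst (asm) DERIV_shift) simp
  then show ?thesis using DERIV_gsin[OF assms, of s] by (rule DERIV_unique)
qed

lemma DERIV_gcos:
  assumes "a \<ge> 1"
  shows "DERIV (gcos (real a)) s :> - (real a * gsin (real a) s ^ (2 * a - 1))"
proof -
  let ?p = "gpi (real a)" and ?S = "gsin (real a)" and ?C = "gcos (real a)"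
  obtain r k where r: "s = r + 2 * ?p * of_int k" "- ?p / 2 < r" "r \<le> 3 * ?p / 2"
    using gpi_reduce[OF assms] .
  have base: "DERIV ?C u :> - (real a * ?S u ^ (2 * a - 1))" if "- ?p / 2 < u" "u \<le> ?p / 2" for u
  proof (cases "u = ?p / 2")
    case True show ?thesis unfolding True by (rule DERIV_gcos_top[OF assms])
  next
    case False then show ?thesis using that by (intro DERIV_gcos_inner[OF assms]) auto
  qed
  have "DERIV ?C r :> - (real a * ?S r ^ (2 * a - 1))"
  proof (cases "r \<le> ?p / 2")
    case True
    then show ?thesis using base r by blast
  next
    case False
    then show ?thesis using base[of "r - ?p"] DERIV_gcos_shift[OF assms, of "r - ?p"] r by simp
  qed
  moreover have "(\<lambda>u. ?C (u + 2 * ?p * of_int k)) = ?C"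
    using gcos_periodic_int[OF assms] by blast
  ultimately show ?thesis
    using DERIV_shift[of ?C _ r "2 * ?p * of_int k"] gsin_periodic_int[OF gpi_pos[OF assms], of r k] by (simp add: r(1))
qed

lemma gsin_gcos_pythagoras:
  assumes "a \<ge> 1"
  shows "(gcos (real a) s)\<^sup>2 + gsin (real a) s ^ (2 * a) = 1"
proof -
  let ?p = "gpi (real a)" and ?S = "gsin (real a)" and ?C = "gcos (real a)"
  obtain r k where r: "s = r + 2 * ?p * of_int k" "- ?p / 2 < r" "r \<le> 3 * ?p / 2"
    using gpi_reduce[OF assms] .
  have "(?C r)\<^sup>2 + ?S r ^ (2 * a) = 1"
  proof (cases "r \<le> ?p / 2")
    case True
    then show ?thesis using gsin_gcos_pythagoras_half_period[OF assms] r by blast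
  next
    case False
    then show ?thesis using gsin_gcos_pythagoras_half_period[OF assms, of "r - ?p"] r
       gsin_antiperiodic[OF assms, of "r - ?p"] gcos_antiperiodic[OF assms, of "r - ?p"] by simp
  qed
  then show ?thesis
    using gcos_periodic_int[OF assms, of r k] gsin_periodic_int[OF gpi_pos[OF assms], of r k] by (simp add: r(1))
qed

section \<open>Analytic tools\<close>

text \<open>Replaces the almost-everywhere chain rule along absolutely continuous curves: on short pieces
  the coefficients of a calibration are frozen, and the error is small compared with the length.\<close>
lemma nonincreasing_of_small_increments:
  fixes G m :: "real \<Rightarrow> real"
  assumes T: "0 \<le> T" and m: "continuous_on {0..T} m"
    and mono: "\<And>a b. 0 \<le> a \<Longrightarrow> a \<le> b \<Longrightarrow> b \<le> T \<Longrightarrow> m a \<le> m b"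
    and small: "\<And>e. e > 0 \<Longrightarrow> \<exists>d>0. \<forall>a b. 0 \<le> a \<longrightarrow> a \<le> b \<longrightarrow> b \<le> T \<longrightarrow> m b - m a < d
        \<longrightarrow> G b - G a \<le> e * (m b - m a)"
  shows "G T \<le> G 0"
proof -
  have "G T - G 0 \<le> e * (m T - m 0)" if e: "e > 0" for e
  proof -
    from small[OF e] obtain d where d: "d > 0"
      and step: "\<And>a b. 0 \<le> a \<Longrightarrow> a \<le> b \<Longrightarrow> b \<le> T \<Longrightarrow> m b - m a < d \<Longrightarrow> G b - G a \<le> e * (m b - m a)"
      by blast
    have ind: "G b - G a \<le> e * (m b - m a)"
      if "0 \<le> a" "a \<le> b" "b \<le> T" "m b - m a < real (Suc N) * d" for N a b
      using that
    proof (induction N arbitrary: b)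
      case 0
      then show ?case using step[of a b] by simp
    next
      case (Suc N)
      \<comment> \<open>Cut by the value of \<open>m\<close> and not by time: the last piece carries
        the fraction \<open>1 / (N + 2)\<close> of the increase, which is below \<open>d\<close>,
        and the induction hypothesis covers the rest.\<close>
      define y where "y = m a + (m b - m a) * (real (Suc N) / real (Suc (Suc N)))"
      have mab: "m a \<le> m b" using mono Suc.prems by blast
      have frac: "0 \<le> real (Suc N) / real (Suc (Suc N))" "real (Suc N) / real (Suc (Suc N)) \<le> 1" by auto
      have y: "m a \<le> y" "y \<le> m b"
        using mab frac mult_left_le[of "real (Suc N) / real (Suc (Suc N))" "m b - m a"]
        by (auto simp: y_def)
      have "continuous_on {a..b} m" using m by (rule continuous_on_subset) (use Suc.prems in auto)
      then obtain c where c: "a \<le> c" "c \<le> b" "m c = y" using IVT'[of m a y b] y Suc.prems by auto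
      have "m b - m a < (real N + 2) * d" using Suc.prems(4) by (simp add: algebra_simps)
      then have q: "(m b - m a) / (real N + 2) < d" by (simp add: divide_less_eq mult.commute)
      have e1: "m c - m a = (m b - m a) / (real N + 2) * real (Suc N)" using c(3) by (simp add: y_def)
      have e2: "m b - m c = (m b - m a) / (real N + 2)" using c(3) by (simp add: y_def field_simps)
      have "m c - m a < real (Suc N) * d" unfolding e1 using mult_strict_right_mono[OF q, of "real (Suc N)"] by (simp add: mult.commute)
      then have "G c - G a \<le> e * (m c - m a)" using Suc.IH[of c] c Suc.prems by simp
      moreover have "G b - G c \<le> e * (m b - m c)" using step[of c b] c Suc.prems e2 q by simp
      ultimately have "G b - G a \<le> e * (m c - m a) + e * (m b - m c)" by linarith
      then show ?case by (simp add: algebra_simps)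
    qed
    obtain N where "m T - m 0 < real N * d" using d reals_Archimedean3 by blast
    then have "m T - m 0 < real (Suc N) * d" using d by (simp add: algebra_simps)
    with ind[of 0 T N] T show ?thesis by simp
  qed
  then have *: "G T - G 0 \<le> e * (m T - m 0)" if "e > 0" for e using that by blast
  have mm: "m 0 \<le> m T" using mono T by simp
  have "G T - G 0 \<le> 0 + e" if e: "e > 0" for e
  proof -
    have "G T - G 0 \<le> e / (m T - m 0 + 1) * (m T - m 0)" using *[of "e / (m T - m 0 + 1)"] e mm by simp
    also have "\<dots> \<le> e" using e mm by (simp add: field_simps)
    finally show ?thesis by simp
  qed
  then have "G T - G 0 \<le> 0" by (rule field_le_epsilon)
  then show ?thesis by simp
qed

text \<open>The second-order Taylor remainder of a power, uniform on [-B, B]: it controls what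
  remains in the calibration after the first-order terms cancel. The induction multiplies the
  remainder for \<open>N\<close> by \<open>y\<close>.\<close>

lemma power_second_order_bound:
  fixes B :: real
  assumes "B \<ge> 0"
  shows "\<exists>M\<ge>0. \<forall>y z. \<bar>y\<bar> \<le> B \<longrightarrow> \<bar>z\<bar> \<le> B \<longrightarrow>
     \<bar>y ^ N - z ^ N - real N * z ^ (N - 1) * (y - z)\<bar> \<le> M * (y - z)\<^sup>2"
proof (induction N)
  case 0
  show ?case by (intro exI[of _ 0]) auto
next
  case (Suc N)
  then obtain M where M: "M \<ge> 0" "\<And>y z. \<bar>y\<bar> \<le> B \<Longrightarrow> \<bar>z\<bar> \<le> B \<Longrightarrow>
     \<bar>y ^ N - z ^ N - real N * z ^ (N - 1) * (y - z)\<bar> \<le> M * (y - z)\<^sup>2" by blast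
  show ?case
  proof (intro exI[of _ "B * M + real N * B ^ (N - 1)"] conjI allI impI)
    show "0 \<le> B * M + real N * B ^ (N - 1)" using assms M by simp
    fix y z :: real assume yz: "\<bar>y\<bar> \<le> B" "\<bar>z\<bar> \<le> B"
    let ?E = "y ^ N - z ^ N - real N * z ^ (N - 1) * (y - z)"
    \<comment> \<open>For \<open>N = 0\<close> the truncated exponent \<open>N - 1\<close> does no
      harm because of the factor \<open>real N\<close>.\<close>
    have zN: "real N * z ^ (N - 1) * z = real N * z ^ N" by (cases N) auto
    have "y ^ Suc N - z ^ Suc N - real (Suc N) * z ^ (Suc N - 1) * (y - z)
        = y * ?E + real N * z ^ (N - 1) * (y - z)\<^sup>2 + (real N * z ^ (N - 1) * z - real N * z ^ N) * (y - z)"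
      by (simp add: power2_eq_square algebra_simps)
    also have "\<dots> = y * ?E + real N * z ^ (N - 1) * (y - z)\<^sup>2" using zN by simp
    also have "\<bar>\<dots>\<bar> \<le> \<bar>y\<bar> * \<bar>?E\<bar> + real N * \<bar>z\<bar> ^ (N - 1) * (y - z)\<^sup>2"
      by (rule order_trans[OF abs_triangle_ineq]) (simp add: abs_mult power_abs)
    also have "\<dots> \<le> B * (M * (y - z)\<^sup>2) + real N * B ^ (N - 1) * (y - z)\<^sup>2"
      using yz M assms by (intro add_mono mult_mono mult_right_mono mult_left_mono power_mono) auto
    finally show "\<bar>y ^ Suc N - z ^ Suc N - real (Suc N) * z ^ (Suc N - 1) * (y - z)\<bar>
        \<le> (B * M + real N * B ^ (N - 1)) * (y - z)\<^sup>2" by (simp add: algebra_simps)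
  qed
qed

text \<open>\<open>w\<close> is the rate of a clock \<open>g\<close>. It may vanish, so
  \<open>\<tau>\<close> need not be differentiable, yet \<open>f\<close> is differentiable in the
  reading of the clock. On a short interval where \<open>q\<close> is within \<open>e\<close> of
  \<open>k\<close>, both \<open>(e + k) * g - f\<close> and \<open>(e - k) * g + f\<close> are
  nondecreasing; this uses only \<open>w \<ge> 0\<close>, which follows from the monotonicity of
  \<open>g\<close>.\<close>

lemma reparametrized_derivative:
  fixes f g w q \<tau> :: "real \<Rightarrow> real"
  assumes T: "0 \<le> T" and g: "strict_mono_on {0..T} g"
    and dg: "\<And>t. t \<in> {0..T} \<Longrightarrow> (g has_real_derivative w t) (at t within {0..T})"
    and df: "\<And>t. t \<in> {0..T} \<Longrightarrow> (f has_real_derivative w t * q t) (at t within {0..T})"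
    and q: "continuous_on {0..T} q"
    and \<tau>: "\<And>t. t \<in> {0..T} \<Longrightarrow> \<tau> (g t) = t"
  shows "g ` {0..T} = {g 0..g T}" "continuous_on {g 0..g T} \<tau>"
    "\<And>r. r \<in> {g 0..g T} \<Longrightarrow> \<tau> r \<in> {0..T} \<and> g (\<tau> r) = r"
    "\<And>r. r \<in> {g 0..g T} \<Longrightarrow> ((\<lambda>r. f (\<tau> r)) has_real_derivative q (\<tau> r)) (at r within {g 0..g T})"
proof -
  have gc: "continuous_on {0..T} g"
    using dg by (rule DERIV_continuous_on)
  have gmono: "g a \<le> g b" if "0 \<le> a" "a \<le> b" "b \<le> T" for a b
    by (rule strict_mono_on_leD[OF g]) (use that in auto)
  show im: "g ` {0..T} = {g 0..g T}"
  proof (intro equalityI subsetI)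
    fix r assume "r \<in> {g 0..g T}"
    then obtain t where "0 \<le> t" "t \<le> T" "g t = r" using IVT'[of g 0 r T] gc T by auto
    then show "r \<in> g ` {0..T}" by auto
  qed (use gmono in auto)
  have "continuous_on (g ` {0..T}) \<tau>"
    by (rule continuous_on_inv[OF gc]) (use \<tau> in auto)
  then show tc: "continuous_on {g 0..g T} \<tau>" by (simp only: im)
  show inv: "\<tau> r \<in> {0..T} \<and> g (\<tau> r) = r" if "r \<in> {g 0..g T}" for r
  proof -
    have "r \<in> g ` {0..T}" using that by (simp only: im)
    then obtain t where t: "t \<in> {0..T}" "r = g t" by (rule imageE) simp
    with \<tau>[OF t(1)] show ?thesis by simp
  qed
  have w0: "w t \<ge> 0" if t: "0 < t" "t < T" for t
  proof (rule ccontr)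
    assume "\<not> w t \<ge> 0"
    moreover have "(g has_real_derivative w t) (at t)"
      using dg[of t] t by (simp add: at_within_Icc_at)
    ultimately obtain d where d: "d > 0" "\<And>h. 0 < h \<Longrightarrow> h < d \<Longrightarrow> g (t + h) < g t"
      using DERIV_neg_dec_right[of g "w t" t] by auto
    define h where "h = min (d/2) (T - t)"
    have h: "0 < h" "h < d" "t + h \<le> T" using d t by (auto simp: h_def min_def)
    have "g (t + h) < g t" using d(2)[OF h(1,2)] .
    moreover have "g t \<le> g (t + h)" using gmono[of t "t + h"] h t by simp
    ultimately show False by simp
  qed
  have fc: "continuous_on {0..T} f"
    using df by (rule DERIV_continuous_on)
  have key: "\<bar>f b - f a - k * (g b - g a)\<bar> \<le> e * (g b - g a)"
    if ab: "0 \<le> a" "a \<le> b" "b \<le> T" and e: "\<And>t. t \<in> {a..b} \<Longrightarrow> \<bar>q t - k\<bar> \<le> e" for a b k e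
  proof -
    have D: "(f has_real_derivative w t * q t) (at t) \<and> (g has_real_derivative w t) (at t)" if "a < t" "t < b" for t
      using df[of t] dg[of t] ab that by (simp add: at_within_Icc_at)
    have c: "continuous_on {a..b} f" "continuous_on {a..b} g"
      using fc gc ab by (auto elim: continuous_on_subset)
    have "(e + k) * g a - f a \<le> (e + k) * g b - f b"
    proof (rule DERIV_nonneg_imp_increasing_open[OF ab(2)])
      fix t assume t: "a < t" "t < b"
      have "((\<lambda>t. (e + k) * g t - f t) has_real_derivative (e + k) * w t - w t * q t) (at t)"
        using D[OF t] by (intro DERIV_diff DERIV_cmult conjunct1[OF D[OF t]] conjunct2[OF D[OF t]])
      moreover have "(e + k) * w t - w t * q t = (e + k - q t) * w t" by (simp add: algebra_simps)
      moreover have "(e + k - q t) * w t \<ge> 0"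
        using e[of t] w0[of t] t ab by (intro mult_nonneg_nonneg) auto
      ultimately show "\<exists>y. ((\<lambda>t. (e + k) * g t - f t) has_real_derivative y) (at t) \<and> 0 \<le> y" by metis
    qed (intro continuous_intros c)
    moreover have "(e - k) * g a + f a \<le> (e - k) * g b + f b"
    proof (rule DERIV_nonneg_imp_increasing_open[OF ab(2)])
      fix t assume t: "a < t" "t < b"
      have "((\<lambda>t. (e - k) * g t + f t) has_real_derivative (e - k) * w t + w t * q t) (at t)"
        using D[OF t] by (intro DERIV_add DERIV_cmult conjunct1[OF D[OF t]] conjunct2[OF D[OF t]])
      moreover have "(e - k) * w t + w t * q t = (e - k + q t) * w t" by (simp add: algebra_simps)
      moreover have "(e - k + q t) * w t \<ge> 0"
        using e[of t] w0[of t] t ab by (intro mult_nonneg_nonneg) auto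
      ultimately show "\<exists>y. ((\<lambda>t. (e - k) * g t + f t) has_real_derivative y) (at t) \<and> 0 \<le> y" by metis
    qed (intro continuous_intros c)
    ultimately show ?thesis by (simp add: abs_le_iff algebra_simps)
  qed
  show "((\<lambda>r. f (\<tau> r)) has_real_derivative q (\<tau> r)) (at r within {g 0..g T})" if r: "r \<in> {g 0..g T}" for r
    unfolding has_field_derivative_def has_derivative_within_alt
  proof (intro conjI allI impI)
    show "bounded_linear ((*) (q (\<tau> r)))" by (rule bounded_linear_mult_right)
    fix e :: real assume e: "e > 0"
    have t0: "\<tau> r \<in> {0..T}" "g (\<tau> r) = r" using inv[OF r] by auto
    obtain d1 where d1: "d1 > 0" "\<And>t. t \<in> {0..T} \<Longrightarrow> \<bar>t - \<tau> r\<bar> < d1 \<Longrightarrow> \<bar>q t - q (\<tau> r)\<bar> < e"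
      using q t0 e unfolding continuous_on_iff dist_real_def by metis
    obtain d2 where d2: "d2 > 0" "\<And>s. s \<in> {g 0..g T} \<Longrightarrow> \<bar>s - r\<bar> < d2 \<Longrightarrow> \<bar>\<tau> s - \<tau> r\<bar> < d1"
      using tc r d1(1) unfolding continuous_on_iff dist_real_def by metis
    show "\<exists>d>0. \<forall>s\<in>{g 0..g T}. norm (s - r) < d \<longrightarrow> norm (f (\<tau> s) - f (\<tau> r) - q (\<tau> r) * (s - r)) \<le> e * norm (s - r)"
    proof (intro exI[of _ d2] conjI ballI impI d2(1))
      fix s assume s: "s \<in> {g 0..g T}" "norm (s - r) < d2"
      have ts: "\<tau> s \<in> {0..T}" "g (\<tau> s) = s" using inv[OF s(1)] by auto
      have near: "\<bar>\<tau> s - \<tau> r\<bar> < d1" using d2(2)[OF s(1)] s(2) by simp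
      show "norm (f (\<tau> s) - f (\<tau> r) - q (\<tau> r) * (s - r)) \<le> e * norm (s - r)"
      proof (cases "\<tau> r \<le> \<tau> s")
        case True
        have "\<bar>q t - q (\<tau> r)\<bar> \<le> e" if "t \<in> {\<tau> r..\<tau> s}" for t
          using d1(2)[of t] that near t0 ts by auto
        from key[OF _ True _ this] t0 ts have k: "\<bar>f (\<tau> s) - f (\<tau> r) - q (\<tau> r) * (s - r)\<bar> \<le> e * (s - r)" by auto
        have "r \<le> s" using gmono[OF _ True] t0 ts by auto
        with k show ?thesis by simp
      next
        case False
        then have le: "\<tau> s \<le> \<tau> r" by simp
        have "\<bar>q t - q (\<tau> r)\<bar> \<le> e" if "t \<in> {\<tau> s..\<tau> r}" for t
          using d1(2)[of t] that near t0 ts by auto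
        from key[OF _ le _ this] t0 ts have k: "\<bar>f (\<tau> r) - f (\<tau> s) - q (\<tau> r) * (r - s)\<bar> \<le> e * (r - s)" by auto
        have "s \<le> r" using gmono[OF _ le] t0 ts by auto
        moreover have "f (\<tau> r) - f (\<tau> s) - q (\<tau> r) * (r - s) = - (f (\<tau> s) - f (\<tau> r) - q (\<tau> r) * (s - r))"
          by (simp add: algebra_simps)
        ultimately show ?thesis using k by (simp only: abs_minus_cancel) simp
      qed
    qed
  qed
qed

text \<open>For the control of the mirrored coordinate, which jumps at finitely many times.\<close>

lemma absolutely_integrable_finite_discont:
  fixes f :: "real \<Rightarrow> real"
  assumes "finite F" "continuous_on ({a..b} - F) f" "\<And>t. t \<in> {a..b} \<Longrightarrow> \<bar>f t\<bar> \<le> C"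
  shows "f absolutely_integrable_on {a..b}"
proof -
  have F: "negligible F" using assms(1) by (rule negligible_finite)
  have S: "{a..b} - F \<in> sets lebesgue"
    using F by (intro sets.Diff) (auto simp: negligible_iff_null_sets null_setsD2)
  have "f absolutely_integrable_on ({a..b} - F)"
  proof (rule measurable_bounded_by_integrable_imp_absolutely_integrable)
    show "f \<in> borel_measurable (lebesgue_on ({a..b} - F))"
      by (rule continuous_imp_measurable_on_sets_lebesgue[OF assms(2) S])
    show "{a..b} - F \<in> sets lebesgue" by (rule S)
    have "(\<lambda>t. C) integrable_on {a..b}" by (rule integrable_const_ivl)
    moreover have "negligible {x \<in> {a..b} - ({a..b} - F). C \<noteq> 0}" "negligible {x \<in> {a..b} - F - {a..b}. C \<noteq> 0}"
      by (rule negligible_subset[OF F]; auto)+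
    ultimately show "(\<lambda>t. C) integrable_on ({a..b} - F)"
      by (subst integrable_spike_set_eq[of _ "{a..b}"])
         (auto intro: negligible_subset[OF F])
    show "norm (f x) \<le> C" if "x \<in> {a..b} - F" for x using assms(3)[of x] that by simp
  qed
  then show ?thesis
    by (rule absolutely_integrable_spike_set) (auto intro: negligible_subset[OF F])
qed

lemma integral_difference:
  fixes f :: "real \<Rightarrow> real"
  assumes "f integrable_on {0..T}" "0 \<le> a" "a \<le> b" "b \<le> T"
  shows "f integrable_on {a..b}" "integral {0..b} f - integral {0..a} f = integral {a..b} f"
proof -
  show "f integrable_on {a..b}"
    by (rule integrable_on_subinterval[OF assms(1)]) (use assms in simp)
  have "f integrable_on {0..b}"
    by (rule integrable_on_subinterval[OF assms(1)]) (use assms in simp)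
  from Henstock_Kurzweil_Integration.integral_combine[OF assms(2,3) this]
  show "integral {0..b} f - integral {0..a} f = integral {a..b} f" by simp
qed

text \<open>Cauchy-Schwarz, followed by the tangent bound of the square root at
  \<open>D\<^sup>2\<close>. The bound is affine in \<open>N\<close>: its part
  \<open>N / (2 * D)\<close> cancels the decrease \<open>N / 2\<close> of the calibration per unit
  of \<open>\<theta> = m / D\<close>.\<close>

lemma linear_form_le:
  fixes D N q c v z x :: real
  assumes "D > 0" "q\<^sup>2 + (c * x)\<^sup>2 \<le> N"
  shows "q * v + c * (x * z) \<le> sqrt (v\<^sup>2 + z\<^sup>2) * (D / 2 + N / (2 * D))"
proof -
  let ?w = "sqrt (v\<^sup>2 + z\<^sup>2)"
  have N: "N \<ge> 0" using assms(2) sum_power2_ge_zero[of q "c * x"] by linarith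
  have "(q * v + c * (x * z))\<^sup>2 \<le> (q\<^sup>2 + (c * x)\<^sup>2) * (v\<^sup>2 + z\<^sup>2)"
    using zero_le_power2[of "q * z - c * x * v"] by (simp add: power2_eq_square algebra_simps)
  also have "\<dots> \<le> N * (v\<^sup>2 + z\<^sup>2)" using assms by (intro mult_right_mono) auto
  also have "\<dots> = (sqrt N * ?w)\<^sup>2" using N by (simp add: power_mult_distrib)
  finally have "q * v + c * (x * z) \<le> sqrt N * ?w"
    by (rule power2_le_imp_le) (use N in simp)
  also have "sqrt N \<le> D / 2 + N / (2 * D)"
  proof -
    have "0 \<le> (D - sqrt N)\<^sup>2" by simp
    then have "2 * D * sqrt N \<le> D\<^sup>2 + N" using N by (simp add: power2_eq_square algebra_simps)
    then show ?thesis using assms(1) by (simp add: field_simps power2_eq_square)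
  qed
  then have "sqrt N * ?w \<le> (D / 2 + N / (2 * D)) * ?w" by (rule mult_right_mono) simp
  finally show ?thesis by (simp add: mult.commute)
qed

text \<open>The calibration is \<open>f \<theta> y = P \<theta> * (y - Y \<theta>) + a \<theta> - K * \<theta> * (y - Y \<theta>)\<^sup>2 / 2\<close>. Because \<open>P' = - \<alpha> c\<^sup>2 Y ^ (2\<alpha> - 1)\<close>,
  all terms of first order in \<open>y - Y \<theta>\<close> cancel in \<open>f_\<theta> + (f_y\<^sup>2 + c\<^sup>2 y ^ (2\<alpha>)) / 2\<close>, and for large \<open>K\<close> and
  small \<open>\<theta>\<close> the second-order remainder is nonpositive.\<close>
lemma calibration_step:
  fixes \<alpha> :: nat and c D B :: real and Y P R :: "real \<Rightarrow> real"
  assumes D: "D > 0" and B: "B \<ge> 0"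
   and dY: "\<And>s. (Y has_real_derivative P s) (at s)"
   and dP: "\<And>s. (P has_real_derivative - (real \<alpha> * c\<^sup>2 * Y s ^ (2 * \<alpha> - 1))) (at s)"
   and dR: "\<And>s. (R has_real_derivative Y s ^ (2 * \<alpha>)) (at s)"
   and E: "\<And>s. (P s)\<^sup>2 + c\<^sup>2 * Y s ^ (2 * \<alpha>) = D\<^sup>2"
   and R0: "R 0 = 0" and YB: "\<And>s. 0 \<le> s \<Longrightarrow> s \<le> 1 \<Longrightarrow> \<bar>Y s\<bar> \<le> B"
  obtains \<theta>0 where "\<theta>0 > 0"
    "\<And>(S::real) (T::real) (y::real \<Rightarrow> real) (v::real \<Rightarrow> real) (z::real \<Rightarrow> real). \<lbrakk>0 \<le> S; S \<le> \<theta>0; 0 \<le> T; (\<lambda>t. sqrt ((v t)\<^sup>2 + (z t)\<^sup>2)) integrable_on {0..T};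
       (\<lambda>t. \<bar>y t\<bar> ^ \<alpha> * z t) integrable_on {0..T};
       \<And>t. t \<in> {0..T} \<Longrightarrow> (v has_integral y t - y 0) {0..t}; \<And>t. t \<in> {0..T} \<Longrightarrow> \<bar>y t\<bar> \<le> B;
       y 0 = Y 0; y T = Y S; c * R S \<le> integral {0..T} (\<lambda>t. \<bar>y t\<bar> ^ \<alpha> * z t); c \<ge> 0\<rbrakk>
      \<Longrightarrow> D * S \<le> integral {0..T} (\<lambda>t. sqrt ((v t)\<^sup>2 + (z t)\<^sup>2))"
proof -
  obtain M where M: "M \<ge> 0" "\<And>y z. \<bar>y\<bar> \<le> B \<Longrightarrow> \<bar>z\<bar> \<le> B \<Longrightarrow>
     \<bar>y ^ (2*\<alpha>) - z ^ (2*\<alpha>) - real (2*\<alpha>) * z ^ (2*\<alpha> - 1) * (y - z)\<bar> \<le> M * (y - z)\<^sup>2"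
    using power_second_order_bound[OF B, of "2*\<alpha>"] by blast
  \<comment> \<open>The first summand absorbs the Taylor error, the 1 absorbs the factor
    \<open>(K * \<theta>)\<^sup>2\<close>, which is at most 1 for
    \<open>\<theta> \<le> \<theta>0\<close>.\<close>
  define K where "K = c\<^sup>2 * M + 1"
  define \<theta>0 where "\<theta>0 = min 1 (1 / K)"
  have K: "K > 0" using M by (simp add: K_def add_nonneg_pos)
  have \<theta>0: "\<theta>0 > 0" "\<theta>0 \<le> 1" "K * \<theta>0 \<le> 1" using K by (auto simp: \<theta>0_def min_def field_simps)
  \<comment> \<open>The summand \<open>D\<^sup>2 * \<theta> / 2 - c\<^sup>2 * R \<theta>\<close>
    turns the Hamilton-Jacobi inequality into an equality on \<open>y = Y \<theta>\<close>. Below,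
    \<open>q\<close> is the derivative of \<open>f\<close> in \<open>y\<close>, and \<open>N\<close>
    is twice the Hamiltonian at \<open>q\<close>.\<close>
  define f where "f \<theta> y = P \<theta> * (y - Y \<theta>) + D\<^sup>2 * \<theta> / 2 - c\<^sup>2 * R \<theta> - K * \<theta> * (y - Y \<theta>)\<^sup>2 / 2" for \<theta> y
  define q where "q \<theta> y = P \<theta> - K * \<theta> * (y - Y \<theta>)" for \<theta> y
  define N where "N \<theta> y = (q \<theta> y)\<^sup>2 + c\<^sup>2 * y ^ (2 * \<alpha>)" for \<theta> y
  define f' where "f' \<theta> y = - (real \<alpha> * c\<^sup>2 * Y \<theta> ^ (2 * \<alpha> - 1)) * (y - Y \<theta>) - P \<theta> * P \<theta> + D\<^sup>2 / 2
      - c\<^sup>2 * Y \<theta> ^ (2 * \<alpha>) - K * (y - Y \<theta>)\<^sup>2 / 2 + K * \<theta> * (y - Y \<theta>) * P \<theta>" for \<theta> y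
  have df: "((\<lambda>\<theta>. f \<theta> y) has_real_derivative f' \<theta> y) (at \<theta>)" for \<theta> y
  proof -
    have e: "((\<lambda>\<theta>. y - Y \<theta>) has_real_derivative 0 - P \<theta>) (at \<theta>)"
      by (intro DERIV_diff DERIV_const dY)
    have "((\<lambda>\<theta>. P \<theta> * (y - Y \<theta>) + D\<^sup>2 / 2 * \<theta> - c\<^sup>2 * R \<theta> - K / 2 * (\<theta> * ((y - Y \<theta>) * (y - Y \<theta>)))) has_real_derivative
       (- (real \<alpha> * c\<^sup>2 * Y \<theta> ^ (2 * \<alpha> - 1)) * (y - Y \<theta>) + (0 - P \<theta>) * P \<theta>) + D\<^sup>2 / 2 * 1 - c\<^sup>2 * Y \<theta> ^ (2 * \<alpha>)
        - K / 2 * (1 * ((y - Y \<theta>) * (y - Y \<theta>)) + ((0 - P \<theta>) * (y - Y \<theta>) + (0 - P \<theta>) * (y - Y \<theta>)) * \<theta>)) (at \<theta>)"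
      by (intro DERIV_diff[OF DERIV_diff] DERIV_add DERIV_cmult dP dR DERIV_mult e DERIV_ident)
    moreover have "f = (\<lambda>\<theta> y. P \<theta> * (y - Y \<theta>) + D\<^sup>2 / 2 * \<theta> - c\<^sup>2 * R \<theta> - K / 2 * (\<theta> * ((y - Y \<theta>) * (y - Y \<theta>))))"
      by (simp add: f_def[abs_def] power2_eq_square mult.assoc)
    ultimately show ?thesis
      by (simp add: f'_def field_simps power2_eq_square)
  qed
  have sub: "f' \<theta> y \<le> - (N \<theta> y / 2)" if "0 \<le> \<theta>" "\<theta> \<le> \<theta>0" "\<bar>y\<bar> \<le> B" for \<theta> y
  proof -
    let ?e = "y - Y \<theta>"
    let ?E = "y ^ (2*\<alpha>) - Y \<theta> ^ (2*\<alpha>) - real (2*\<alpha>) * Y \<theta> ^ (2*\<alpha> - 1) * ?e"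
    have "f' \<theta> y + N \<theta> y / 2 = c\<^sup>2 * ?E / 2 - K * ?e\<^sup>2 / 2 + (K * \<theta>)\<^sup>2 * ?e\<^sup>2 / 2 + (D\<^sup>2 - ((P \<theta>)\<^sup>2 + c\<^sup>2 * Y \<theta> ^ (2 * \<alpha>))) / 2"
      unfolding f'_def N_def q_def by (simp add: field_simps power2_eq_square)
    also have "\<dots> = c\<^sup>2 * ?E / 2 - K * ?e\<^sup>2 / 2 + (K * \<theta>)\<^sup>2 * ?e\<^sup>2 / 2" using E by simp
    also have "\<dots> \<le> c\<^sup>2 * (M * ?e\<^sup>2) / 2 - K * ?e\<^sup>2 / 2 + 1 * ?e\<^sup>2 / 2"
    proof -
      have "?E \<le> M * ?e\<^sup>2" using M(2)[of y "Y \<theta>"] YB[of \<theta>] that \<theta>0 by (simp add: abs_le_iff)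
      then have "c\<^sup>2 * ?E \<le> c\<^sup>2 * (M * ?e\<^sup>2)" by (rule mult_left_mono) simp
      moreover have "K * \<theta> \<le> 1" using that \<theta>0 K by (meson mult_left_mono less_imp_le order_trans)
      then have "(K * \<theta>)\<^sup>2 \<le> 1" using that K by (simp add: power_le_one)
      then have "(K * \<theta>)\<^sup>2 * ?e\<^sup>2 \<le> 1 * ?e\<^sup>2" by (rule mult_right_mono) simp
      ultimately show ?thesis by linarith
    qed
    also have "\<dots> = 0" by (simp add: K_def field_simps)
    finally show ?thesis by simp
  qed
  have cY: "continuous_on A Y" and cP: "continuous_on A P" for A
    using dY dP by (meson DERIV_continuous_on has_field_derivative_at_within)+
  define Q where "Q = {0..\<theta>0} \<times> {-B..B}"
  have "continuous_on Q (\<lambda>p. N (fst p) (snd p))"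
    unfolding N_def q_def
    by (intro continuous_intros continuous_on_compose2[OF cP[of UNIV]] continuous_on_compose2[OF cY[of UNIV]]) auto
  then have uN: "uniformly_continuous_on Q (\<lambda>p. N (fst p) (snd p))"
    by (rule compact_uniformly_continuous) (auto simp: Q_def intro: compact_Times)
  have uy: "uniformly_continuous_on {-B..B} (\<lambda>y. c\<^sup>2 * y ^ (2 * \<alpha>))"
    by (rule compact_uniformly_continuous) (auto intro!: continuous_intros)
  have main: "D * S \<le> integral {0..T} (\<lambda>t. sqrt ((v t)\<^sup>2 + (z t)\<^sup>2))"
    if S: "0 \<le> S" "S \<le> \<theta>0" and T: "0 \<le> T" and iw: "(\<lambda>t. sqrt ((v t)\<^sup>2 + (z t)\<^sup>2)) integrable_on {0..T}"
      and iw': "(\<lambda>t. \<bar>y t\<bar> ^ \<alpha> * z t) integrable_on {0..T}"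
      and iv: "\<And>t. t \<in> {0..T} \<Longrightarrow> (v has_integral y t - y 0) {0..t}"
      and yB: "\<And>t. t \<in> {0..T} \<Longrightarrow> \<bar>y t\<bar> \<le> B"
      and y0: "y 0 = Y 0" and yT: "y T = Y S" and l': "c * R S \<le> integral {0..T} (\<lambda>t. \<bar>y t\<bar> ^ \<alpha> * z t)" and c: "c \<ge> 0"
    for S T :: real and y v z :: "real \<Rightarrow> real"
  proof -
    let ?w = "\<lambda>t. sqrt ((v t)\<^sup>2 + (z t)\<^sup>2)" and ?w' = "\<lambda>t. \<bar>y t\<bar> ^ \<alpha> * z t"
    show "D * S \<le> integral {0..T} ?w"
    proof (rule ccontr)
      assume contr: "\<not> D * S \<le> integral {0..T} ?w"
      \<comment> \<open>Arguing by contradiction keeps \<open>\<theta> t\<close> below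
        \<open>S\<close>, hence below \<open>\<theta>0\<close>, where the subsolution inequality
        \<open>sub\<close> is available.\<close>
      define m where "m t = integral {0..t} ?w" for t
      define \<theta> where "\<theta> t = m t / D" for t
      \<comment> \<open>The calibration is evaluated at the clock time which the oscillator would
        need for the length \<open>m t\<close>. On the oscillator itself, with \<open>R\<close>
        contributing \<open>c * R \<theta>\<close> to the second term, \<open>G\<close> is
        identically zero; along a competitor it cannot increase.\<close>
      define G where "G t = f (\<theta> t) (y t) + c * integral {0..t} ?w' - D / 2 * m t" for t
      have mdiff: "m b - m a = integral {a..b} ?w" if "0 \<le> a" "a \<le> b" "b \<le> T" for a b
        unfolding m_def using integral_difference(2)[OF iw that] .
      have mmono: "m a \<le> m b" if "0 \<le> a" "a \<le> b" "b \<le> T" for a b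
      proof -
        have "0 \<le> integral {a..b} ?w"
          by (rule integral_nonneg[OF integral_difference(1)[OF iw that]]) simp
        with mdiff[OF that] show ?thesis by simp
      qed
      have m0: "m 0 = 0" by (simp add: m_def)
      have ivT: "v integrable_on {0..T}" using iv[of T] T by auto
      have ydiff: "y b - y a = integral {a..b} v" if "0 \<le> a" "a \<le> b" "b \<le> T" for a b
        using integral_difference(2)[OF ivT that] iv[of a] iv[of b] that by (auto dest!: integral_unique)
      have \<theta>r: "0 \<le> \<theta> t" "\<theta> t \<le> S" "\<theta> t \<le> \<theta>0" if "t \<in> {0..T}" for t
      proof -
        have "m 0 \<le> m t" "m t \<le> m T" using mmono[of 0 t] mmono[of t T] that by auto
        then have "0 \<le> m t" "m t \<le> D * S" using contr m0 by (auto simp: m_def)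
        then show "0 \<le> \<theta> t" "\<theta> t \<le> S" using D by (auto simp: \<theta>_def field_simps)
        then show "\<theta> t \<le> \<theta>0" using S by simp
      qed
      have "G T \<le> G 0"
      proof (rule nonincreasing_of_small_increments[OF T, where m = m])
        show "continuous_on {0..T} m" unfolding m_def by (rule indefinite_integral_continuous_1[OF iw])
        show "m a \<le> m b" if "0 \<le> a" "a \<le> b" "b \<le> T" for a b using mmono[OF that] .
        fix e :: real assume e: "e > 0"
        define e' where "e' = e * D"
        have e': "e' > 0" using e D by (simp add: e'_def)
        obtain d1 where d1: "d1 > 0" "\<And>p p'. p \<in> Q \<Longrightarrow> p' \<in> Q \<Longrightarrow> dist p' p < d1 \<Longrightarrow> \<bar>N (fst p') (snd p') - N (fst p) (snd p)\<bar> < e'"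
          using uN e' unfolding uniformly_continuous_on_def dist_real_def by metis
        obtain d2 where d2: "d2 > 0" "\<And>p p'. p \<in> {-B..B} \<Longrightarrow> p' \<in> {-B..B} \<Longrightarrow> \<bar>p' - p\<bar> < d2 \<Longrightarrow> \<bar>c\<^sup>2 * p' ^ (2*\<alpha>) - c\<^sup>2 * p ^ (2*\<alpha>)\<bar> < e'"
          using uy e' unfolding uniformly_continuous_on_def dist_real_def by metis
        define d where "d = min d2 (d1 / (1 / D + 1))"
        have "1 / D + 1 > 0" using D by (simp add: add_pos_pos)
        have "d \<le> d1 / (1 / D + 1)" by (simp add: d_def)
        then have d: "d > 0" "d \<le> d2" "d * (1 / D + 1) \<le> d1"
          using d1(1) d2(1) \<open>1 / D + 1 > 0\<close> by (simp_all only: pos_le_divide_eq) (simp_all add: d_def)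
        show "\<exists>d>0. \<forall>a b. 0 \<le> a \<longrightarrow> a \<le> b \<longrightarrow> b \<le> T \<longrightarrow> m b - m a < d \<longrightarrow> G b - G a \<le> e * (m b - m a)"
        proof (intro exI[of _ d] conjI allI impI d(1))
          fix a b assume ab: "0 \<le> a" "a \<le> b" "b \<le> T" and lt: "m b - m a < d"
          have dy: "\<bar>y t - y a\<bar> \<le> m b - m a" if t: "a \<le> t" "t \<le> b" for t
          proof -
            have t': "t \<le> T" using t ab by simp
            have "norm (integral {a..t} v) \<le> integral {a..t} ?w"
              by (rule integral_norm_bound_integral[OF integral_difference(1)[OF ivT ab(1) t(1) t'] integral_difference(1)[OF iw ab(1) t(1) t']])
                 (auto intro: real_le_rsqrt)
            then show ?thesis using ydiff[OF ab(1) t(1) t'] mdiff[OF ab(1) t(1) t'] mmono[of t b] t ab by simp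
          qed
          have \<theta>ab: "\<theta> b - \<theta> a = (m b - m a) / D" unfolding \<theta>_def by (rule diff_divide_distrib[symmetric])
          have \<theta>le: "\<theta> a \<le> \<theta> b" using mmono[OF ab] D by (simp add: \<theta>_def divide_right_mono)
          have a: "a \<in> {0..T}" and b: "b \<in> {0..T}" using ab by auto
          have Nb: "N \<eta> (y b) \<ge> N (\<theta> a) (y a) - e'" if \<eta>: "\<theta> a \<le> \<eta>" "\<eta> \<le> \<theta> b" for \<eta>
          proof -
            have "dist (\<eta>, y b) (\<theta> a, y a) \<le> \<bar>\<eta> - \<theta> a\<bar> + \<bar>y b - y a\<bar>"
              unfolding dist_Pair_Pair dist_real_def using sqrt_sum_squares_le_sum_abs[of "\<bar>\<eta> - \<theta> a\<bar>" "\<bar>y b - y a\<bar>"] by simp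
            also have "\<dots> \<le> (m b - m a) / D + (m b - m a)"
              using \<eta> \<theta>ab dy[of b] ab by linarith
            also have "\<dots> = (m b - m a) * (1 / D + 1)" by (simp only: distrib_left mult_1_right times_divide_eq_right)
            also have "\<dots> < d * (1 / D + 1)" using lt \<open>1 / D + 1 > 0\<close> by (rule mult_strict_right_mono)
            also have "\<dots> \<le> d1" by (rule d)
            finally have "dist (\<eta>, y b) (\<theta> a, y a) < d1" .
            moreover have "(\<eta>, y b) \<in> Q" "(\<theta> a, y a) \<in> Q"
              using \<theta>r[OF a] \<theta>r[OF b] \<eta> yB[OF a] yB[OF b] by (auto simp: Q_def abs_le_iff)
            ultimately have "\<bar>N \<eta> (y b) - N (\<theta> a) (y a)\<bar> < e'" using d1(2)[of "(\<theta> a, y a)" "(\<eta>, y b)"] by simp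
            then show ?thesis by linarith
          qed
          \<comment> \<open>The increment of \<open>f\<close> is split: first in
            \<open>\<theta>\<close> with \<open>y\<close> at its right end, by the subsolution
            inequality, then in \<open>y\<close> with \<open>\<theta>\<close> at its left end, by
            concavity.\<close>
          let ?k = "(N (\<theta> a) (y a) - e') / 2"
          have f1: "f (\<theta> b) (y b) + ?k * \<theta> b \<le> f (\<theta> a) (y b) + ?k * \<theta> a"
          proof (rule DERIV_nonpos_imp_nonincreasing[OF \<theta>le])
            fix \<eta> assume \<eta>: "\<theta> a \<le> \<eta>" "\<eta> \<le> \<theta> b"
            have "((\<lambda>\<theta>. f \<theta> (y b) + ?k * \<theta>) has_real_derivative f' \<eta> (y b) + ?k * 1) (at \<eta>)"
              by (intro DERIV_add df DERIV_cmult DERIV_ident)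
            moreover have "f' \<eta> (y b) + ?k * 1 \<le> 0"
            proof -
              have "f' \<eta> (y b) \<le> - (N \<eta> (y b) / 2)"
                by (rule sub) (use \<theta>r[OF a] \<theta>r[OF b] \<eta> yB[OF b] in auto)
              moreover have "?k * 1 \<le> N \<eta> (y b) / 2" using divide_right_mono[OF Nb[OF \<eta>], of 2] by simp
              ultimately have "f' \<eta> (y b) + ?k * 1 \<le> - (N \<eta> (y b) / 2) + N \<eta> (y b) / 2" using add_mono by blast
              then show ?thesis by simp
            qed
            ultimately show "\<exists>l. ((\<lambda>\<theta>. f \<theta> (y b) + ?k * \<theta>) has_real_derivative l) (at \<eta>) \<and> l \<le> 0" by blast
          qed
          have f2: "f (\<theta> a) (y b) - f (\<theta> a) (y a) \<le> q (\<theta> a) (y a) * (y b - y a)"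
          proof -
            have "f (\<theta> a) (y b) - f (\<theta> a) (y a) = q (\<theta> a) (y a) * (y b - y a) - K * \<theta> a * (y b - y a)\<^sup>2 / 2"
              unfolding f_def q_def by (simp add: field_simps power2_eq_square)
            moreover have "0 \<le> K * \<theta> a * (y b - y a)\<^sup>2" using K \<theta>r[OF a] by simp
            ultimately show ?thesis by linarith
          qed
          let ?q = "q (\<theta> a) (y a)" and ?r = "D / 2 + (N (\<theta> a) (y a) + e') / (2 * D)"
          have pw: "?q * v t + c * ?w' t \<le> ?w t * ?r" if t: "t \<in> {a..b}" for t
          proof (rule linear_form_le[OF D])
            have tT: "t \<in> {0..T}" using t ab by auto
            have "\<bar>y t - y a\<bar> < d2" using dy[of t] t lt d(2) by auto
            then have "\<bar>c\<^sup>2 * y t ^ (2*\<alpha>) - c\<^sup>2 * y a ^ (2*\<alpha>)\<bar> < e'"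
              using d2(2)[of "y a" "y t"] yB[OF a] yB[OF tT] by (auto simp: abs_le_iff)
            moreover have "(c * \<bar>y t\<bar> ^ \<alpha>)\<^sup>2 = c\<^sup>2 * y t ^ (2*\<alpha>)"
              by (simp add: power_mult_distrib power_mult[symmetric] mult.commute[of \<alpha>] power_even_abs)
            ultimately show "?q\<^sup>2 + (c * \<bar>y t\<bar> ^ \<alpha>)\<^sup>2 \<le> N (\<theta> a) (y a) + e'"
              unfolding N_def by linarith
          qed
          have i1: "(\<lambda>t. ?q * v t + c * ?w' t) integrable_on {a..b}"
            by (intro integrable_add integrable_on_mult_right integral_difference(1)[OF ivT ab] integral_difference(1)[OF iw' ab])
          have "integral {a..b} (\<lambda>t. ?q * v t + c * ?w' t) \<le> integral {a..b} (\<lambda>t. ?w t * ?r)"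
            by (rule integral_le[OF i1 _ pw]) (intro integrable_on_mult_left integral_difference(1)[OF iw ab])
          moreover have "integral {a..b} (\<lambda>t. ?q * v t + c * ?w' t) = ?q * integral {a..b} v + c * integral {a..b} ?w'"
            using integral_difference(1)[OF ivT ab] integral_difference(1)[OF iw' ab]
            by (simp add: integral_add integrable_on_mult_right)
          moreover have "integral {a..b} (\<lambda>t. ?w t * ?r) = (m b - m a) * ?r"
            unfolding mdiff[OF ab] by (rule integral_mult_left)
          ultimately have f3: "?q * (y b - y a) + c * (integral {0..b} ?w' - integral {0..a} ?w') \<le> (m b - m a) * ?r"
            unfolding ydiff[OF ab] integral_difference(2)[OF iw' ab] by (simp only:)
          have "G b - G a \<le> - ?k * (\<theta> b - \<theta> a) + (m b - m a) * ?r - D / 2 * (m b - m a)"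
            using f1 f2 f3 unfolding G_def right_diff_distrib by linarith
          also have "\<dots> = e' / D * (m b - m a)" unfolding \<theta>ab using D by (simp add: field_simps)
          finally show "G b - G a \<le> e * (m b - m a)" using D by (simp add: e'_def)
        qed
      qed
      moreover have "G 0 = 0" using y0 m0 R0 by (simp add: G_def f_def \<theta>_def)
      \<comment> \<open>The derivative of \<open>f\<close> in \<open>\<theta>\<close> is at most
        \<open>- N / 2 \<le> 0\<close>, so passing from \<open>\<theta> T\<close> to the later time
        \<open>S\<close> lowers \<open>f\<close>.\<close>
      moreover have "f S (Y S) \<le> f (\<theta> T) (Y S)"
      proof (rule DERIV_nonpos_imp_nonincreasing[where f = "\<lambda>\<eta>. f \<eta> (Y S)"])
        show "\<theta> T \<le> S" using \<theta>r[of T] T by simp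
        fix \<eta> assume \<eta>: "\<theta> T \<le> \<eta>" "\<eta> \<le> S"
        have "f' \<eta> (Y S) \<le> - (N \<eta> (Y S) / 2)"
          by (rule sub) (use \<eta> \<theta>r[of T] S T yB[of T] yT in auto)
        moreover have "N \<eta> (Y S) \<ge> 0" by (simp add: N_def power_mult)
        ultimately show "\<exists>l. ((\<lambda>\<theta>. f \<theta> (Y S)) has_real_derivative l) (at \<eta>) \<and> l \<le> 0" using df by force
      qed
      moreover have "c * (c * R S) \<le> c * integral {0..T} ?w'" using l' c by (rule mult_left_mono)
      moreover have "f S (Y S) = D\<^sup>2 * S / 2 - c * (c * R S)" by (simp add: f_def power2_eq_square)
      ultimately have "D\<^sup>2 * S / 2 \<le> D / 2 * m T" unfolding G_def yT by linarith
      then have "D * (D * S) \<le> D * m T" by (simp add: power2_eq_square)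
      then have "D * S \<le> m T" using D by simp
      with contr show False by (simp add: m_def)
    qed
  qed
  show thesis by (rule that[OF \<theta>0(1) main])
qed

lemma isCont_tendsto_nhds:
  fixes f :: "real \<Rightarrow> real"
  shows "isCont f b \<Longrightarrow> (f \<longlongrightarrow> f b) (nhds b)"
  unfolding isCont_def by (rule tendsto_at_iff_tendsto_nhds[THEN iffD1])

lemma DERIV_chain_within:
  fixes f g :: "real \<Rightarrow> real"
  assumes "(f has_real_derivative D) (at (g t) within B)" "(g has_real_derivative D') (at t within A)" "g ` A \<subseteq> B"
  shows "((\<lambda>t. f (g t)) has_real_derivative D * D') (at t within A)"
  using DERIV_image_chain[OF DERIV_subset[OF assms(1,3)] assms(2)] by (simp add: o_def)

lemma DERIV_const_on_interval:
  fixes f :: "real \<Rightarrow> real"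
  assumes "(f has_real_derivative D) (at t)" "a < t" "t < b" "\<And>s. a < s \<Longrightarrow> s < b \<Longrightarrow> f s = c"
  shows "D = 0"
proof -
  have "((\<lambda>s. c) has_real_derivative D) (at t)"
    by (rule has_field_derivative_transform_within_open[OF assms(1), of "{a<..<b}"]) (use assms in auto)
  then show ?thesis using DERIV_const DERIV_unique by blast
qed

lemma continuous_nonzero_interval:
  fixes f :: "real \<Rightarrow> real"
  assumes "continuous_on {a<..<b} f" "a < t" "t < b" "f t \<noteq> 0"
  obtains a' b' where "a < a'" "a' < t" "t < b'" "b' < b" "\<And>s. a' < s \<Longrightarrow> s < b' \<Longrightarrow> f s \<noteq> 0"
proof -
  have "isCont f t" using assms by (simp add: continuous_on_eq_continuous_at)
  then obtain d where d: "d > 0" "\<And>s. dist t s < d \<Longrightarrow> f s \<noteq> 0"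
    using continuous_at_avoid[of t f 0] assms(4) by blast
  show thesis
  proof (rule that[of "max ((a + t) / 2) (t - d / 2)" "min ((t + b) / 2) (t + d / 2)"])
    fix s assume "max ((a + t) / 2) (t - d / 2) < s" "s < min ((t + b) / 2) (t + d / 2)"
    then have "dist t s < d" using d(1) by (auto simp: dist_real_def abs_less_iff)
    then show "f s \<noteq> 0" by (rule d(2))
  qed (use assms d(1) in \<open>auto simp: less_max_iff_disj min_less_iff_disj\<close>)
qed

text \<open>On a short interval \<open>q\<close> may be replaced by its left end value: that part
  integrates to zero because all integrals of \<open>h\<close> vanish, and the remainder is at most
  \<open>e\<close> times the integral of the absolute value of \<open>h\<close>.\<close>

lemma integral_against_null_primitive:
  fixes h q :: "real \<Rightarrow> real"
  assumes T: "0 \<le> T" and h: "h absolutely_integrable_on {0..T}"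
    and null: "\<And>t. t \<in> {0..T} \<Longrightarrow> (h has_integral 0) {0..t}"
    and q: "continuous_on {0..T} q"
  shows "(\<lambda>t. q t * h t) absolutely_integrable_on {0..T}" "integral {0..T} (\<lambda>t. q t * h t) \<le> 0"
proof -
  show ai: "(\<lambda>t. q t * h t) absolutely_integrable_on {0..T}"
  proof (rule absolutely_integrable_bounded_measurable_product_real[OF _ _ _ h])
    show "q \<in> borel_measurable (lebesgue_on {0..T})"
      by (rule continuous_imp_measurable_on_sets_lebesgue[OF q]) simp
    show "bounded (q ` {0..T})"
      by (intro compact_imp_bounded compact_continuous_image q) simp
  qed simp
  then have iqh: "(\<lambda>t. q t * h t) integrable_on {0..T}" by (rule set_lebesgue_integral_eq_integral(1))
  have ih: "h integrable_on {0..T}" using h by (rule set_lebesgue_integral_eq_integral(1))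
  have iah: "(\<lambda>t. \<bar>h t\<bar>) integrable_on {0..T}" using h by (simp add: absolutely_integrable_on_def)
  define G where "G t = integral {0..t} (\<lambda>t. q t * h t)" for t
  \<comment> \<open>The summand \<open>t\<close> makes a small increment of \<open>m\<close> force a
    short interval, so that uniform continuity of \<open>q\<close> applies.\<close>
  define m where "m t = integral {0..t} (\<lambda>t. \<bar>h t\<bar>) + t" for t
  have mdiff: "m b - m a = integral {a..b} (\<lambda>t. \<bar>h t\<bar>) + (b - a)" if "0 \<le> a" "a \<le> b" "b \<le> T" for a b
    using integral_difference(2)[OF iah that] by (simp add: m_def)
  have pos: "0 \<le> integral {a..b} (\<lambda>t. \<bar>h t\<bar>)" if "0 \<le> a" "a \<le> b" "b \<le> T" for a b
    by (rule integral_nonneg[OF integral_difference(1)[OF iah that]]) simp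
  have "G T \<le> G 0"
  proof (rule nonincreasing_of_small_increments[OF T, where m = m])
    show "continuous_on {0..T} m" unfolding m_def
      by (intro continuous_intros indefinite_integral_continuous_1[OF iah])
    show "m a \<le> m b" if "0 \<le> a" "a \<le> b" "b \<le> T" for a b
      using mdiff[OF that] pos[OF that] that by linarith
    fix e :: real assume e: "e > 0"
    have "uniformly_continuous_on {0..T} q" by (rule compact_uniformly_continuous[OF q]) simp
    then obtain d where d: "d > 0" "\<And>t s. t \<in> {0..T} \<Longrightarrow> s \<in> {0..T} \<Longrightarrow> dist s t < d \<Longrightarrow> dist (q s) (q t) < e"
      unfolding uniformly_continuous_on_def using e by metis
    show "\<exists>d>0. \<forall>a b. 0 \<le> a \<longrightarrow> a \<le> b \<longrightarrow> b \<le> T \<longrightarrow> m b - m a < d \<longrightarrow> G b - G a \<le> e * (m b - m a)"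
    proof (intro exI[of _ d] conjI allI impI d(1))
      fix a b assume ab: "0 \<le> a" "a \<le> b" "b \<le> T" and lt: "m b - m a < d"
      have ba: "b - a < d" using lt mdiff[OF ab] pos[OF ab] by linarith
      have i0: "integral {a..b} h = 0"
        using integral_difference(2)[OF ih ab] null[of a] null[of b] ab by (auto dest!: integral_unique)
      have i1: "(\<lambda>t. q t * h t) integrable_on {a..b}" "h integrable_on {a..b}" "(\<lambda>t. \<bar>h t\<bar>) integrable_on {a..b}"
        by (rule integral_difference(1)[OF iqh ab] integral_difference(1)[OF ih ab] integral_difference(1)[OF iah ab])+
      have "G b - G a = integral {a..b} (\<lambda>t. q t * h t) - q a * integral {a..b} h"
        using integral_difference(2)[OF iqh ab] i0 by (simp add: G_def)
      also have "\<dots> = integral {a..b} (\<lambda>t. q t * h t - q a * h t)"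
        using i1 by (simp add: integral_diff integrable_on_mult_right)
      also have "\<dots> \<le> integral {a..b} (\<lambda>t. e * \<bar>h t\<bar>)"
      proof (rule integral_le)
        show "(\<lambda>t. q t * h t - q a * h t) integrable_on {a..b}"
          by (intro integrable_diff i1 integrable_on_mult_right)
        show "(\<lambda>t. e * \<bar>h t\<bar>) integrable_on {a..b}" by (intro i1 integrable_on_mult_right)
        fix t assume t: "t \<in> {a..b}"
        then have "dist t a < d" using ba by (simp add: dist_real_def)
        then have "\<bar>q t - q a\<bar> \<le> e" using d(2)[of a t] t ab by (simp add: dist_real_def)
        then have "\<bar>q t - q a\<bar> * \<bar>h t\<bar> \<le> e * \<bar>h t\<bar>" by (rule mult_right_mono) simp
        then have "\<bar>(q t - q a) * h t\<bar> \<le> e * \<bar>h t\<bar>" by (simp only: abs_mult)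
        then have "(q t - q a) * h t \<le> e * \<bar>h t\<bar>" by linarith
        then show "q t * h t - q a * h t \<le> e * \<bar>h t\<bar>" by (simp only: left_diff_distrib)
      qed
      also have "\<dots> = e * integral {a..b} (\<lambda>t. \<bar>h t\<bar>)" by (rule integral_mult_right)
      also have "\<dots> \<le> e * (m b - m a)"
        using mdiff[OF ab] ab e by (intro mult_left_mono) auto
      finally show "G b - G a \<le> e * (m b - m a)" .
    qed
  qed
  then show "integral {0..T} (\<lambda>t. q t * h t) \<le> 0" by (simp add: G_def)
qed

lemma zero_deriv_constant:
  fixes f :: "real \<Rightarrow> real"
  assumes "\<And>t. 0 \<le> t \<Longrightarrow> (f has_real_derivative 0) (at t within {0..})" "0 \<le> t"
  shows "f t = f 0"
proof -
  have "\<exists>c. \<forall>t\<in>{0..}. f t = c"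
    by (rule has_field_derivative_zero_constant) (use assms in auto)
  then show ?thesis using assms(2) by auto
qed

section \<open>The nested Hamiltonian and admissible curves\<close>

text \<open>The quotient \<open>xi k / xi j\<close>, as a product that still makes sense where
  \<open>xi j\<close> vanishes.\<close>

definition eta :: "(nat \<Rightarrow> nat) \<Rightarrow> nat \<Rightarrow> nat \<Rightarrow> (nat \<Rightarrow> real) \<Rightarrow> real" where
  "eta \<alpha> j k y = (\<Prod>i\<in>{j..<k}. y i ^ \<alpha> i)"

definition tail_energy :: "nat \<Rightarrow> (nat \<Rightarrow> nat) \<Rightarrow> nat \<Rightarrow> (nat \<Rightarrow> real) \<Rightarrow> (nat \<Rightarrow> real) \<Rightarrow> real" where
  "tail_energy n \<alpha> j y p = (\<Sum>k\<in>{j..n+1}. (eta \<alpha> j k y)\<^sup>2 * (p k)\<^sup>2)"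

lemma xi_eq_eta: "xi \<alpha> k y = eta \<alpha> 1 k y"
  by (simp add: xi_def eta_def)

lemma eta_self [simp]: "eta \<alpha> j j y = 1"
  by (simp add: eta_def)

lemma eta_mult: "j \<le> l \<Longrightarrow> l \<le> k \<Longrightarrow> eta \<alpha> j k y = eta \<alpha> j l y * eta \<alpha> l k y"
  by (simp add: eta_def prod.atLeastLessThan_concat)

lemma eta_Suc: "j < k \<Longrightarrow> eta \<alpha> j k y = y j ^ \<alpha> j * eta \<alpha> (Suc j) k y"
  by (simp add: eta_def prod.atLeast_Suc_lessThan)

lemma xi_mult: "1 \<le> j \<Longrightarrow> j \<le> k \<Longrightarrow> xi \<alpha> k y = xi \<alpha> j y * eta \<alpha> j k y"
  unfolding xi_eq_eta by (rule eta_mult)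

lemma xi_Suc: "1 \<le> j \<Longrightarrow> xi \<alpha> (Suc j) y = xi \<alpha> j y * y j ^ \<alpha> j"
  by (simp add: xi_def prod.atLeastLessThan_Suc)

lemma xi_1 [simp]: "xi \<alpha> (Suc 0) y = 1"
  by (simp add: xi_def)

lemma eta_cong: "(\<And>i. j \<le> i \<Longrightarrow> i < k \<Longrightarrow> y i = z i) \<Longrightarrow> eta \<alpha> j k y = eta \<alpha> j k z"
  by (simp add: eta_def)

lemma tail_energy_rec:
  assumes "j \<le> n + 1"
  shows "tail_energy n \<alpha> j y p = (p j)\<^sup>2 + y j ^ (2 * \<alpha> j) * tail_energy n \<alpha> (Suc j) y p"
proof -
  have "tail_energy n \<alpha> j y p = (p j)\<^sup>2 + (\<Sum>k\<in>{Suc j..n+1}. (eta \<alpha> j k y)\<^sup>2 * (p k)\<^sup>2)"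
    unfolding tail_energy_def sum.atLeast_Suc_atMost[OF assms] by simp
  also have "(\<Sum>k\<in>{Suc j..n+1}. (eta \<alpha> j k y)\<^sup>2 * (p k)\<^sup>2) = (\<Sum>k\<in>{Suc j..n+1}. y j ^ (2 * \<alpha> j) * ((eta \<alpha> (Suc j) k y)\<^sup>2 * (p k)\<^sup>2))"
    by (rule sum.cong) (auto simp: eta_Suc power_mult_distrib power_mult[symmetric] mult.commute)
  finally show ?thesis unfolding sum_distrib_left[symmetric] tail_energy_def .
qed

text \<open>The coordinate \<open>y k\<close> enters only the weights of the coordinates after
  \<open>k\<close>, each time through the common factor \<open>y k ^ \<alpha> k\<close>. As a
  function of \<open>y k\<close> alone, the Hamiltonian is thus a constant plus a multiple of the
  power \<open>2 * \<alpha> k\<close>.\<close>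

lemma dham_dx_eq:
  assumes "1 \<le> k" "k \<le> n + 1"
  shows "dham_dx n \<alpha> k y p = (xi \<alpha> k y)\<^sup>2 * (real (\<alpha> k) * y k ^ (2 * \<alpha> k - 1)) * tail_energy n \<alpha> (Suc k) y p"
proof -
  define C where "C = (\<Sum>i\<in>{1..k}. (xi \<alpha> i y)\<^sup>2 * (p i)\<^sup>2) / 2"
  let ?A = "(xi \<alpha> k y)\<^sup>2 * tail_energy n \<alpha> (Suc k) y p / 2"
  have h: "ham n \<alpha> (y(k := z)) p = C + ?A * z ^ (2 * \<alpha> k)" for z
  proof -
    have "{1..n+1} = {1..k} \<union> {Suc k..n+1}" "{1..k} \<inter> {Suc k..n+1} = {}" using assms by auto
    then have "(\<Sum>j\<in>{1..n+1}. (xi \<alpha> j (y(k := z)))\<^sup>2 * (p j)\<^sup>2)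
       = (\<Sum>j\<in>{1..k}. (xi \<alpha> j (y(k := z)))\<^sup>2 * (p j)\<^sup>2) + (\<Sum>j\<in>{Suc k..n+1}. (xi \<alpha> j (y(k := z)))\<^sup>2 * (p j)\<^sup>2)"
      by (simp add: sum.union_disjoint)
    also have "(\<Sum>j\<in>{1..k}. (xi \<alpha> j (y(k := z)))\<^sup>2 * (p j)\<^sup>2) = (\<Sum>j\<in>{1..k}. (xi \<alpha> j y)\<^sup>2 * (p j)\<^sup>2)"
      by (rule sum.cong) (auto simp: xi_def)
    also have "(\<Sum>j\<in>{Suc k..n+1}. (xi \<alpha> j (y(k := z)))\<^sup>2 * (p j)\<^sup>2)
       = (\<Sum>j\<in>{Suc k..n+1}. ((xi \<alpha> k y)\<^sup>2 * z ^ (2 * \<alpha> k)) * ((eta \<alpha> (Suc k) j y)\<^sup>2 * (p j)\<^sup>2))"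
    proof (rule sum.cong)
      fix j assume j: "j \<in> {Suc k..n+1}"
      have "xi \<alpha> j (y(k := z)) = xi \<alpha> k (y(k := z)) * (z ^ \<alpha> k * eta \<alpha> (Suc k) j (y(k := z)))"
        using j assms by (simp add: xi_mult[of k j] eta_Suc)
      also have "xi \<alpha> k (y(k := z)) = xi \<alpha> k y" by (simp add: xi_def)
      also have "eta \<alpha> (Suc k) j (y(k := z)) = eta \<alpha> (Suc k) j y" by (rule eta_cong) auto
      finally have e: "xi \<alpha> j (y(k := z)) = xi \<alpha> k y * (z ^ \<alpha> k * eta \<alpha> (Suc k) j y)" .
      show "(xi \<alpha> j (y(k := z)))\<^sup>2 * (p j)\<^sup>2 = ((xi \<alpha> k y)\<^sup>2 * z ^ (2 * \<alpha> k)) * ((eta \<alpha> (Suc k) j y)\<^sup>2 * (p j)\<^sup>2)"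
        unfolding e by (simp add: power_mult_distrib power_mult[symmetric] mult.commute[of _ 2])
    qed simp
    finally have e: "(\<Sum>j\<in>{1..n+1}. (xi \<alpha> j (y(k := z)))\<^sup>2 * (p j)\<^sup>2)
       = (\<Sum>j\<in>{1..k}. (xi \<alpha> j y)\<^sup>2 * (p j)\<^sup>2) + (xi \<alpha> k y)\<^sup>2 * z ^ (2 * \<alpha> k) * tail_energy n \<alpha> (Suc k) y p"
      unfolding sum_distrib_left[symmetric] tail_energy_def .
    show ?thesis unfolding ham_def C_def e by (simp add: field_simps)
  qed
  have "((\<lambda>z. C + ?A * z ^ (2 * \<alpha> k)) has_real_derivative 0 + ?A * (real (2 * \<alpha> k) * y k ^ (2 * \<alpha> k - Suc 0))) (at (y k))"
    by (intro DERIV_add DERIV_const DERIV_cmult DERIV_pow)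
  then have "deriv (\<lambda>z. C + ?A * z ^ (2 * \<alpha> k)) (y k) = ?A * (real (2 * \<alpha> k) * y k ^ (2 * \<alpha> k - Suc 0))"
    by (simp add: DERIV_imp_deriv)
  then show ?thesis unfolding dham_dx_def h by (simp add: algebra_simps)
qed

lemma rho_power2:
  assumes "\<theta> \<ge> 1"
  shows "(rho \<theta> s)\<^sup>2 = s ^ (2 * \<theta>)"
proof -
  obtain m where m: "\<theta> = Suc m" using assms by (cases \<theta>) auto
  have "(rho \<theta> s)\<^sup>2 = (s ^ m * s)\<^sup>2"
    by (simp add: rho_def m power_mult_distrib power_abs[symmetric])
  also have "\<dots> = (s ^ \<theta>)\<^sup>2" by (simp add: m mult.commute)
  finally show ?thesis by (simp add: power_mult[symmetric] mult.commute)
qed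

lemma rho_eq_0_iff: "rho \<theta> s = 0 \<longleftrightarrow> s = 0"
  by (auto simp: rho_def)

lemma power_lipschitz:
  fixes B :: real
  assumes "B \<ge> 0"
  obtains L where "L \<ge> 0" "\<And>y z. \<bar>y\<bar> \<le> B \<Longrightarrow> \<bar>z\<bar> \<le> B \<Longrightarrow> \<bar>y ^ N - z ^ N\<bar> \<le> L * \<bar>y - z\<bar>"
proof -
  obtain M where M: "M \<ge> 0" "\<And>y z. \<bar>y\<bar> \<le> B \<Longrightarrow> \<bar>z\<bar> \<le> B \<Longrightarrow>
     \<bar>y ^ N - z ^ N - real N * z ^ (N - 1) * (y - z)\<bar> \<le> M * (y - z)\<^sup>2"
    using power_second_order_bound[OF assms, of N] by blast
  show thesis
  proof (rule that[of "M * (2 * B) + real N * B ^ (N - 1)"])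
    show "0 \<le> M * (2 * B) + real N * B ^ (N - 1)" using M(1) assms by simp
    fix y z :: real assume yz: "\<bar>y\<bar> \<le> B" "\<bar>z\<bar> \<le> B"
    have "\<bar>y ^ N - z ^ N\<bar> \<le> M * (y - z)\<^sup>2 + \<bar>real N * z ^ (N - 1) * (y - z)\<bar>"
      using M(2)[OF yz] by linarith
    also have "M * (y - z)\<^sup>2 \<le> M * (2 * B) * \<bar>y - z\<bar>"
    proof -
      have "\<bar>y - z\<bar> \<le> 2 * B" using yz by linarith
      then have "\<bar>y - z\<bar> * \<bar>y - z\<bar> \<le> 2 * B * \<bar>y - z\<bar>" by (rule mult_right_mono) simp
      then have "M * (\<bar>y - z\<bar> * \<bar>y - z\<bar>) \<le> M * (2 * B * \<bar>y - z\<bar>)" using M(1) by (rule mult_left_mono)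
      then show ?thesis by (simp add: power2_eq_square mult.assoc)
    qed
    also have "\<bar>real N * z ^ (N - 1) * (y - z)\<bar> \<le> real N * B ^ (N - 1) * \<bar>y - z\<bar>"
      unfolding abs_mult power_abs using yz by (intro mult_right_mono mult_mono power_mono) auto
    finally show "\<bar>y ^ N - z ^ N\<bar> \<le> (M * (2 * B) + real N * B ^ (N - 1)) * \<bar>y - z\<bar>"
      by (simp add: distrib_right)
  qed
qed

text \<open>Gronwall's argument for the oscillator run in the clock \<open>\<sigma>\<close>.
  Comparing the solutions in the time \<open>t\<close>, with \<open>\<sigma>\<close> in the
  exponential, avoids inverting the clock where its rate \<open>w\<close> vanishes.\<close>

lemma weighted_ode_unique:
  fixes u v U V w \<sigma> :: "real \<Rightarrow> real" and k :: real and N :: nat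
  assumes T: "0 \<le> T"
    and du: "\<And>t. t \<in> {0..T} \<Longrightarrow> (u has_real_derivative w t * v t) (at t within {0..T})"
    and dv: "\<And>t. t \<in> {0..T} \<Longrightarrow> (v has_real_derivative w t * (k * u t ^ N)) (at t within {0..T})"
    and dU: "\<And>t. t \<in> {0..T} \<Longrightarrow> (U has_real_derivative w t * V t) (at t within {0..T})"
    and dV: "\<And>t. t \<in> {0..T} \<Longrightarrow> (V has_real_derivative w t * (k * U t ^ N)) (at t within {0..T})"
    and d\<sigma>: "\<And>t. t \<in> {0..T} \<Longrightarrow> (\<sigma> has_real_derivative w t) (at t within {0..T})"
    and w: "\<And>t. t \<in> {0..T} \<Longrightarrow> w t \<ge> 0"
    and init: "u 0 = U 0" "v 0 = V 0"
  shows "u T = U T \<and> v T = V T"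
proof -
  have cu: "continuous_on {0..T} u" using du by (rule DERIV_continuous_on)
  have cU: "continuous_on {0..T} U" using dU by (rule DERIV_continuous_on)
  have "compact ((\<lambda>t. \<bar>u t\<bar> + \<bar>U t\<bar>) ` {0..T})"
    by (intro compact_continuous_image continuous_intros cu cU) simp
  then have "bounded ((\<lambda>t. \<bar>u t\<bar> + \<bar>U t\<bar>) ` {0..T})" by (rule compact_imp_bounded)
  then obtain B where B: "\<And>t. t \<in> {0..T} \<Longrightarrow> \<bar>u t\<bar> + \<bar>U t\<bar> \<le> B"
    unfolding bounded_iff by fastforce
  have "B \<ge> 0" using B[of 0] T by auto
  then obtain L where L: "L \<ge> 0" "\<And>y z. \<bar>y\<bar> \<le> B \<Longrightarrow> \<bar>z\<bar> \<le> B \<Longrightarrow> \<bar>y ^ N - z ^ N\<bar> \<le> L * \<bar>y - z\<bar>"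
    using power_lipschitz[of B N] by metis
  \<comment> \<open>The 1 comes from the equation for \<open>u\<close>, the other summand from the
    Lipschitz bound on the force in the equation for \<open>v\<close>.\<close>
  define C where "C = 1 + \<bar>k\<bar> * L"
  define d where "d t = (u t - U t) * (u t - U t) + (v t - V t) * (v t - V t)" for t
  define d' where "d' t = 2 * w t * ((u t - U t) * (v t - V t) + (v t - V t) * (k * (u t ^ N - U t ^ N)))" for t
  have dd: "(d has_real_derivative d' t) (at t within {0..T})" if t: "t \<in> {0..T}" for t
  proof -
    have a: "((\<lambda>t. u t - U t) has_real_derivative w t * v t - w t * V t) (at t within {0..T})"
      by (intro DERIV_diff du dU t)
    have b: "((\<lambda>t. v t - V t) has_real_derivative w t * (k * u t ^ N) - w t * (k * U t ^ N)) (at t within {0..T})"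
      by (intro DERIV_diff dv dV t)
    show ?thesis unfolding d_def[abs_def]
      by (rule DERIV_cong[OF DERIV_add[OF DERIV_mult[OF a a] DERIV_mult[OF b b]]]) (simp add: d'_def algebra_simps)
  qed
  have d'le: "d' t \<le> C * w t * d t" if t: "t \<in> {0..T}" for t
  proof -
    let ?a = "u t - U t" and ?b = "v t - V t"
    have ab: "2 * (\<bar>?a\<bar> * \<bar>?b\<bar>) \<le> d t"
      using zero_le_power2[of "\<bar>?a\<bar> - \<bar>?b\<bar>"] unfolding d_def by (simp add: power2_eq_square algebra_simps abs_mult[symmetric])
    have "\<bar>u t ^ N - U t ^ N\<bar> \<le> L * \<bar>?a\<bar>" using L(2)[of "u t" "U t"] B[OF t] by simp
    then have "\<bar>?b\<bar> * (\<bar>k\<bar> * \<bar>u t ^ N - U t ^ N\<bar>) \<le> \<bar>?b\<bar> * (\<bar>k\<bar> * (L * \<bar>?a\<bar>))"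
      by (intro mult_left_mono) auto
    moreover have "?a * ?b + ?b * (k * (u t ^ N - U t ^ N)) \<le> \<bar>?a\<bar> * \<bar>?b\<bar> + \<bar>?b\<bar> * (\<bar>k\<bar> * \<bar>u t ^ N - U t ^ N\<bar>)"
      unfolding abs_mult[symmetric] by (intro add_mono abs_ge_self)
    ultimately have "?a * ?b + ?b * (k * (u t ^ N - U t ^ N)) \<le> C * (\<bar>?a\<bar> * \<bar>?b\<bar>)"
      by (simp add: C_def algebra_simps)
    then have "d' t \<le> 2 * w t * (C * (\<bar>?a\<bar> * \<bar>?b\<bar>))"
      unfolding d'_def using w[OF t] by (intro mult_left_mono) auto
    also have "\<dots> = C * w t * (2 * (\<bar>?a\<bar> * \<bar>?b\<bar>))" by (simp add: algebra_simps)
    also have "\<dots> \<le> C * w t * d t"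
      using ab w[OF t] L(1) by (intro mult_left_mono) (auto simp: C_def)
    finally show ?thesis .
  qed
  define h where "h t = d t * exp (- C * \<sigma> t)" for t
  have dh: "(h has_real_derivative (d' t - C * w t * d t) * exp (- C * \<sigma> t)) (at t within {0..T})" if t: "t \<in> {0..T}" for t
  proof -
    have "((\<lambda>t. exp (- C * \<sigma> t)) has_real_derivative exp (- C * \<sigma> t) * (- C * w t)) (at t within {0..T})"
      by (rule DERIV_chain2[OF DERIV_exp DERIV_cmult[OF d\<sigma>[OF t]]])
    from DERIV_mult[OF dd[OF t] this] show ?thesis
      unfolding h_def[abs_def] by (rule DERIV_cong) (simp add: algebra_simps)
  qed
  have "h T \<le> h 0"
  proof (rule DERIV_nonpos_imp_decreasing_open[OF T])
    fix t assume t: "0 < t" "t < T"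
    then have "(h has_real_derivative (d' t - C * w t * d t) * exp (- C * \<sigma> t)) (at t)"
      using dh[of t] by (simp add: at_within_Icc_at)
    moreover have "(d' t - C * w t * d t) * exp (- C * \<sigma> t) \<le> 0"
      using d'le[of t] t by (simp add: mult_nonpos_nonneg)
    ultimately show "\<exists>y. (h has_real_derivative y) (at t) \<and> y \<le> 0" by blast
  next
    show "continuous_on {0..T} h" using dh by (rule DERIV_continuous_on)
  qed
  moreover have "h 0 = 0" by (simp add: h_def d_def init)
  ultimately have "d T \<le> 0" by (simp add: h_def mult_le_0_iff)
  moreover have "(u T - U T) * (u T - U T) \<ge> 0" "(v T - V T) * (v T - V T) \<ge> 0" by simp_all
  ultimately have "(u T - U T) * (u T - U T) = 0" "(v T - V T) * (v T - V T) = 0"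
    unfolding d_def by linarith+
  then show ?thesis by simp
qed

lemma absolutely_integrable_times_norm:
  fixes u :: "nat \<Rightarrow> real \<Rightarrow> real"
  assumes "finite K" "\<And>k. k \<in> K \<Longrightarrow> u k absolutely_integrable_on {a..b}" "continuous_on {a..b} g"
  shows "(\<lambda>t. g t * sqrt (\<Sum>k\<in>K. (u k t)\<^sup>2)) absolutely_integrable_on {a..b}"
proof (rule absolutely_integrable_bounded_measurable_product_real)
  show "g \<in> borel_measurable (lebesgue_on {a..b})"
    by (rule continuous_imp_measurable_on_sets_lebesgue[OF assms(3)]) simp
  show "bounded (g ` {a..b})"
    by (intro compact_imp_bounded compact_continuous_image assms) simp
  show "(\<lambda>t. sqrt (\<Sum>k\<in>K. (u k t)\<^sup>2)) absolutely_integrable_on {a..b}"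
  proof (rule measurable_bounded_by_integrable_imp_absolutely_integrable)
    show "(\<lambda>t. sqrt (\<Sum>k\<in>K. (u k t)\<^sup>2)) \<in> borel_measurable (lebesgue_on {a..b})"
    proof (rule measurable_compose[OF _ borel_measurable_sqrt], intro borel_measurable_sum borel_measurable_power)
      show "u k \<in> borel_measurable (lebesgue_on {a..b})" if "k \<in> K" for k
        using absolutely_integrable_measurable[of "{a..b}" "u k"] assms(2)[OF that] by simp
    qed
    have "(\<lambda>t. \<bar>u k t\<bar>) integrable_on {a..b}" if "k \<in> K" for k
      using assms(2)[OF that] by (simp add: absolutely_integrable_on_def)
    then show "(\<lambda>t. \<Sum>k\<in>K. \<bar>u k t\<bar>) integrable_on {a..b}"
      using assms(1) by (intro integrable_sum) auto
    show "norm (sqrt (\<Sum>k\<in>K. (u k t)\<^sup>2)) \<le> (\<Sum>k\<in>K. \<bar>u k t\<bar>)" for t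
      using L2_set_le_sum_abs[of "\<lambda>k. u k t" K] by (simp add: L2_set_def sum_nonneg)
  qed simp
qed simp

section \<open>Admissible curves: continuity, level speeds and displacement\<close>

lemma horizontalD:
  assumes "horizontal n \<alpha> T \<gamma> u"
  shows "0 \<le> T" "j \<in> {1..n+1} \<Longrightarrow> u j absolutely_integrable_on {0..T}"
    "j \<in> {1..n+1} \<Longrightarrow> t \<in> {0..T} \<Longrightarrow> ((\<lambda>s. u j s * xi \<alpha> j (\<gamma> s)) has_integral (\<gamma> t j - \<gamma> 0 j)) {0..t}"
  using assms by (auto simp: horizontal_def)

lemma horizontal_continuous:
  assumes h: "horizontal n \<alpha> T \<gamma> u" and j: "j \<in> {1..n+1}"
  shows "continuous_on {0..T} (\<lambda>t. \<gamma> t j)"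
proof -
  let ?f = "\<lambda>s. u j s * xi \<alpha> j (\<gamma> s)"
  have "?f integrable_on {0..T}" using horizontalD(3)[OF h j, of T] horizontalD(1)[OF h] by auto
  then have "continuous_on {0..T} (\<lambda>t. \<gamma> 0 j + integral {0..t} ?f)"
    by (intro continuous_intros indefinite_integral_continuous_1)
  then show ?thesis
  proof (rule continuous_on_eq)
    fix t assume "t \<in> {0..T}"
    from integral_unique[OF horizontalD(3)[OF h j this]] show "\<gamma> 0 j + integral {0..t} ?f = \<gamma> t j" by simp
  qed
qed

lemma horizontal_continuous_xi:
  assumes h: "horizontal n \<alpha> T \<gamma> u" and "k \<le> n + 2"
  shows "continuous_on {0..T} (\<lambda>t. xi \<alpha> k (\<gamma> t))"
  unfolding xi_def using assms(2) by (intro continuous_intros horizontal_continuous[OF h]) auto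

text \<open>The speed of \<open>(\<gamma> j, \<dots>, \<gamma> (n+1))\<close> in the Grushin metric of these coordinates alone, i.e. with \<open>eta \<alpha> j k\<close>
  in place of \<open>xi \<alpha> k\<close>.\<close>
definition level_speed :: "nat \<Rightarrow> (nat \<Rightarrow> nat) \<Rightarrow> (real \<Rightarrow> nat \<Rightarrow> real) \<Rightarrow> (nat \<Rightarrow> real \<Rightarrow> real) \<Rightarrow> nat \<Rightarrow> real \<Rightarrow> real" where
  "level_speed n \<alpha> \<gamma> u j t = \<bar>xi \<alpha> j (\<gamma> t)\<bar> * sqrt (\<Sum>k\<in>{j..n+1}. (u k t)\<^sup>2)"

lemma level_speed_integrable:
  assumes h: "horizontal n \<alpha> T \<gamma> u" and "1 \<le> j" "j \<le> n + 1"
  shows "level_speed n \<alpha> \<gamma> u j integrable_on {0..T}"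
proof -
  have "(\<lambda>t. \<bar>xi \<alpha> j (\<gamma> t)\<bar> * sqrt (\<Sum>k\<in>{j..n+1}. (u k t)\<^sup>2)) absolutely_integrable_on {0..T}"
    using assms(2,3) by (intro absolutely_integrable_times_norm horizontalD(2)[OF h] continuous_intros horizontal_continuous_xi[OF h]) auto
  then show ?thesis
    unfolding level_speed_def[abs_def] by (rule set_lebesgue_integral_eq_integral(1))
qed

lemma ctrl_length_eq_level_speed: "ctrl_length n T u = integral {0..T} (level_speed n \<alpha> \<gamma> u 1)"
proof -
  have "xi \<alpha> 1 y = 1" for y by (simp add: xi_def)
  then show ?thesis by (simp only: ctrl_length_def level_speed_def[abs_def] abs_one mult_1)
qed

lemma ctrl_length_integrable:
  assumes h: "horizontal n \<alpha> T \<gamma> u"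
  shows "(\<lambda>t. sqrt (\<Sum>k\<in>{1..n+1}. (u k t)\<^sup>2)) integrable_on {0..T}"
  using level_speed_integrable[OF h, of 1] by (simp add: level_speed_def[abs_def])

lemma horizontal_displacement:
  assumes h: "horizontal n \<alpha> T \<gamma> u" and j: "j \<in> {1..n+1}" and t: "t \<in> {0..T}"
    and C: "\<And>s. s \<in> {0..T} \<Longrightarrow> \<bar>xi \<alpha> j (\<gamma> s)\<bar> \<le> C" and C0: "0 \<le> C"
  shows "\<bar>\<gamma> t j - \<gamma> 0 j\<bar> \<le> C * ctrl_length n T u"
proof -
  let ?w = "\<lambda>t. sqrt (\<Sum>k\<in>{1..n+1}. (u k t)\<^sup>2)" and ?f = "\<lambda>s. u j s * xi \<alpha> j (\<gamma> s)"
  have iw: "?w integrable_on {0..T}" by (rule ctrl_length_integrable[OF h])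
  have iwt: "?w integrable_on {0..t}" by (rule integrable_on_subinterval[OF iw]) (use t in auto)
  have w: "\<bar>u j s\<bar> \<le> ?w s" for s
  proof (rule real_le_rsqrt)
    show "\<bar>u j s\<bar>\<^sup>2 \<le> (\<Sum>k\<in>{1..n+1}. (u k s)\<^sup>2)"
      unfolding power2_abs by (rule member_le_sum[of j "{1..n+1}" "\<lambda>k. (u k s)\<^sup>2"]) (use j in simp_all)
  qed
  have "norm (integral {0..t} ?f) \<le> integral {0..t} (\<lambda>s. C * ?w s)"
  proof (rule integral_norm_bound_integral)
    show "?f integrable_on {0..t}" using horizontalD(3)[OF h j t] by blast
    show "(\<lambda>s. C * ?w s) integrable_on {0..t}" by (rule integrable_on_mult_right[OF iwt])
    fix s assume "s \<in> {0..t}"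
    then have "\<bar>xi \<alpha> j (\<gamma> s)\<bar> \<le> C" using C[of s] t by simp
    then have "\<bar>xi \<alpha> j (\<gamma> s)\<bar> * \<bar>u j s\<bar> \<le> C * ?w s" using w C0 by (intro mult_mono) auto
    then show "norm (?f s) \<le> C * ?w s" by (simp only: real_norm_def abs_mult mult.commute)
  qed
  also have "\<dots> = C * integral {0..t} ?w" by (rule integral_mult_right)
  also have "\<dots> \<le> C * integral {0..T} ?w"
  proof (rule mult_left_mono[OF _ C0], rule integral_subset_le[OF _ iwt iw])
    show "{0..t} \<subseteq> {0..T}" using t by auto
    show "\<forall>s\<in>{0..T}. 0 \<le> ?w s" by (intro ballI real_sqrt_ge_zero sum_nonneg) simp
  qed
  finally show ?thesis
    using integral_unique[OF horizontalD(3)[OF h j t]] by (simp add: ctrl_length_def)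
qed

section \<open>The geodesic in oscillator coordinates\<close>

locale grushin_geodesic =
  fixes n :: nat and \<alpha> :: "nat \<Rightarrow> nat" and x0 \<phi> :: "nat \<Rightarrow> real"
    and x p :: "real \<Rightarrow> nat \<Rightarrow> real"
  assumes n1: "n \<ge> 1"
    and riem: "riemannian_point n \<alpha> x0"
    and phi: "\<phi> \<in> R0_alpha n \<alpha>"
    and ham_sol: "hamilton_solution n \<alpha> x0 (p0_sph n \<alpha> x0 \<phi>) x p"
begin

text \<open>Up to sign, the conserved value of \<open>sqrt (tail_energy n \<alpha> j x p)\<close>.\<close>
definition mom :: "nat \<Rightarrow> real" where
  "mom j = (\<Prod>i\<in>{1..<j}. delta \<alpha> x0 \<phi> i)"

definition clock :: "nat \<Rightarrow> real \<Rightarrow> real" where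
  "clock j t = integral {0..t} (\<lambda>s. (xi \<alpha> j (x s))\<^sup>2)"

lemma mom_1 [simp]: "mom (Suc 0) = 1"
  by (simp add: mom_def)

lemma mom_Suc: "1 \<le> j \<Longrightarrow> mom (Suc j) = mom j * delta \<alpha> x0 \<phi> j"
  by (simp add: mom_def prod.atLeastLessThan_Suc)

lemma alpha_t_ge_1: "alpha_t \<alpha> j \<ge> 1"
  by (simp add: alpha_t_def)

lemma sin_nz: "1 \<le> j \<Longrightarrow> j \<le> n \<Longrightarrow> gsin (real (alpha_t \<alpha> j)) (\<phi> j) \<noteq> 0"
  using phi by (simp add: R0_alpha_def)

lemma x0_nz: "1 \<le> j \<Longrightarrow> j \<le> n \<Longrightarrow> \<alpha> j \<noteq> 0 \<Longrightarrow> x0 j \<noteq> 0"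
  using riem by (simp add: riemannian_point_def Jset_def)

lemma delta_nz: "1 \<le> j \<Longrightarrow> j \<le> n \<Longrightarrow> delta \<alpha> x0 \<phi> j \<noteq> 0"
  using sin_nz[of j] x0_nz[of j] by (simp add: delta_def rho_eq_0_iff x0_t_def)

lemma mom_nz: "j \<le> n + 1 \<Longrightarrow> mom j \<noteq> 0"
  using delta_nz by (auto simp: mom_def)

lemma p0_eq: "1 \<le> j \<Longrightarrow> j \<le> n \<Longrightarrow> p0_sph n \<alpha> x0 \<phi> j = gcos (real (alpha_t \<alpha> j)) (\<phi> j) * mom j"
  by (simp add: p0_sph_def mom_def)

lemma p0_last: "p0_sph n \<alpha> x0 \<phi> (n+1) = mom (n+1)"
  by (simp add: p0_sph_def mom_def atLeastLessThanSuc_atLeastAtMost)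

text \<open>The spherical coordinates are made for this: the generalized Pythagorean identity splits
  the energy of level \<open>j\<close> into the part of \<open>p_j\<close> and the part of level
  \<open>j + 1\<close>. For \<open>\<alpha> j = 0\<close> the conventions \<open>alpha_t = 1\<close>
  and \<open>x0_t = 1\<close> reduce it to the same identity with exponent 2.\<close>

lemma initial_energy:
  assumes "1 \<le> j" "j \<le> n"
  shows "(p0_sph n \<alpha> x0 \<phi> j)\<^sup>2 + (mom (Suc j))\<^sup>2 * x0 j ^ (2 * \<alpha> j) = (mom j)\<^sup>2"
proof -
  let ?a = "alpha_t \<alpha> j"
  have "(delta \<alpha> x0 \<phi> j)\<^sup>2 * x0 j ^ (2 * \<alpha> j) = gsin (real ?a) (\<phi> j) ^ (2 * ?a)"
    using x0_nz[OF assms] unfolding delta_def rho_power2[OF alpha_t_ge_1]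
    by (cases "\<alpha> j = 0") (simp_all add: alpha_t_def x0_t_def power_divide)
  moreover have "(gcos (real ?a) (\<phi> j))\<^sup>2 + gsin (real ?a) (\<phi> j) ^ (2 * ?a) = 1"
    by (rule gsin_gcos_pythagoras[OF alpha_t_ge_1])
  ultimately have "(mom j)\<^sup>2 * ((gcos (real ?a) (\<phi> j))\<^sup>2 + (delta \<alpha> x0 \<phi> j)\<^sup>2 * x0 j ^ (2 * \<alpha> j)) = (mom j)\<^sup>2"
    by simp
  then show ?thesis
    by (simp add: p0_eq[OF assms] mom_Suc[OF assms(1)] power_mult_distrib algebra_simps)
qed

lemma initial:
  "1 \<le> j \<Longrightarrow> j \<le> n + 1 \<Longrightarrow> x 0 j = x0 j" "1 \<le> j \<Longrightarrow> j \<le> n + 1 \<Longrightarrow> p 0 j = p0_sph n \<alpha> x0 \<phi> j"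
  using ham_sol by (simp_all add: hamilton_solution_def)

lemma ham_x_deriv:
  assumes "1 \<le> j" "j \<le> n + 1" "0 \<le> t"
  shows "((\<lambda>s. x s j) has_real_derivative (xi \<alpha> j (x t))\<^sup>2 * p t j) (at t within {0..})"
  using ham_sol assms by (simp add: hamilton_solution_def)

lemma ham_p_deriv:
  assumes "1 \<le> j" "j \<le> n + 1" "0 \<le> t"
  shows "((\<lambda>s. p s j) has_real_derivative
     - ((xi \<alpha> j (x t))\<^sup>2 * (real (\<alpha> j) * x t j ^ (2 * \<alpha> j - 1)) * tail_energy n \<alpha> (Suc j) (x t) (p t))) (at t within {0..})"
proof -
  have "((\<lambda>s. p s j) has_real_derivative - dham_dx n \<alpha> j (x t) (p t)) (at t within {0..})"
    using ham_sol assms by (simp add: hamilton_solution_def)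
  then show ?thesis unfolding dham_dx_eq[OF assms(1,2)] .
qed

lemma tail_energy_end: "tail_energy n \<alpha> (Suc (n+1)) y q = 0"
  by (simp add: tail_energy_def)

lemma p_last:
  assumes "0 \<le> t"
  shows "p t (n+1) = mom (n+1)"
proof -
  have "((\<lambda>s. p s (n+1)) has_real_derivative 0) (at t within {0..})" if "0 \<le> t" for t
    using ham_p_deriv[of "n+1" t] that unfolding tail_energy_end by simp
  from zero_deriv_constant[of "\<lambda>s. p s (n+1)", OF this assms] show ?thesis
    using initial(2)[of "n+1"] p0_last by simp
qed

text \<open>Downward induction: once \<open>tail_energy (Suc j)\<close> is constant,
  \<open>x_j\<close> and \<open>p_j\<close> form a system with one degree of freedom, multiplied by
  the common rate \<open>xi_j\<^sup>2\<close>, and \<open>tail_energy j\<close> is its first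
  integral. At time 0 its value is given by \<open>initial_energy\<close>.\<close>

lemma energy_conserved:
  assumes "1 \<le> j" "j \<le> n + 1"
  shows "\<forall>t\<ge>0. tail_energy n \<alpha> j (x t) (p t) = (mom j)\<^sup>2"
  using assms(2,1)
proof (induction j rule: inc_induct)
  case base
  then show ?case unfolding tail_energy_rec[OF order_refl] tail_energy_end using p_last by simp
next
  case (step j)
  then have j: "1 \<le> j" "j \<le> n" "j \<le> n + 1" by auto
  have IH: "tail_energy n \<alpha> (Suc j) (x t) (p t) = (mom (Suc j))\<^sup>2" if "0 \<le> t" for t using step.IH that by simp
  let ?f = "\<lambda>t. p t j * p t j + (mom (Suc j))\<^sup>2 * x t j ^ (2 * \<alpha> j)"
  have "(?f has_real_derivative 0) (at t within {0..})" if t: "0 \<le> t" for t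
  proof -
    note dp = ham_p_deriv[OF j(1,3) t, unfolded IH[OF t]] and dx = ham_x_deriv[OF j(1,3) t]
    have dxp: "((\<lambda>s. x s j ^ (2 * \<alpha> j)) has_real_derivative
        real (2 * \<alpha> j) * x t j ^ (2 * \<alpha> j - Suc 0) * ((xi \<alpha> j (x t))\<^sup>2 * p t j)) (at t within {0..})"
      by (rule DERIV_chain2[OF DERIV_pow dx])
    show ?thesis
      by (rule DERIV_cong[OF DERIV_add[OF DERIV_mult[OF dp dp] DERIV_cmult[OF dxp]]]) (simp add: algebra_simps)
  qed
  then have f: "?f t = ?f 0" if "0 \<le> t" for t using zero_deriv_constant[of ?f] that by blast
  have "?f 0 = (mom j)\<^sup>2"
    using initial_energy[OF j(1,2)] initial[OF j(1,3)] by (simp add: power2_eq_square)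
  then show ?case using f IH by (simp add: tail_energy_rec[OF j(3)] power2_eq_square mult.commute)
qed

lemma x_deriv:
  assumes "1 \<le> j" "j \<le> n + 1" "t \<in> {0..T}"
  shows "((\<lambda>s. x s j) has_real_derivative (xi \<alpha> j (x t))\<^sup>2 * p t j) (at t within {0..T})"
  by (rule DERIV_subset[OF ham_x_deriv]) (use assms in auto)

lemma p_deriv:
  assumes "1 \<le> j" "j \<le> n" "t \<in> {0..T}"
  shows "((\<lambda>s. p s j) has_real_derivative (xi \<alpha> j (x t))\<^sup>2 * (- (real (\<alpha> j) * (mom (Suc j))\<^sup>2) * x t j ^ (2 * \<alpha> j - 1))) (at t within {0..T})"
proof -
  have t: "0 \<le> t" and j: "j \<le> n + 1" using assms by auto
  have e: "tail_energy n \<alpha> (Suc j) (x t) (p t) = (mom (Suc j))\<^sup>2"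
    using energy_conserved[of "Suc j"] assms(2) t by simp
  have "((\<lambda>s. p s j) has_real_derivative
     - ((xi \<alpha> j (x t))\<^sup>2 * (real (\<alpha> j) * x t j ^ (2 * \<alpha> j - 1)) * (mom (Suc j))\<^sup>2)) (at t within {0..T})"
    by (rule DERIV_subset[OF ham_p_deriv[OF assms(1) j t, unfolded e]]) auto
  then show ?thesis by (rule DERIV_cong) (simp add: algebra_simps)
qed

lemma continuous_x: "1 \<le> j \<Longrightarrow> j \<le> n + 1 \<Longrightarrow> continuous_on {0..T} (\<lambda>t. x t j)"
  by (rule DERIV_continuous_on[OF x_deriv])

lemma continuous_p:
  assumes "1 \<le> j" "j \<le> n + 1"
  shows "continuous_on {0..T} (\<lambda>t. p t j)"
proof (cases "j = n + 1")
  case True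
  have "continuous_on {0..T} (\<lambda>t. mom (n+1))" by simp
  then show ?thesis by (rule continuous_on_eq) (use p_last True in auto)
next
  case False
  then show ?thesis using assms by (intro DERIV_continuous_on[OF p_deriv]) auto
qed

lemma continuous_eta: "1 \<le> j \<Longrightarrow> k \<le> n + 2 \<Longrightarrow> continuous_on {0..T} (\<lambda>t. eta \<alpha> j k (x t))"
  unfolding eta_def by (intro continuous_intros continuous_x) auto

lemma continuous_xi: "k \<le> n + 2 \<Longrightarrow> continuous_on {0..T} (\<lambda>t. xi \<alpha> k (x t))"
  unfolding xi_eq_eta by (rule continuous_eta) auto

lemma clock_deriv:
  assumes "j \<le> n + 2" "t \<in> {0..T}"
  shows "(clock j has_real_derivative (xi \<alpha> j (x t))\<^sup>2) (at t within {0..T})"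
  unfolding clock_def[abs_def]
  by (rule integral_has_real_derivative) (use assms in \<open>auto intro!: continuous_intros continuous_xi\<close>)

lemma clock_0 [simp]: "clock j 0 = 0"
  by (simp add: clock_def)

lemma clock_1: "0 \<le> t \<Longrightarrow> clock (Suc 0) t = t"
  by (simp add: clock_def)

section \<open>The one-dimensional oscillators and the nested clocks\<close>

definition osc :: "nat \<Rightarrow> real \<Rightarrow> real" where
  "osc j s = (if \<alpha> j = 0 then x0 j + p0_sph n \<alpha> x0 \<phi> j * s
     else x0 j / gsin (real (\<alpha> j)) (\<phi> j) * gsin (real (\<alpha> j)) (\<phi> j + omega \<alpha> x0 \<phi> j * s))"

definition osc' :: "nat \<Rightarrow> real \<Rightarrow> real" where
  "osc' j s = (if \<alpha> j = 0 then p0_sph n \<alpha> x0 \<phi> j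
     else mom j * gcos (real (\<alpha> j)) (\<phi> j + omega \<alpha> x0 \<phi> j * s))"

lemma sin_nz': "1 \<le> j \<Longrightarrow> j \<le> n \<Longrightarrow> \<alpha> j \<noteq> 0 \<Longrightarrow> gsin (real (\<alpha> j)) (\<phi> j) \<noteq> 0"
  using sin_nz[of j] by (simp add: alpha_t_def)

lemma omega_eq: "omega \<alpha> x0 \<phi> j = gsin (real (\<alpha> j)) (\<phi> j) / x0 j * mom j"
  by (simp add: omega_def mom_def)

lemma amp_omega:
  assumes "1 \<le> j" "j \<le> n" "\<alpha> j \<noteq> 0"
  shows "x0 j / gsin (real (\<alpha> j)) (\<phi> j) * omega \<alpha> x0 \<phi> j = mom j"
  using sin_nz'[OF assms] x0_nz[OF assms] by (simp add: omega_eq)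

text \<open>The energy balance at a turning point, where \<open>osc\<close> has its full amplitude
  and the whole energy of the level is potential.\<close>

lemma amp_power:
  assumes "1 \<le> j" "j \<le> n" "\<alpha> j \<noteq> 0"
  shows "(mom (Suc j))\<^sup>2 * (x0 j / gsin (real (\<alpha> j)) (\<phi> j)) ^ (2 * \<alpha> j) = (mom j)\<^sup>2"
proof -
  have "(delta \<alpha> x0 \<phi> j)\<^sup>2 = (gsin (real (\<alpha> j)) (\<phi> j) / x0 j) ^ (2 * \<alpha> j)"
    unfolding delta_def rho_power2[OF alpha_t_ge_1] using assms(3) by (simp add: alpha_t_def x0_t_def)
  then show ?thesis
    using sin_nz'[OF assms] x0_nz[OF assms] by (simp add: mom_Suc[OF assms(1)] power_mult_distrib power_divide)
qed

lemma osc_deriv: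
  assumes "1 \<le> j" "j \<le> n"
  shows "(osc j has_real_derivative osc' j s) (at s)"
proof (cases "\<alpha> j = 0")
  case True
  have "((\<lambda>s. x0 j + p0_sph n \<alpha> x0 \<phi> j * s) has_real_derivative 0 + p0_sph n \<alpha> x0 \<phi> j * 1) (at s)"
    by (intro DERIV_add DERIV_const DERIV_cmult DERIV_ident)
  then show ?thesis using True by (simp add: osc_def[abs_def] osc'_def)
next
  case False
  have "((\<lambda>s. \<phi> j + omega \<alpha> x0 \<phi> j * s) has_real_derivative 0 + omega \<alpha> x0 \<phi> j * 1) (at s)"
    by (intro DERIV_add DERIV_const DERIV_cmult DERIV_ident)
  from DERIV_cmult[OF DERIV_chain2[OF DERIV_gsin this], of "\<alpha> j" "x0 j / gsin (real (\<alpha> j)) (\<phi> j)"] False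
  have "(osc j has_real_derivative x0 j / gsin (real (\<alpha> j)) (\<phi> j) * (gcos (real (\<alpha> j)) (\<phi> j + omega \<alpha> x0 \<phi> j * s) * (0 + omega \<alpha> x0 \<phi> j * 1))) (at s)"
    by (simp add: osc_def[abs_def])
  then show ?thesis
    by (rule DERIV_cong) (use amp_omega[OF assms False, symmetric] False in \<open>simp add: osc'_def\<close>)
qed

lemma osc'_deriv:
  assumes "1 \<le> j" "j \<le> n"
  shows "(osc' j has_real_derivative - (real (\<alpha> j) * (mom (Suc j))\<^sup>2 * osc j s ^ (2 * \<alpha> j - 1))) (at s)"
proof (cases "\<alpha> j = 0")
  case True
  then show ?thesis by (simp add: osc'_def[abs_def])
next
  case False
  let ?A = "x0 j / gsin (real (\<alpha> j)) (\<phi> j)" and ?S = "gsin (real (\<alpha> j)) (\<phi> j + omega \<alpha> x0 \<phi> j * s)"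
  have "((\<lambda>s. \<phi> j + omega \<alpha> x0 \<phi> j * s) has_real_derivative 0 + omega \<alpha> x0 \<phi> j * 1) (at s)"
    by (intro DERIV_add DERIV_const DERIV_cmult DERIV_ident)
  from DERIV_cmult[OF DERIV_chain2[OF DERIV_gcos this], of "\<alpha> j" "mom j"] False
  have d: "(osc' j has_real_derivative mom j * (- (real (\<alpha> j) * ?S ^ (2 * \<alpha> j - 1)) * (0 + omega \<alpha> x0 \<phi> j * 1))) (at s)"
    by (simp add: osc'_def[abs_def])
  have A: "?A \<noteq> 0" using sin_nz'[OF assms False] x0_nz[OF assms False] by simp
  \<comment> \<open>The coefficient with the odd power of the amplitude is found by multiplying by
    \<open>?A\<close>, inserting \<open>amp_power\<close> and \<open>amp_omega\<close>, and
    cancelling \<open>?A\<close>.\<close>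
  have "(mom (Suc j))\<^sup>2 * ?A ^ (2 * \<alpha> j - 1) * ?A = (mom (Suc j))\<^sup>2 * ?A ^ (2 * \<alpha> j)"
    using False by (cases "\<alpha> j") auto
  also have "\<dots> = mom j * (?A * omega \<alpha> x0 \<phi> j)"
    using amp_power[OF assms False] amp_omega[OF assms False] by (simp add: power2_eq_square)
  finally have "((mom (Suc j))\<^sup>2 * ?A ^ (2 * \<alpha> j - 1)) * ?A = (mom j * omega \<alpha> x0 \<phi> j) * ?A"
    by (simp only: mult.assoc mult.commute mult.left_commute)
  then have e: "(mom (Suc j))\<^sup>2 * ?A ^ (2 * \<alpha> j - 1) = mom j * omega \<alpha> x0 \<phi> j"
    using A by (simp only: mult_cancel_right) simp
  have o: "osc j s = ?A * ?S" using False by (simp add: osc_def)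
  have "real (\<alpha> j) * (mom (Suc j))\<^sup>2 * osc j s ^ (2 * \<alpha> j - 1) = real (\<alpha> j) * ((mom (Suc j))\<^sup>2 * ?A ^ (2 * \<alpha> j - 1)) * ?S ^ (2 * \<alpha> j - 1)"
    unfolding o power_mult_distrib by (simp only: mult.assoc)
  then have e2: "real (\<alpha> j) * (mom (Suc j))\<^sup>2 * osc j s ^ (2 * \<alpha> j - 1) = real (\<alpha> j) * (mom j * omega \<alpha> x0 \<phi> j) * ?S ^ (2 * \<alpha> j - 1)"
    unfolding e .
  show ?thesis unfolding e2 by (intro DERIV_cong[OF d]) (simp add: algebra_simps)
qed

lemma osc_0: "1 \<le> j \<Longrightarrow> j \<le> n \<Longrightarrow> osc j 0 = x0 j" "1 \<le> j \<Longrightarrow> j \<le> n \<Longrightarrow> osc' j 0 = p0_sph n \<alpha> x0 \<phi> j"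
  using sin_nz'[of j] by (simp_all add: osc_def osc'_def p0_eq alpha_t_def)

lemma osc_energy:
  assumes "1 \<le> j" "j \<le> n"
  shows "(osc' j s)\<^sup>2 + (mom (Suc j))\<^sup>2 * osc j s ^ (2 * \<alpha> j) = (mom j)\<^sup>2"
proof (cases "\<alpha> j = 0")
  case True
  then show ?thesis using initial_energy[OF assms] by (simp add: osc_def osc'_def)
next
  case False
  let ?t = "\<phi> j + omega \<alpha> x0 \<phi> j * s"
  have "(osc' j s)\<^sup>2 + (mom (Suc j))\<^sup>2 * osc j s ^ (2 * \<alpha> j)
     = (mom j)\<^sup>2 * (gcos (real (\<alpha> j)) ?t)\<^sup>2 + ((mom (Suc j))\<^sup>2 * (x0 j / gsin (real (\<alpha> j)) (\<phi> j)) ^ (2 * \<alpha> j)) * gsin (real (\<alpha> j)) ?t ^ (2 * \<alpha> j)"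
    using False by (simp only: osc_def osc'_def power_mult_distrib if_False mult.assoc)
  also have "\<dots> = (mom j)\<^sup>2 * ((gcos (real (\<alpha> j)) ?t)\<^sup>2 + gsin (real (\<alpha> j)) ?t ^ (2 * \<alpha> j))"
    unfolding amp_power[OF assms False] by (simp only: distrib_left)
  also have "\<dots> = (mom j)\<^sup>2" using gsin_gcos_pythagoras[of "\<alpha> j" ?t] False by simp
  finally show ?thesis .
qed

lemma osc_antiperiodic:
  assumes "\<alpha> j \<noteq> 0" "\<bar>omega \<alpha> x0 \<phi> j\<bar> * S = gpi (real (\<alpha> j))"
  shows "osc j (s + S) = - osc j s" "osc' j (s + S) = - osc' j s"
proof -
  let ?p = "gpi (real (\<alpha> j))" and ?t = "\<phi> j + omega \<alpha> x0 \<phi> j * s"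
  have a: "\<alpha> j \<ge> 1" using assms(1) by simp
  \<comment> \<open>\<open>omega\<close> may be negative; then the phase moves by
    \<open>- ?p\<close>.\<close>
  have *: "\<phi> j + omega \<alpha> x0 \<phi> j * (s + S) = ?t + ?p \<or> \<phi> j + omega \<alpha> x0 \<phi> j * (s + S) = ?t - ?p"
    using assms(2) by (cases "omega \<alpha> x0 \<phi> j \<ge> 0") (auto simp: algebra_simps)
  have "gsin (real (\<alpha> j)) (?t - ?p) = - gsin (real (\<alpha> j)) ?t" "gcos (real (\<alpha> j)) (?t - ?p) = - gcos (real (\<alpha> j)) ?t"
    using gsin_antiperiodic[OF a, of "?t - ?p"] gcos_antiperiodic[OF a, of "?t - ?p"] by simp_all
  with * gsin_antiperiodic[OF a, of ?t] gcos_antiperiodic[OF a, of ?t]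
  have "gsin (real (\<alpha> j)) (\<phi> j + omega \<alpha> x0 \<phi> j * (s + S)) = - gsin (real (\<alpha> j)) ?t"
    "gcos (real (\<alpha> j)) (\<phi> j + omega \<alpha> x0 \<phi> j * (s + S)) = - gcos (real (\<alpha> j)) ?t" by metis+
  then show "osc j (s + S) = - osc j s" "osc' j (s + S) = - osc' j s"
    using assms(1) by (simp_all add: osc_def osc'_def)
qed

lemma x_eq_osc:
  assumes "1 \<le> j" "j \<le> n" "0 \<le> t"
  shows "x t j = osc j (clock j t)" "p t j = osc' j (clock j t)"
proof -
  have j: "j \<le> n + 1" "j \<le> n + 2" using assms by auto
  have "x t j = osc j (clock j t) \<and> p t j = osc' j (clock j t)"
  proof (rule weighted_ode_unique[OF assms(3), where \<sigma> = "clock j" and w = "\<lambda>t. (xi \<alpha> j (x t))\<^sup>2"])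
    fix s assume s: "s \<in> {0..t}"
    show "((\<lambda>s. x s j) has_real_derivative (xi \<alpha> j (x s))\<^sup>2 * p s j) (at s within {0..t})"
      by (rule x_deriv[OF assms(1) j(1) s])
    show "((\<lambda>s. p s j) has_real_derivative (xi \<alpha> j (x s))\<^sup>2 * (- (real (\<alpha> j) * (mom (Suc j))\<^sup>2) * x s j ^ (2 * \<alpha> j - 1))) (at s within {0..t})"
      by (rule p_deriv[OF assms(1,2) s])
    show c: "(clock j has_real_derivative (xi \<alpha> j (x s))\<^sup>2) (at s within {0..t})"
      by (rule clock_deriv[OF j(2) s])
    show "((\<lambda>s. osc j (clock j s)) has_real_derivative (xi \<alpha> j (x s))\<^sup>2 * osc' j (clock j s)) (at s within {0..t})"
      by (rule DERIV_cong[OF DERIV_chain2[OF osc_deriv[OF assms(1,2)] c]]) simp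
    show "((\<lambda>s. osc' j (clock j s)) has_real_derivative (xi \<alpha> j (x s))\<^sup>2 * (- (real (\<alpha> j) * (mom (Suc j))\<^sup>2) * osc j (clock j s) ^ (2 * \<alpha> j - 1))) (at s within {0..t})"
      by (rule DERIV_cong[OF DERIV_chain2[OF osc'_deriv[OF assms(1,2)] c]]) simp
  qed (use initial[OF assms(1) j(1)] osc_0[OF assms(1,2)] in simp_all)
  then show "x t j = osc j (clock j t)" "p t j = osc' j (clock j t)" by auto
qed

text \<open>An explicit antiderivative of \<open>osc j s ^ (2 * \<alpha> j)\<close>, from
  \<open>(osc * osc')' = osc'\<^sup>2 - \<alpha> * mom\<^sup>2 * osc ^ (2 * \<alpha>)\<close> and energy conservation.\<close>
definition osc_int :: "nat \<Rightarrow> real \<Rightarrow> real" where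
  "osc_int j s = ((mom j)\<^sup>2 * s - osc j s * osc' j s + osc j 0 * osc' j 0) / ((real (\<alpha> j) + 1) * (mom (Suc j))\<^sup>2)"

lemma osc_int_0 [simp]: "osc_int j 0 = 0"
  by (simp add: osc_int_def)

lemma osc_int_deriv:
  assumes "1 \<le> j" "j \<le> n"
  shows "(osc_int j has_real_derivative osc j s ^ (2 * \<alpha> j)) (at s)"
proof -
  let ?c = "(mom (Suc j))\<^sup>2"
  have c: "?c \<noteq> 0" using mom_nz[of "Suc j"] assms by simp
  have "((\<lambda>s. ((mom j)\<^sup>2 * s - osc j s * osc' j s + osc j 0 * osc' j 0) / ((real (\<alpha> j) + 1) * ?c)) has_real_derivative
    ((mom j)\<^sup>2 * 1 - (osc' j s * osc' j s + - (real (\<alpha> j) * ?c * osc j s ^ (2 * \<alpha> j - 1)) * osc j s) + 0) / ((real (\<alpha> j) + 1) * ?c)) (at s)"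
    by (intro DERIV_cdivide DERIV_add DERIV_diff DERIV_cmult DERIV_ident DERIV_const DERIV_mult osc_deriv osc'_deriv assms)
  moreover have "((mom j)\<^sup>2 * 1 - (osc' j s * osc' j s + - (real (\<alpha> j) * ?c * osc j s ^ (2 * \<alpha> j - 1)) * osc j s) + 0) = (real (\<alpha> j) + 1) * ?c * osc j s ^ (2 * \<alpha> j)"
  proof -
    have "real (\<alpha> j) * (osc j s ^ (2 * \<alpha> j - 1) * osc j s) = real (\<alpha> j) * osc j s ^ (2 * \<alpha> j)"
      by (cases "\<alpha> j") auto
    moreover have "(mom j)\<^sup>2 = osc' j s * osc' j s + ?c * osc j s ^ (2 * \<alpha> j)"
      using osc_energy[OF assms, of s] by (simp add: power2_eq_square)
    moreover have "(mom j)\<^sup>2 * 1 - (osc' j s * osc' j s + - (real (\<alpha> j) * ?c * osc j s ^ (2 * \<alpha> j - 1)) * osc j s) + 0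
       = (mom j)\<^sup>2 - osc' j s * osc' j s + ?c * (real (\<alpha> j) * (osc j s ^ (2 * \<alpha> j - 1) * osc j s))"
      by (simp add: algebra_simps)
    ultimately show ?thesis by (simp only:) (simp add: algebra_simps)
  qed
  moreover have "(real (\<alpha> j) + 1) * ?c * osc j s ^ (2 * \<alpha> j) / ((real (\<alpha> j) + 1) * ?c) = osc j s ^ (2 * \<alpha> j)"
    using c by simp
  ultimately show ?thesis unfolding osc_int_def[abs_def] by simp
qed

text \<open>Clock \<open>j + 1\<close> runs at the rate \<open>x_j ^ (2 * \<alpha>_j)\<close>
  relative to clock \<open>j\<close>. This links neighbouring levels in the length estimate and
  fixes the end of the time change in the shorter curve.\<close>

lemma clock_Suc:
  assumes "1 \<le> j" "j \<le> n" "0 \<le> t"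
  shows "clock (Suc j) t = osc_int j (clock j t)"
proof -
  have d: "((\<lambda>s. clock (Suc j) s - osc_int j (clock j s)) has_real_derivative 0) (at s within {0..t})" if s: "s \<in> {0..t}" for s
  proof -
    have a: "(clock (Suc j) has_real_derivative (xi \<alpha> (Suc j) (x s))\<^sup>2) (at s within {0..t})"
      by (rule clock_deriv) (use assms s in auto)
    have b: "((\<lambda>s. osc_int j (clock j s)) has_real_derivative osc j (clock j s) ^ (2 * \<alpha> j) * (xi \<alpha> j (x s))\<^sup>2) (at s within {0..t})"
      by (rule DERIV_chain2[OF osc_int_deriv[OF assms(1,2)] clock_deriv]) (use assms s in auto)
    have "(xi \<alpha> (Suc j) (x s))\<^sup>2 = osc j (clock j s) ^ (2 * \<alpha> j) * (xi \<alpha> j (x s))\<^sup>2"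
      using x_eq_osc(1)[OF assms(1,2), of s] s assms(1)
      by (simp add: xi_Suc power_mult_distrib power_mult[symmetric] mult.commute)
    then show ?thesis by (intro DERIV_cong[OF DERIV_diff[OF a b]]) simp
  qed
  have "\<exists>c. \<forall>s\<in>{0..t}. clock (Suc j) s - osc_int j (clock j s) = c"
    by (rule has_field_derivative_zero_constant[OF _ d]) simp_all
  then obtain c where c: "\<And>s. s \<in> {0..t} \<Longrightarrow> clock (Suc j) s - osc_int j (clock j s) = c" by blast
  have "clock (Suc j) t - osc_int j (clock j t) = clock (Suc j) 0 - osc_int j (clock j 0)"
    using c[of 0] c[of t] assms(3) by simp
  then show ?thesis by simp
qed

section \<open>The geodesic as a unit-speed admissible curve\<close>

definition ctrl :: "nat \<Rightarrow> real \<Rightarrow> real" where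
  "ctrl k t = xi \<alpha> k (x t) * p t k"

lemma ctrl_sum:
  assumes "1 \<le> j" "j \<le> n + 1" "0 \<le> t"
  shows "(\<Sum>k\<in>{j..n+1}. (ctrl k t)\<^sup>2) = (xi \<alpha> j (x t))\<^sup>2 * (mom j)\<^sup>2"
proof -
  have "(\<Sum>k\<in>{j..n+1}. (ctrl k t)\<^sup>2) = (\<Sum>k\<in>{j..n+1}. (xi \<alpha> j (x t))\<^sup>2 * ((eta \<alpha> j k (x t))\<^sup>2 * (p t k)\<^sup>2))"
  proof (rule sum.cong)
    fix k assume "k \<in> {j..n+1}"
    then have e: "xi \<alpha> k (x t) = xi \<alpha> j (x t) * eta \<alpha> j k (x t)" by (intro xi_mult assms(1)) simp
    show "(ctrl k t)\<^sup>2 = (xi \<alpha> j (x t))\<^sup>2 * ((eta \<alpha> j k (x t))\<^sup>2 * (p t k)\<^sup>2)"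
      unfolding ctrl_def e by (simp add: power_mult_distrib)
  qed simp
  also have "\<dots> = (xi \<alpha> j (x t))\<^sup>2 * tail_energy n \<alpha> j (x t) (p t)"
    unfolding tail_energy_def sum_distrib_left ..
  finally show ?thesis using energy_conserved[OF assms(1,2)] assms(3) by simp
qed

lemma ctrl_unit: "0 \<le> t \<Longrightarrow> (\<Sum>k\<in>{1..n+1}. (ctrl k t)\<^sup>2) = 1"
  using ctrl_sum[of 1 t] by simp

lemma horizontal_ctrl:
  assumes "0 \<le> T"
  shows "horizontal n \<alpha> T x ctrl"
  unfolding horizontal_def
proof (intro conjI ballI assms)
  fix j assume j: "j \<in> {1..n+1}"
  show "ctrl j absolutely_integrable_on {0..T}"
    unfolding ctrl_def[abs_def] using j
    by (intro absolutely_integrable_continuous_real continuous_intros continuous_xi continuous_p) auto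
  fix t assume t: "t \<in> {0..T}"
  show "((\<lambda>s. ctrl j s * xi \<alpha> j (x s)) has_integral x t j - x 0 j) {0..t}"
  proof (rule fundamental_theorem_of_calculus)
    fix s assume s: "s \<in> {0..t}"
    have "((\<lambda>s. x s j) has_real_derivative ctrl j s * xi \<alpha> j (x s)) (at s within {0..t})"
      by (rule DERIV_cong[OF x_deriv]) (use j s in \<open>auto simp: ctrl_def power2_eq_square\<close>)
    then show "((\<lambda>s. x s j) has_vector_derivative ctrl j s * xi \<alpha> j (x s)) (at s within {0..t})"
      by (simp add: has_real_derivative_iff_has_vector_derivative)
  qed (use t in simp)
qed

lemma ctrl_length_ctrl:
  assumes "0 \<le> T"
  shows "ctrl_length n T ctrl = T"
proof -
  have "ctrl_length n T ctrl = integral {0..T} (\<lambda>t. 1)"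
    unfolding ctrl_length_def by (rule integral_cong) (use ctrl_unit in simp)
  then show ?thesis using assms by simp
qed

section \<open>Short arcs are minimizing\<close>

text \<open>The weight \<open>xi j\<close> depends only on the coordinates before \<open>j\<close>,
  so bounds propagate from one coordinate to the next. A bound uniform in the competitor is needed
  because the calibration and its time \<open>\<theta>0\<close> depend on it.\<close>

lemma competitors_bounded:
  assumes "m \<le> n"
  shows "\<exists>B\<ge>0. \<forall>T \<gamma> u. horizontal n \<alpha> T \<gamma> u \<longrightarrow> (\<forall>j\<in>{1..n+1}. \<gamma> 0 j = x0 j) \<longrightarrow> ctrl_length n T u \<le> 1
    \<longrightarrow> (\<forall>t\<in>{0..T}. \<forall>j\<in>{1..m}. \<bar>\<gamma> t j\<bar> \<le> B)"
  using assms
proof (induction m)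
  case 0
  show ?case by (intro exI[of _ 0]) auto
next
  case (Suc m)
  then obtain B where B: "B \<ge> 0" "\<And>T \<gamma> u t j. horizontal n \<alpha> T \<gamma> u \<Longrightarrow> (\<forall>j\<in>{1..n+1}. \<gamma> 0 j = x0 j) \<Longrightarrow> ctrl_length n T u \<le> 1
    \<Longrightarrow> t \<in> {0..T} \<Longrightarrow> j \<in> {1..m} \<Longrightarrow> \<bar>\<gamma> t j\<bar> \<le> B" by (meson Suc_leD)
  define C where "C = (\<Prod>i\<in>{1..<Suc m}. B ^ \<alpha> i)"
  have C0: "0 \<le> C" unfolding C_def using B(1) by (intro prod_nonneg) auto
  show ?case
  proof (intro exI[of _ "max B (\<bar>x0 (Suc m)\<bar> + C)"] conjI allI impI ballI)
    show "0 \<le> max B (\<bar>x0 (Suc m)\<bar> + C)" using B(1) by simp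
    fix T \<gamma> u t j
    assume h: "horizontal n \<alpha> T \<gamma> u" and i: "\<forall>j\<in>{1..n+1}. \<gamma> 0 j = x0 j" and l: "ctrl_length n T u \<le> 1"
      and t: "t \<in> {0..T}" and j: "j \<in> {1..Suc m}"
    show "\<bar>\<gamma> t j\<bar> \<le> max B (\<bar>x0 (Suc m)\<bar> + C)"
    proof (cases "j = Suc m")
      case False
      then have "j \<in> {1..m}" using j by auto
      from B(2)[OF h i l t this] show ?thesis by simp
    next
      case True
      have jn: "j \<in> {1..n+1}" using True Suc.prems by auto
      have "\<bar>xi \<alpha> j (\<gamma> s)\<bar> \<le> C" if "s \<in> {0..T}" for s
        unfolding xi_def C_def abs_prod power_abs True
        by (rule prod_mono) (use B(2)[OF h i l that] in \<open>auto intro: power_mono\<close>)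
      from horizontal_displacement[OF h jn t this C0] have "\<bar>\<gamma> t j - \<gamma> 0 j\<bar> \<le> C * ctrl_length n T u" .
      also have "\<dots> \<le> C" using l C0 by (rule mult_left_le)
      finally show ?thesis using i jn True by fastforce
    qed
  qed
qed

text \<open>One level of the descent for an arc of clock length \<open>S\<close>: the estimate at
  level \<open>j + 1\<close> is a premise. The admissible clock time \<open>\<theta>\<close> depends
  on the bound \<open>B\<close> but not on the competitor.\<close>

definition level_bound :: "nat \<Rightarrow> real \<Rightarrow> real \<Rightarrow> bool" where
  "level_bound j B \<theta> \<longleftrightarrow> (\<forall>S T \<gamma> u. 0 \<le> S \<longrightarrow> S \<le> \<theta> \<longrightarrow> horizontal n \<alpha> T \<gamma> u \<longrightarrow> (\<forall>t\<in>{0..T}. \<bar>\<gamma> t j\<bar> \<le> B) \<longrightarrow> \<gamma> 0 j = x0 j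
     \<longrightarrow> \<gamma> T j = osc j S \<longrightarrow> \<bar>mom (Suc j)\<bar> * osc_int j S \<le> integral {0..T} (level_speed n \<alpha> \<gamma> u (Suc j))
     \<longrightarrow> \<bar>mom j\<bar> * S \<le> integral {0..T} (level_speed n \<alpha> \<gamma> u j))"

lemma level_step:
  assumes j: "1 \<le> j" "j \<le> n" and B: "B \<ge> 0"
  shows "\<exists>\<theta>>0. level_bound j B \<theta>"
proof -
  have "continuous_on {0..1} (osc j)"
    by (rule DERIV_continuous_on[OF has_field_derivative_at_within[OF osc_deriv[OF j]]])
  then have "bounded (osc j ` {0..1})"
    by (intro compact_imp_bounded compact_continuous_image) auto
  then obtain B1 where B1: "\<And>s. s \<in> {0..1} \<Longrightarrow> \<bar>osc j s\<bar> \<le> B1" unfolding bounded_iff by fastforce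
  \<comment> \<open>\<open>calibration_step\<close> takes a single bound for the competitor and for
    the oscillator on [0, 1].\<close>
  define B' where "B' = max B B1"
  have B': "B' \<ge> 0" "\<And>s. 0 \<le> s \<Longrightarrow> s \<le> 1 \<Longrightarrow> \<bar>osc j s\<bar> \<le> B'"
    using B B1 by (auto simp: B'_def le_max_iff_disj)
  have D: "\<bar>mom j\<bar> > 0" using mom_nz[of j] j by simp
  have d1: "\<And>s. (osc' j has_real_derivative - (real (\<alpha> j) * \<bar>mom (Suc j)\<bar>\<^sup>2 * osc j s ^ (2 * \<alpha> j - 1))) (at s)"
    using osc'_deriv[OF j] by simp
  have en: "\<And>s. (osc' j s)\<^sup>2 + \<bar>mom (Suc j)\<bar>\<^sup>2 * osc j s ^ (2 * \<alpha> j) = \<bar>mom j\<bar>\<^sup>2"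
    using osc_energy[OF j] by simp
  show ?thesis
  proof (rule calibration_step[OF D B'(1) osc_deriv[OF j] d1 osc_int_deriv[OF j] en osc_int_0 B'(2)], goal_cases)
    case (3 \<theta>)
    show ?case
      unfolding level_bound_def
    proof (intro exI[of _ \<theta>] conjI allI impI 3(1))
      fix S T \<gamma> u
      assume S: "0 \<le> S" "S \<le> \<theta>" and h: "horizontal n \<alpha> T \<gamma> u" and b: "\<forall>t\<in>{0..T}. \<bar>\<gamma> t j\<bar> \<le> B"
        and i: "\<gamma> 0 j = x0 j" and e: "\<gamma> T j = osc j S"
        and l: "\<bar>mom (Suc j)\<bar> * osc_int j S \<le> integral {0..T} (level_speed n \<alpha> \<gamma> u (Suc j))"
      \<comment> \<open>The warped product: the speed at level \<open>j\<close> is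
        \<open>sqrt (v\<^sup>2 + z\<^sup>2)\<close>, and the speed at level \<open>j + 1\<close> is
        \<open>z\<close> times the factor
        \<open>\<bar>\<gamma> t j\<bar> ^ \<alpha> j\<close>.\<close>
      let ?z = "\<lambda>t. \<bar>xi \<alpha> j (\<gamma> t)\<bar> * sqrt (\<Sum>k\<in>{Suc j..n+1}. (u k t)\<^sup>2)"
      let ?v = "\<lambda>t. u j t * xi \<alpha> j (\<gamma> t)"
      have e1: "level_speed n \<alpha> \<gamma> u j = (\<lambda>t. sqrt ((?v t)\<^sup>2 + (?z t)\<^sup>2))"
      proof
        fix t
        have "(\<Sum>k\<in>{j..n+1}. (u k t)\<^sup>2) = (u j t)\<^sup>2 + (\<Sum>k\<in>{Suc j..n+1}. (u k t)\<^sup>2)"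
          by (rule sum.atLeast_Suc_atMost) (use j in simp)
        moreover have "(\<Sum>k\<in>{Suc j..n+1}. (u k t)\<^sup>2) \<ge> 0" by (rule sum_nonneg) simp
        ultimately have "(level_speed n \<alpha> \<gamma> u j t)\<^sup>2 = (?v t)\<^sup>2 + (?z t)\<^sup>2"
          unfolding level_speed_def power_mult_distrib by (simp only: real_sqrt_pow2 add_nonneg_nonneg zero_le_power2 power2_abs distrib_left mult.commute)
        moreover have "level_speed n \<alpha> \<gamma> u j t \<ge> 0"
          unfolding level_speed_def by (intro mult_nonneg_nonneg real_sqrt_ge_zero sum_nonneg) auto
        ultimately show "level_speed n \<alpha> \<gamma> u j t = sqrt ((?v t)\<^sup>2 + (?z t)\<^sup>2)"
          by (simp only: real_sqrt_unique[symmetric])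
      qed
      have e2: "level_speed n \<alpha> \<gamma> u (Suc j) = (\<lambda>t. \<bar>\<gamma> t j\<bar> ^ \<alpha> j * ?z t)"
        unfolding level_speed_def[abs_def] xi_Suc[OF j(1)] abs_mult power_abs by (simp only: mult.assoc mult.left_commute mult.commute)
      have jn: "j \<in> {1..n+1}" using j by auto
      show "\<bar>mom j\<bar> * S \<le> integral {0..T} (level_speed n \<alpha> \<gamma> u j)"
        unfolding e1
      proof (rule 3(2)[where y = "\<lambda>t. \<gamma> t j", OF S horizontalD(1)[OF h]])
        show "(\<lambda>t. sqrt ((?v t)\<^sup>2 + (?z t)\<^sup>2)) integrable_on {0..T}"
          unfolding e1[symmetric] by (rule level_speed_integrable[OF h]) (use j in auto)
        show "(\<lambda>t. \<bar>\<gamma> t j\<bar> ^ \<alpha> j * ?z t) integrable_on {0..T}"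
          unfolding e2[symmetric] by (rule level_speed_integrable[OF h]) (use j in auto)
        show "(?v has_integral \<gamma> t j - \<gamma> 0 j) {0..t}" if "t \<in> {0..T}" for t
          by (rule horizontalD(3)[OF h jn that])
        show "\<bar>\<gamma> t j\<bar> \<le> B'" if "t \<in> {0..T}" for t using b that by (force simp: B'_def)
        show "\<gamma> 0 j = osc j 0" using i osc_0[OF j] by simp
        show "\<gamma> T j = osc j S" by (rule e)
        show "\<bar>mom (Suc j)\<bar> * osc_int j S \<le> integral {0..T} (\<lambda>t. \<bar>\<gamma> t j\<bar> ^ \<alpha> j * ?z t)"
          using l unfolding e2 .
      qed simp
    qed
  qed simp_all
qed

lemma clock_nonneg:
  assumes "j \<le> n + 2" "0 \<le> t"
  shows "0 \<le> clock j t"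
  unfolding clock_def
  by (rule integral_nonneg) (use assms in \<open>auto intro!: integrable_continuous_real continuous_intros continuous_xi\<close>)

lemma short_time_minimizing: "\<exists>T>0. minimizing_on n \<alpha> x T"
proof -
  obtain B where B: "B \<ge> 0" "\<And>T \<gamma> u t j. horizontal n \<alpha> T \<gamma> u \<Longrightarrow> (\<forall>j\<in>{1..n+1}. \<gamma> 0 j = x0 j) \<Longrightarrow> ctrl_length n T u \<le> 1
    \<Longrightarrow> t \<in> {0..T} \<Longrightarrow> j \<in> {1..n} \<Longrightarrow> \<bar>\<gamma> t j\<bar> \<le> B"
    using competitors_bounded[OF order_refl] by meson
  have "\<forall>j\<in>{1..n}. \<exists>\<theta>>0. level_bound j B \<theta>"
    using level_step B(1) by simp
  then obtain \<theta> where \<theta>: "\<And>j. j \<in> {1..n} \<Longrightarrow> \<theta> j > 0"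
    "\<And>j. j \<in> {1..n} \<Longrightarrow> level_bound j B (\<theta> j)"
    by (drule_tac bchoice) blast
  have "eventually (\<lambda>t. clock j t < \<theta> j) (at 0 within {0..1})" if j: "j \<in> {1..n}" for j
  proof -
    have "continuous_on {0..1} (clock j)"
      by (rule DERIV_continuous_on[OF clock_deriv]) (use j in auto)
    then have "(clock j \<longlongrightarrow> clock j 0) (at 0 within {0..1})" unfolding continuous_on_def by (rule bspec) simp
    then show ?thesis using \<theta>(1)[OF j] by (intro order_tendstoD(2)) auto
  qed
  then have "eventually (\<lambda>t. \<forall>j\<in>{1..n}. clock j t < \<theta> j) (at 0 within {0..1})"
    by (intro eventually_ball_finite) auto
  then obtain d where d: "d > 0" "\<And>t. t \<in> {0..1} \<Longrightarrow> t \<noteq> 0 \<Longrightarrow> dist t 0 < d \<Longrightarrow> \<forall>j\<in>{1..n}. clock j t < \<theta> j"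
    unfolding eventually_at by blast
  \<comment> \<open>With \<open>T \<le> 1\<close>, a competitor shorter than \<open>T\<close> falls
    under the uniform bound \<open>B\<close>; \<open>d\<close> keeps all clocks within the
    calibrated times.\<close>
  define T where "T = min 1 (d / 2)"
  have T: "T > 0" "T \<le> 1" and small: "\<And>j. j \<in> {1..n} \<Longrightarrow> clock j T \<le> \<theta> j"
    using d(1) d(2)[of T] by (auto simp: T_def min_def less_imp_le)
  have min: "T \<le> ctrl_length n T' u"
    if h: "horizontal n \<alpha> T' \<gamma> u" and ends: "\<And>j. j \<in> {1..n+1} \<Longrightarrow> \<gamma> 0 j = x 0 j \<and> \<gamma> T' j = x T j" for T' \<gamma> u
  proof (rule ccontr)
    assume "\<not> T \<le> ctrl_length n T' u"
    then have l1: "ctrl_length n T' u \<le> 1" using T by simp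
    have i: "\<forall>j\<in>{1..n+1}. \<gamma> 0 j = x0 j" using ends initial(1) by simp
    \<comment> \<open>The left-hand side is the length of the geodesic itself at level
      \<open>j\<close>.\<close>
    have "\<bar>mom j\<bar> * clock j T \<le> integral {0..T'} (level_speed n \<alpha> \<gamma> u j)" if "1 \<le> j" "j \<le> n + 1" for j
      using that(2,1)
    proof (induction j rule: inc_induct)
      \<comment> \<open>At the last level the momentum is constant, so the geodesic's length is its
        displacement, which bounds the length of any competitor with the same ends.\<close>
      case base
      have n1': "n + 1 \<in> {1..n+1}" "1 \<le> n + 1" by auto
      have T': "T' \<in> {0..T'}" using horizontalD(1)[OF h] by simp
      let ?f = "\<lambda>s. u (n+1) s * xi \<alpha> (n+1) (\<gamma> s)"
      have f: "(?f has_integral (\<gamma> T' (n+1) - \<gamma> 0 (n+1))) {0..T'}" by (rule horizontalD(3)[OF h n1'(1) T'])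
      have "norm (integral {0..T'} ?f) \<le> integral {0..T'} (level_speed n \<alpha> \<gamma> u (n+1))"
        by (rule integral_norm_bound_integral)
           (use f level_speed_integrable[OF h, of "n+1"] in \<open>auto simp: level_speed_def abs_mult mult.commute\<close>)
      moreover have "integral {0..T'} ?f = x T (n+1) - x 0 (n+1)"
        using integral_unique[OF f] ends[OF n1'(1)] by simp
      moreover have "x T (n+1) - x 0 (n+1) = mom (n+1) * clock (n+1) T"
      proof -
        have "((\<lambda>t. (xi \<alpha> (n+1) (x t))\<^sup>2 * mom (n+1)) has_integral x T (n+1) - x 0 (n+1)) {0..T}"
        proof (rule fundamental_theorem_of_calculus)
          fix t assume t: "t \<in> {0..T}"
          have "((\<lambda>s. x s (n+1)) has_real_derivative (xi \<alpha> (n+1) (x t))\<^sup>2 * mom (n+1)) (at t within {0..T})"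
            using x_deriv[OF n1'(2) order_refl t] p_last[of t] t by simp
          then show "((\<lambda>s. x s (n+1)) has_vector_derivative (xi \<alpha> (n+1) (x t))\<^sup>2 * mom (n+1)) (at t within {0..T})"
            by (simp add: has_real_derivative_iff_has_vector_derivative)
        qed (use T in simp)
        from integral_unique[OF this] show ?thesis by (simp add: clock_def mult.commute)
      qed
      moreover have "0 \<le> clock (n+1) T" by (rule clock_nonneg) (use T in auto)
      ultimately show ?case by (simp add: abs_mult)
    next
      case (step j)
      then have j: "1 \<le> j" "j \<le> n" "j \<in> {1..n}" "j \<in> {1..n+1}" "j \<le> n + 2" by auto
      show ?case
      proof (rule \<theta>(2)[OF j(3), unfolded level_bound_def, rule_format, OF clock_nonneg[OF j(5)] small[OF j(3)] h])
        show "\<bar>\<gamma> t j\<bar> \<le> B" if "t \<in> {0..T'}" for t by (rule B(2)[OF h i l1 that j(3)])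
        show "\<gamma> 0 j = x0 j" using i j(4) by blast
        show "\<gamma> T' j = osc j (clock j T)" using ends[OF j(4)] x_eq_osc(1)[OF j(1,2), of T] T by simp
        show "\<bar>mom (Suc j)\<bar> * osc_int j (clock j T) \<le> integral {0..T'} (level_speed n \<alpha> \<gamma> u (Suc j))"
          using step.IH clock_Suc[OF j(1,2), of T] T by simp
      qed (use T in simp)
    qed
    \<comment> \<open>At level 1 both \<open>mom\<close> and \<open>xi\<close> are 1: the clock is
      time and the level speed is the full speed.\<close>
    from this[of 1] have "T \<le> ctrl_length n T' u"
      unfolding ctrl_length_eq_level_speed[of _ _ _ \<alpha> \<gamma>] using clock_1[of T] T by simp
    then show False using \<open>\<not> T \<le> ctrl_length n T' u\<close> by simp
  qed
  have "cc_dist n \<alpha> (x 0) (x T) = T"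
    unfolding cc_dist_def
  proof (rule cInf_eq_minimum)
    show "T \<in> {L. \<exists>T' \<gamma> u. horizontal n \<alpha> T' \<gamma> u \<and> (\<forall>j\<in>{1..n+1}. \<gamma> 0 j = x 0 j \<and> \<gamma> T' j = x T j) \<and> L = ctrl_length n T' u}"
      using horizontal_ctrl[of T] ctrl_length_ctrl[of T] T
      by (intro CollectI exI[of _ T] exI[of _ x] exI[of _ ctrl]) auto
  next
    fix L assume "L \<in> {L. \<exists>T' \<gamma> u. horizontal n \<alpha> T' \<gamma> u \<and> (\<forall>j\<in>{1..n+1}. \<gamma> 0 j = x 0 j \<and> \<gamma> T' j = x T j) \<and> L = ctrl_length n T' u}"
    then obtain T' \<gamma> u where "horizontal n \<alpha> T' \<gamma> u" "\<forall>j\<in>{1..n+1}. \<gamma> 0 j = x 0 j \<and> \<gamma> T' j = x T j" "L = ctrl_length n T' u" by blast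
    then show "T \<le> L" using min by blast
  qed
  then have "minimizing_on n \<alpha> x T"
    unfolding minimizing_on_def using horizontal_ctrl[of T] ctrl_length_ctrl[of T] T by (intro exI[of _ ctrl]) simp
  with T show ?thesis by blast
qed

lemma cut_time_nonneg: "0 \<le> cut_time n \<alpha> x"
proof -
  obtain T where T: "T > 0" "minimizing_on n \<alpha> x T" using short_time_minimizing by blast
  then have "ereal T \<le> cut_time n \<alpha> x"
    unfolding cut_time_def by (intro Sup_upper imageI) simp
  moreover have "0 \<le> ereal T" using T by simp
  ultimately show ?thesis by (rule order_trans[rotated])
qed

section \<open>The geodesic is not minimizing after a half period\<close>

text \<open>\<open>minimizing_on\<close> admits every control of the geodesic, not only
  \<open>ctrl\<close>. Two controls of the same curve differ by something whose product with
  \<open>xi\<close> has vanishing integrals. Paired with the momentum, the difference becomes 1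
  minus the scalar product of \<open>ctrl\<close> and \<open>u\<close>, which is at least 1 minus
  the norm of \<open>u\<close>.\<close>

lemma horizontal_length_ge:
  assumes h: "horizontal n \<alpha> T x u"
  shows "T \<le> ctrl_length n T u"
proof -
  have T: "0 \<le> T" by (rule horizontalD(1)[OF h])
  let ?w = "\<lambda>t. sqrt (\<Sum>k\<in>{1..n+1}. (u k t)\<^sup>2)"
  define h' where "h' k t = (ctrl k t - u k t) * xi \<alpha> k (x t)" for k t
  have hc: "horizontal n \<alpha> T x ctrl" by (rule horizontal_ctrl[OF T])
  have k: "(\<lambda>t. p t k * h' k t) integrable_on {0..T} \<and> integral {0..T} (\<lambda>t. p t k * h' k t) \<le> 0" if k: "k \<in> {1..n+1}" for k
  proof -
    have ai: "h' k absolutely_integrable_on {0..T}"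
    proof -
      have "(\<lambda>t. xi \<alpha> k (x t) * (ctrl k t - u k t)) absolutely_integrable_on {0..T}"
      proof (rule absolutely_integrable_bounded_measurable_product_real)
        have c: "continuous_on {0..T} (\<lambda>t. xi \<alpha> k (x t))" by (rule continuous_xi) (use k in auto)
        show "(\<lambda>t. xi \<alpha> k (x t)) \<in> borel_measurable (lebesgue_on {0..T})"
          by (rule continuous_imp_measurable_on_sets_lebesgue[OF c]) simp
        show "bounded ((\<lambda>t. xi \<alpha> k (x t)) ` {0..T})"
          by (intro compact_imp_bounded compact_continuous_image c) simp
        show "(\<lambda>t. ctrl k t - u k t) absolutely_integrable_on {0..T}"
          by (rule set_integral_diff(1)[OF horizontalD(2)[OF hc k] horizontalD(2)[OF h k]])
      qed simp
      then show ?thesis by (simp only: h'_def[abs_def] mult.commute)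
    qed
    have null: "(h' k has_integral 0) {0..t}" if "t \<in> {0..T}" for t
      using has_integral_diff[OF horizontalD(3)[OF hc k that] horizontalD(3)[OF h k that]]
      by (simp add: h'_def[abs_def] left_diff_distrib)
    have c: "continuous_on {0..T} (\<lambda>t. p t k)" by (rule continuous_p) (use k in auto)
    from integral_against_null_primitive[OF T ai null c] show ?thesis
      using set_lebesgue_integral_eq_integral(1) by blast
  qed
  have sum_int: "(\<lambda>t. \<Sum>k\<in>{1..n+1}. p t k * h' k t) integrable_on {0..T}"
    using k by (intro integrable_sum) auto
  have "integral {0..T} (\<lambda>t. \<Sum>k\<in>{1..n+1}. p t k * h' k t) = (\<Sum>k\<in>{1..n+1}. integral {0..T} (\<lambda>t. p t k * h' k t))"
    by (rule integral_sum) (use k in auto)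
  also have "\<dots> \<le> 0" by (rule sum_nonpos) (use k in auto)
  finally have le0: "integral {0..T} (\<lambda>t. \<Sum>k\<in>{1..n+1}. p t k * h' k t) \<le> 0" .
  have iw: "?w integrable_on {0..T}" by (rule ctrl_length_integrable[OF h])
  have "integral {0..T} (\<lambda>t. 1 - ?w t) \<le> integral {0..T} (\<lambda>t. \<Sum>k\<in>{1..n+1}. p t k * h' k t)"
  proof (rule integral_le[OF _ sum_int])
    show "(\<lambda>t. 1 - ?w t) integrable_on {0..T}" by (intro integrable_diff iw integrable_const_ivl)
    fix t assume t: "t \<in> {0..T}"
    have "(\<Sum>k\<in>{1..n+1}. p t k * h' k t) = (\<Sum>k\<in>{1..n+1}. (ctrl k t)\<^sup>2) - (\<Sum>k\<in>{1..n+1}. ctrl k t * u k t)"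
      unfolding sum_subtractf[symmetric]
      by (rule sum.cong) (simp_all add: h'_def ctrl_def power2_eq_square algebra_simps)
    also have "(\<Sum>k\<in>{1..n+1}. (ctrl k t)\<^sup>2) = 1" by (rule ctrl_unit) (use t in auto)
    finally have e: "(\<Sum>k\<in>{1..n+1}. p t k * h' k t) = 1 - (\<Sum>k\<in>{1..n+1}. ctrl k t * u k t)" .
    have "(\<Sum>k\<in>{1..n+1}. ctrl k t * u k t) \<le> (\<Sum>k\<in>{1..n+1}. \<bar>ctrl k t\<bar> * \<bar>u k t\<bar>)"
      by (rule sum_mono) (simp add: abs_mult[symmetric])
    also have "\<dots> \<le> L2_set (\<lambda>k. ctrl k t) {1..n+1} * L2_set (\<lambda>k. u k t) {1..n+1}"
      by (rule L2_set_mult_ineq)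
    also have "L2_set (\<lambda>k. ctrl k t) {1..n+1} = 1" unfolding L2_set_def using ctrl_unit[of t] t by simp
    finally show "1 - ?w t \<le> (\<Sum>k\<in>{1..n+1}. p t k * h' k t)" unfolding e by (simp only: L2_set_def mult_1)
  qed
  also have "integral {0..T} (\<lambda>t. 1 - ?w t) = T - ctrl_length n T u"
    using integral_diff[OF integrable_const_ivl iw, of 1] T by (simp add: ctrl_length_def)
  finally show ?thesis using le0 by linarith
qed

section \<open>Strict monotonicity of the clocks\<close>

lemma energy_level:
  assumes "1 \<le> k" "k \<le> n" "0 \<le> t"
  shows "(p t k)\<^sup>2 + (mom (Suc k))\<^sup>2 * x t k ^ (2 * \<alpha> k) = (mom k)\<^sup>2"
  using osc_energy[OF assms(1,2), of "clock k t"] x_eq_osc[OF assms] by simp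

text \<open>By induction \<open>xi k\<close> is nonzero on a subinterval. If
  \<open>xi (Suc k)\<close> vanished there, then so would \<open>x_k\<close> with positive exponent,
  hence its velocity and \<open>p_k\<close>, and the energy \<open>mom k\<close> squared would be
  zero.\<close>

lemma xi_nonzero_dense:
  assumes "1 \<le> k" "k \<le> n + 1" "0 \<le> a" "a < b"
  shows "\<exists>t. a < t \<and> t < b \<and> xi \<alpha> k (x t) \<noteq> 0"
  using assms(1,2,3,4)
proof (induction k arbitrary: a b rule: dec_induct)
  case base
  then show ?case using dense[of a b] by auto
next
  case (step k)
  then have k: "1 \<le> k" "k \<le> n" "k \<le> n + 1" "k \<le> n + 2" by auto
  obtain t where t: "a < t" "t < b" "xi \<alpha> k (x t) \<noteq> 0" using step.IH[of a b] step.prems k by auto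
  have "continuous_on {a<..<b} (\<lambda>t. xi \<alpha> k (x t))"
    by (rule continuous_on_subset[OF continuous_xi[OF k(4), of b]]) (use step.prems in auto)
  then obtain a' b' where ab: "a < a'" "a' < t" "t < b'" "b' < b" and nz: "\<And>s. a' < s \<Longrightarrow> s < b' \<Longrightarrow> xi \<alpha> k (x s) \<noteq> 0"
    using continuous_nonzero_interval[of a b "\<lambda>t. xi \<alpha> k (x t)" t] t by metis
  show ?case
  proof (rule ccontr)
    assume "\<not> ?case"
    then have z: "xi \<alpha> (Suc k) (x s) = 0" if "a' < s" "s < b'" for s using that ab by force
    have xz: "x s k = 0 \<and> \<alpha> k \<noteq> 0" if s: "a' < s" "s < b'" for s
    proof -
      have "xi \<alpha> k (x s) * x s k ^ \<alpha> k = 0" using z[OF s] unfolding xi_Suc[OF k(1)] .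
      then have "x s k ^ \<alpha> k = 0" using nz[OF s] by simp
      then show ?thesis by (cases "\<alpha> k") auto
    qed
    have t0: "t \<in> {0..b}" "0 < t" using t step.prems by auto
    have "((\<lambda>s. x s k) has_real_derivative (xi \<alpha> k (x t))\<^sup>2 * p t k) (at t)"
      using x_deriv[OF k(1,3) t0(1)] t0(2) t(2) by (simp add: at_within_Icc_at)
    from DERIV_const_on_interval[OF this ab(2,3), of 0] xz have "(xi \<alpha> k (x t))\<^sup>2 * p t k = 0" by blast
    then have "p t k = 0" using t(3) by simp
    moreover have "x t k = 0" "\<alpha> k \<noteq> 0" using xz ab by auto
    moreover from this(2) have "(0::real) ^ (2 * \<alpha> k) = 0" by (simp add: zero_power)
    ultimately have "(mom k)\<^sup>2 = 0" using energy_level[OF k(1,2), of t] t0(2) by (simp only: mult_zero_right add_0 zero_power2)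
    then show False using mom_nz[OF k(3)] by simp
  qed
qed

lemma clock_strict_mono:
  assumes "1 \<le> k" "k \<le> n + 1"
  shows "strict_mono_on {0..T} (clock k)"
proof (rule strict_mono_onI)
  fix a b assume ab: "a \<in> {0..T}" "b \<in> {0..T}" "a < b"
  have k2: "k \<le> n + 2" using assms by simp
  have D: "(clock k has_real_derivative (xi \<alpha> k (x t))\<^sup>2) (at t)" if "0 < t" for t
    using clock_deriv[OF k2, of t "t + 1"] that by (simp add: at_within_Icc_at)
  have c: "continuous_on {a'..b'} (clock k)" if "0 \<le> a'" for a' b'
    by (rule continuous_on_subset[OF DERIV_continuous_on[OF clock_deriv[OF k2]], of b']) (use that in auto)
  have mono: "clock k a' \<le> clock k b'" if "0 \<le> a'" "a' \<le> b'" for a' b'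
    by (rule DERIV_nonneg_imp_increasing_open[OF that(2) _ c[OF that(1)]])
       (use D that(1) in \<open>metis order_le_less_trans zero_le_power2\<close>)
  obtain t where t: "a < t" "t < b" "xi \<alpha> k (x t) \<noteq> 0" using xi_nonzero_dense[OF assms, of a b] ab by auto
  have "clock k a \<noteq> clock k b"
  proof
    assume e: "clock k a = clock k b"
    have "clock k s = clock k a" if "a < s" "s < b" for s
      using mono[of a s] mono[of s b] that ab e by auto
    from DERIV_const_on_interval[OF D t(1,2) this] t ab have "(xi \<alpha> k (x t))\<^sup>2 = 0" by auto
    with t(3) show False by simp
  qed
  with mono[of a b] ab show "clock k a < clock k b" by auto
qed

section \<open>The mirrored oscillator and its corner\<close>

lemma osc_continuous:
  assumes "1 \<le> j" "j \<le> n"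
  shows "continuous_on A (osc j)" "continuous_on A (osc' j)"
  by (rule DERIV_continuous_on[OF has_field_derivative_at_within[OF osc_deriv[OF assms]]]
      DERIV_continuous_on[OF has_field_derivative_at_within[OF osc'_deriv[OF assms]]])+

lemma osc_regular_point:
  assumes j: "1 \<le> j" "j \<le> n" "\<alpha> j \<noteq> 0" and lt: "s0 < s1"
  obtains b where "s0 < b" "b < s1" "osc j b \<noteq> 0" "osc' j b \<noteq> 0"
proof -
  have jn: "j \<le> n + 1" "Suc j \<le> n + 1" using j by auto
  have "\<exists>t. s0 < t \<and> t < s1 \<and> osc j t \<noteq> 0"
  proof (rule ccontr)
    assume "\<not> ?thesis"
    then have z: "\<And>s. s0 < s \<Longrightarrow> s < s1 \<Longrightarrow> osc j s = 0" by blast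
    obtain t where t: "s0 < t" "t < s1" using dense[OF lt] by blast
    have "osc' j t = 0" by (rule DERIV_const_on_interval[OF osc_deriv[OF j(1,2)] t z])
    moreover have "osc j t ^ (2 * \<alpha> j) = 0" using z[OF t] j(3) by (simp add: zero_power)
    ultimately have "(mom j)\<^sup>2 = 0" using osc_energy[OF j(1,2), of t] by (simp only: mult_zero_right add_0 zero_power2)
    then show False using mom_nz[OF jn(1)] by simp
  qed
  then obtain t where t: "s0 < t" "t < s1" "osc j t \<noteq> 0" by blast
  obtain a' b' where ab: "s0 < a'" "a' < t" "t < b'" "b' < s1" and nz: "\<And>s. a' < s \<Longrightarrow> s < b' \<Longrightarrow> osc j s \<noteq> 0"
    using continuous_nonzero_interval[OF osc_continuous(1)[OF j(1,2)] t] by metis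
  have "\<exists>b. a' < b \<and> b < b' \<and> osc' j b \<noteq> 0"
  proof (rule ccontr)
    assume "\<not> ?thesis"
    then have z: "\<And>s. a' < s \<Longrightarrow> s < b' \<Longrightarrow> osc' j s = 0" by blast
    have "- (real (\<alpha> j) * (mom (Suc j))\<^sup>2 * osc j t ^ (2 * \<alpha> j - 1)) = 0"
      by (rule DERIV_const_on_interval[OF osc'_deriv[OF j(1,2)] ab(2,3) z])
    then show False using j(3) mom_nz[OF jn(2)] t(3) by simp
  qed
  then obtain b where "a' < b" "b < b'" "osc' j b \<noteq> 0" by blast
  with ab nz[of b] show thesis by (intro that[of b]) auto
qed

text \<open>The product \<open>osc * osc'\<close> is unchanged by a half period, so only the linear
  term of \<open>osc_int\<close> contributes and the increment does not depend on
  \<open>s\<close>.\<close>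

lemma osc_int_shift:
  assumes "\<alpha> j \<noteq> 0" "\<bar>omega \<alpha> x0 \<phi> j\<bar> * S = gpi (real (\<alpha> j))"
  shows "osc_int j (s + S) - osc_int j s = (mom j)\<^sup>2 * S / ((real (\<alpha> j) + 1) * (mom (Suc j))\<^sup>2)"
  unfolding osc_int_def osc_antiperiodic[OF assms] diff_divide_distrib[symmetric]
  by (rule arg_cong2[where f = "(/)"]) (simp_all add: algebra_simps)

text \<open>In the clock \<open>s\<close> of level \<open>j\<close>, \<open>y\<close> follows the oscillator up to \<open>a = b - S\<close>, its mirror image
  \<open>osc j (2 * b - s)\<close> up to \<open>b - e\<close>, is constant on \<open>[b - e, b + e]\<close> (this cuts the corner at \<open>b\<close>), and
  follows the oscillator again; \<open>z\<close> is the control that keeps \<open>z * y ^ \<alpha> j\<close> equal to its value for the uncut curve \<open>W\<close>.\<close>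
lemma osc_reflection:
  assumes j: "1 \<le> j" "j \<le> n" "\<alpha> j \<noteq> 0" and S: "\<bar>omega \<alpha> x0 \<phi> j\<bar> * S = gpi (real (\<alpha> j))" "0 < S" "S < s1"
  shows "\<exists>y v z W b1 b2 \<kappa> E. finite E \<and> continuous_on UNIV y \<and> (\<forall>s. s \<notin> E \<longrightarrow> (y has_real_derivative v s) (at s))
    \<and> continuous_on (- E) v \<and> continuous_on UNIV z \<and> continuous_on UNIV W \<and> (\<forall>s. z s * y s ^ \<alpha> j = W s ^ (2 * \<alpha> j))
    \<and> y 0 = osc j 0 \<and> y s1 = osc j s1 \<and> integral {0..s1} (\<lambda>s. W s ^ (2 * \<alpha> j)) = osc_int j s1
    \<and> (\<forall>s. (v s)\<^sup>2 + (mom (Suc j))\<^sup>2 * (z s)\<^sup>2 \<le> (mom j)\<^sup>2)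
    \<and> 0 \<le> b1 \<and> b1 < b2 \<and> b2 \<le> s1 \<and> \<kappa> > (0::real)
    \<and> (\<forall>s. b1 \<le> s \<longrightarrow> s \<le> b2 \<longrightarrow> (v s)\<^sup>2 + (mom (Suc j))\<^sup>2 * (z s)\<^sup>2 \<le> (mom j)\<^sup>2 - \<kappa>)"
proof -
  let ?Z = "osc j" and ?P = "osc' j" and ?a = "\<alpha> j" and ?c = "(mom (Suc j))\<^sup>2" and ?D = "(mom j)\<^sup>2" and ?R = "osc_int j"
  note cZ = osc_continuous(1)[OF j(1,2)] and cP = osc_continuous(2)[OF j(1,2)]
  note anti = osc_antiperiodic[OF j(3) S(1)]
  note E = osc_energy[OF j(1,2)]
  obtain b where b: "S < b" "b < s1" "?Z b \<noteq> 0" "?P b \<noteq> 0" using osc_regular_point[OF j S(3)] by metis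
  define a where "a = b - S"
  have a: "0 < a" "b = a + S" using b by (auto simp: a_def)
  define F where "F s = ?Z s ^ (2 * ?a)" for s
  have Fb: "F b > 0" using b(3) by (simp add: F_def power_mult)
  define \<kappa> where "\<kappa> = (?P b)\<^sup>2 / 2"
  have \<kappa>: "\<kappa> > 0" using b(4) by (simp add: \<kappa>_def)
  have D\<kappa>: "?D - \<kappa> = ?c * F b + \<kappa>" using E[of b] by (simp add: \<kappa>_def F_def)
  \<comment> \<open>A value strictly between \<open>?c * (F b)\<^sup>2\<close> and
    \<open>(?D - \<kappa>) * F b\<close>. It separates the two points in the required bound
    \<open>?c * (F t)\<^sup>2 \<le> (?D - \<kappa>) * F (b + e)\<close>: each side is compared with
    \<open>\<mu>\<close> by continuity at \<open>b\<close>.\<close>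
  define \<mu> where "\<mu> = ?c * (F b)\<^sup>2 + \<kappa> * F b / 2"
  have \<mu>: "?c * (F b)\<^sup>2 < \<mu>" "\<mu> < (?D - \<kappa>) * F b"
    unfolding D\<kappa> \<mu>_def using \<kappa> Fb by (simp_all add: distrib_right power2_eq_square)
  have cF: "isCont F b"
    unfolding F_def using cZ[of UNIV] by (intro continuous_intros) (simp add: continuous_on_eq_continuous_at)
  have "eventually (\<lambda>s. ?c * (F s)\<^sup>2 < \<mu>) (nhds b)"
  proof -
    have "isCont (\<lambda>s. ?c * (F s)\<^sup>2) b" by (intro continuous_intros cF)
    then have "((\<lambda>s. ?c * (F s)\<^sup>2) \<longlongrightarrow> ?c * (F b)\<^sup>2) (nhds b)" by (rule isCont_tendsto_nhds)
    then show ?thesis using \<mu>(1) by (rule order_tendstoD(2))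
  qed
  moreover have "eventually (\<lambda>s. \<mu> < (?D - \<kappa>) * F s) (nhds b)"
  proof -
    have "isCont (\<lambda>s. (?D - \<kappa>) * F s) b" by (intro continuous_intros cF)
    then have "((\<lambda>s. (?D - \<kappa>) * F s) \<longlongrightarrow> (?D - \<kappa>) * F b) (nhds b)" by (rule isCont_tendsto_nhds)
    then show ?thesis using \<mu>(2) by (rule order_tendstoD(1))
  qed
  moreover have "eventually (\<lambda>s. F s > 0) (nhds b)"
    by (rule order_tendstoD(1)[OF isCont_tendsto_nhds[OF cF] Fb])
  ultimately have "eventually (\<lambda>s. ?c * (F s)\<^sup>2 < \<mu> \<and> \<mu> < (?D - \<kappa>) * F s \<and> F s > 0) (nhds b)"
    by eventually_elim simp
  then obtain d where d: "d > 0" "\<And>s. dist s b < d \<Longrightarrow> ?c * (F s)\<^sup>2 < \<mu> \<and> \<mu> < (?D - \<kappa>) * F s \<and> F s > 0"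
    unfolding eventually_nhds_metric by blast
  define e where "e = min (d / 2) (min (S / 2) (s1 - b))"
  have e: "0 < e" "e < d" "e < S" "b + e \<le> s1" using d(1) S b by (auto simp: e_def min_def)
  have near: "?c * (F s)\<^sup>2 < \<mu> \<and> \<mu> < (?D - \<kappa>) * F s \<and> F s > 0" if "b \<le> s" "s \<le> b + e" for s
    using d(2)[of s] that e by (simp add: dist_real_def)
  let ?q = "?Z (b + e)"
  have q: "?q \<noteq> 0" using near[of "b + e"] e j(3) by (auto simp: F_def power_0_left)
  \<comment> \<open>The argument \<open>b + \<bar>s - b\<bar>\<close> is \<open>2 * b - s\<close>
    before \<open>b\<close> and \<open>s\<close> after it, so one formula covers the mirror image
    and the oscillator. In \<open>y\<close>, the maximum with \<open>e\<close> freezes this at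
    \<open>osc j (b + e)\<close>.\<close>
  define W where "W s = (if s \<le> a then ?Z s else ?Z (b + \<bar>s - b\<bar>))" for s
  define y where "y s = (if s \<le> a then ?Z s else ?Z (b + max e \<bar>s - b\<bar>))" for s
  define v where "v s = (if s < a then ?P s else if s < b - e then - ?P (2 * b - s) else if s \<le> b + e then 0 else ?P s)" for s
  define z where "z s = W s ^ ?a * ?Z (b + min e \<bar>s - b\<bar>) ^ ?a / ?q ^ ?a" for s
  have aS: "\<bar>a - b\<bar> = S" using a S by simp
  \<comment> \<open>\<open>b + S\<close> lies a full period after \<open>a\<close>, so the mirror
    image meets the oscillator at \<open>a\<close>.\<close>
  have per: "?Z (b + S) = ?Z a" "?P (b + S) = ?P a" using anti(1)[of a] anti(1)[of b] anti(2)[of a] anti(2)[of b] a(2) by simp_all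
  have cW: "continuous_on UNIV W"
    unfolding W_def
  proof (rule continuous_on_cases_le)
    show "continuous_on {t \<in> UNIV. a \<le> t} (\<lambda>s. ?Z (b + \<bar>s - b\<bar>))"
      by (rule continuous_on_compose2[OF cZ[of UNIV]]) (auto intro!: continuous_intros)
  qed (use cZ aS per in \<open>auto intro: continuous_on_id\<close>)
  have cy: "continuous_on UNIV y"
    unfolding y_def
  proof (rule continuous_on_cases_le)
    show "continuous_on {t \<in> UNIV. a \<le> t} (\<lambda>s. ?Z (b + max e \<bar>s - b\<bar>))"
      by (rule continuous_on_compose2[OF cZ[of UNIV]]) (auto intro!: continuous_intros)
    show "?Z t = ?Z (b + max e \<bar>t - b\<bar>)" if "t = a" for t using aS per e that by simp
  qed (use cZ in \<open>auto intro: continuous_on_id\<close>)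
  have cz: "continuous_on UNIV z"
    unfolding z_def
    by (intro continuous_intros cW continuous_on_compose2[OF cZ[of UNIV]]) (use q in auto)
  have rule_z: "z s * y s ^ ?a = W s ^ (2 * ?a)" for s
  proof -
    have ww: "W s ^ (2 * ?a) = W s ^ ?a * W s ^ ?a" by (simp add: mult_2 power_add)
    show ?thesis
    proof (cases "\<bar>s - b\<bar> \<le> e")
      case True
      then have "\<not> s \<le> a" using e(3) a by auto
      then have "y s = ?q" "W s = ?Z (b + \<bar>s - b\<bar>)" using True by (simp_all add: y_def W_def max_def)
      then show ?thesis unfolding ww z_def using True q by (simp add: min_def)
    next
      case False
      then have "y s = W s" "min e \<bar>s - b\<bar> = e" by (simp_all add: y_def W_def)
      then show ?thesis unfolding ww z_def using q by simp
    qed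
  qed
  have dy: "(y has_real_derivative v s) (at s)" if s: "s \<notin> {a, b - e, b + e}" for s
  proof -
    consider "s < a" | "a < s" "s < b - e" | "b - e < s" "s < b + e" | "b + e < s" using s by fastforce
    then show ?thesis
    proof cases
      case 1
      have "(y has_real_derivative ?P s) (at s)"
        by (rule has_field_derivative_transform_within_open[OF osc_deriv[OF j(1,2)], of "{..<a}"]) (use 1 in \<open>auto simp: y_def\<close>)
      then show ?thesis using 1 by (simp add: v_def)
    next
      case 2
      have "((\<lambda>s. 2 * b - s) has_real_derivative 0 - 1) (at s)" by (intro DERIV_diff DERIV_const DERIV_ident)
      from DERIV_chain2[OF osc_deriv[OF j(1,2)] this]
      have "(y has_real_derivative ?P (2 * b - s) * (0 - 1)) (at s)"
        by (rule has_field_derivative_transform_within_open[of _ _ _ "{a<..<b - e}"]) (use 2 e in \<open>auto simp: y_def max_def\<close>)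
      then show ?thesis using 2 by (simp add: v_def)
    next
      case 3
      have "(y has_real_derivative 0) (at s)"
        by (rule has_field_derivative_transform_within_open[OF DERIV_const[of ?q], of "{b - e<..<b + e}"]) (use 3 e a in \<open>auto simp: y_def max_def abs_if\<close>)
      then show ?thesis using 3 e a by (simp add: v_def)
    next
      case 4
      have "(y has_real_derivative ?P s) (at s)"
        by (rule has_field_derivative_transform_within_open[OF osc_deriv[OF j(1,2)], of "{b + e<..}"]) (use 4 e a S in \<open>auto simp: y_def max_def\<close>)
      then show ?thesis using 4 e a S by (simp add: v_def)
    qed
  qed
  have cv: "continuous_on (- {a, b - e, b + e}) v"
  proof -
    have "- {a, b - e, b + e} = {..<a} \<union> ({a<..<b - e} \<union> ({b - e<..<b + e} \<union> {b + e<..}))"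
      using e a by fastforce
    moreover have "continuous_on {..<a} v"
      by (rule continuous_on_eq[OF cP]) (simp add: v_def)
    moreover have "continuous_on {a<..<b - e} v"
    proof (rule continuous_on_eq)
      show "continuous_on {a<..<b - e} (\<lambda>s. - ?P (2 * b - s))"
        by (intro continuous_intros continuous_on_compose2[OF cP[of UNIV]]) auto
    qed (simp add: v_def)
    moreover have "continuous_on {b - e<..<b + e} v"
      by (rule continuous_on_eq[OF continuous_on_const[of _ 0]]) (use e a in \<open>simp add: v_def\<close>)
    moreover have "continuous_on {b + e<..} v"
      by (rule continuous_on_eq[OF cP]) (use e a S in \<open>simp add: v_def\<close>)
    ultimately show ?thesis
      by (simp only:) (intro continuous_on_open_Un open_Un open_lessThan open_greaterThanLessThan open_greaterThan; assumption)
  qed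
  have outside: "(v s)\<^sup>2 + ?c * (z s)\<^sup>2 = ?D" if s: "\<bar>s - b\<bar> > e" for s
  proof -
    have "min e \<bar>s - b\<bar> = e" using s by simp
    then have "z s = W s ^ ?a" using q by (simp add: z_def)
    then have z2: "(z s)\<^sup>2 = W s ^ (2 * ?a)" by (simp add: power_mult[symmetric] mult.commute)
    consider "s < a" | "s = a" | "a < s" "s < b - e" | "b + e < s" using s by (cases "s < b") fastforce+
    then show ?thesis
    proof cases
      case 1
      then show ?thesis unfolding z2 using E[of s] by (simp add: v_def W_def)
    next
      case 2
      have "a < b - e" using a e by simp
      then show ?thesis unfolding z2 using 2 E[of a] per(2) a by (simp add: v_def W_def add.commute)
    next
      case 3
      then show ?thesis unfolding z2 using E[of "2 * b - s"] e by (simp add: v_def W_def)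
    next
      case 4
      then show ?thesis unfolding z2 using E[of s] e a S by (simp add: v_def W_def)
    qed
  qed
  have inside: "(v s)\<^sup>2 + ?c * (z s)\<^sup>2 \<le> ?D - \<kappa>" if s: "b - e \<le> s" "s \<le> b + e" for s
  proof -
    have as: "\<bar>s - b\<bar> \<le> e" using s by (simp add: abs_le_iff)
    have na: "\<not> s < a" "\<not> s \<le> a" using s e a by auto
    then have v: "v s = 0" using s by (simp add: v_def)
    let ?t = "b + \<bar>s - b\<bar>"
    have "z s = ?Z ?t ^ ?a * ?Z ?t ^ ?a / ?q ^ ?a" using as na by (simp add: z_def W_def)
    then have "(z s)\<^sup>2 = (F ?t)\<^sup>2 / F (b + e)"
      by (simp add: F_def power_divide power_mult_distrib power_mult[symmetric] power2_eq_square mult_2 mult_2_right power_add)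
    moreover have "?c * (F ?t)\<^sup>2 \<le> (?D - \<kappa>) * F (b + e)" "F (b + e) > 0"
      using near[of ?t] near[of "b + e"] as e by auto
    ultimately have "?c * (z s)\<^sup>2 \<le> ?D - \<kappa>" by (simp add: divide_le_eq)
    with v show ?thesis by simp
  qed
  have int: "integral {0..s1} (\<lambda>s. W s ^ (2 * ?a)) = ?R s1"
  proof -
    have "((\<lambda>s. W s ^ (2 * ?a)) has_integral ?R a - ?R 0) {0..a}"
    proof (rule fundamental_theorem_of_calculus)
      fix s assume "s \<in> {0..a}"
      then have "W s = ?Z s" by (simp add: W_def)
      then show "(?R has_vector_derivative W s ^ (2 * ?a)) (at s within {0..a})"
        using has_field_derivative_at_within[OF osc_int_deriv[OF j(1,2)]] by (simp add: has_real_derivative_iff_has_vector_derivative)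
    qed (use a in simp)
    moreover have "((\<lambda>s. W s ^ (2 * ?a)) has_integral (- ?R (2 * b - b)) - (- ?R (2 * b - a))) {a..b}"
    proof (rule fundamental_theorem_of_calculus)
      fix s assume s: "s \<in> {a..b}"
      have W: "W s = ?Z (2 * b - s)"
      proof (cases "s = a")
        case True
        have "2 * b - a = b + S" using a by simp
        then show ?thesis using per(1) unfolding True W_def by (simp only: order_refl if_True)
      next
        case False
        then have "\<not> s \<le> a" "b + \<bar>s - b\<bar> = 2 * b - s" using s by auto
        then show ?thesis by (simp add: W_def)
      qed
      have "((\<lambda>s. 2 * b - s) has_real_derivative 0 - 1) (at s)" by (intro DERIV_diff DERIV_const DERIV_ident)
      from DERIV_minus[OF DERIV_chain2[OF osc_int_deriv[OF j(1,2)] this]]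
      have "((\<lambda>s. - ?R (2 * b - s)) has_real_derivative W s ^ (2 * ?a)) (at s)" unfolding W by simp
      then show "((\<lambda>s. - ?R (2 * b - s)) has_vector_derivative W s ^ (2 * ?a)) (at s within {a..b})"
        by (simp add: has_field_derivative_at_within flip: has_real_derivative_iff_has_vector_derivative)
    qed (use a S in simp)
    ultimately have "((\<lambda>s. W s ^ (2 * ?a)) has_integral (?R a - ?R 0) + ((- ?R (2 * b - b)) - (- ?R (2 * b - a)))) {0..b}"
      by (rule has_integral_combine[rotated 2]) (use a S in auto)
    moreover have "((\<lambda>s. W s ^ (2 * ?a)) has_integral ?R s1 - ?R b) {b..s1}"
    proof (rule fundamental_theorem_of_calculus)
      fix s assume "s \<in> {b..s1}"
      then have "W s = ?Z s" using a S by (simp add: W_def)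
      then show "(?R has_vector_derivative W s ^ (2 * ?a)) (at s within {b..s1})"
        using has_field_derivative_at_within[OF osc_int_deriv[OF j(1,2)]] by (simp add: has_real_derivative_iff_has_vector_derivative)
    qed (use b in simp)
    ultimately have "((\<lambda>s. W s ^ (2 * ?a)) has_integral ((?R a - ?R 0) + ((- ?R (2 * b - b)) - (- ?R (2 * b - a)))) + (?R s1 - ?R b)) {0..s1}"
      by (rule has_integral_combine[rotated 2]) (use a S b in auto)
    from integral_unique[OF this]
    have "integral {0..s1} (\<lambda>s. W s ^ (2 * ?a)) = ?R s1 + (?R (b + S) - ?R b) - (?R (a + S) - ?R a)"
      using a(2) by (simp add: algebra_simps)
    \<comment> \<open>The mirrored piece contributes \<open>?R (b + S) - ?R b\<close> in place of
      \<open>?R (a + S) - ?R a\<close>; both are increments over a half period.\<close>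
    then show ?thesis unfolding osc_int_shift[OF j(3) S(1)] by simp
  qed
  have bound: "(v s)\<^sup>2 + ?c * (z s)\<^sup>2 \<le> ?D" for s
  proof (cases "\<bar>s - b\<bar> > e")
    case True then show ?thesis using outside[of s] by simp
  next
    case False
    then have "b - e \<le> s" "s \<le> b + e" by auto
    then show ?thesis using inside[of s] \<kappa> by simp
  qed
  show ?thesis
  proof (rule exI[of _ y], rule exI[of _ v], rule exI[of _ z], rule exI[of _ W], rule exI[of _ "b - e"],
      rule exI[of _ "b + e"], rule exI[of _ \<kappa>], rule exI[of _ "{a, b - e, b + e}"], intro conjI allI impI)
    show "y 0 = ?Z 0" using a by (simp add: y_def)
    show "y s1 = ?Z s1" using e a S b by (simp add: y_def max_def)
    show "0 \<le> b - e" "b - e < b + e" using e a by auto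
    show "(v s)\<^sup>2 + ?c * (z s)\<^sup>2 \<le> ?D - \<kappa>" if "b - e \<le> s" "s \<le> b + e" for s by (rule inside[OF that])
  qed (rule cy cv cz cW int \<kappa> e(4) rule_z bound finite.intros dy; assumption?)+
qed

text \<open>The new curve keeps the coordinates before \<open>j\<close>, moves \<open>x_j\<close>
  along \<open>y\<close> in clock \<open>j\<close>, and places the later coordinates where the
  geodesic has them at the time \<open>\<theta> t\<close>, when clock \<open>j + 1\<close> reads
  \<open>r (clock j t)\<close>. Since \<open>r\<close> ends at \<open>clock (Suc j) t1\<close>, the
  end point is correct.\<close>

lemma shorter_competitor:
  assumes j: "1 \<le> j" "j \<le> n" "\<alpha> j \<noteq> 0"
    and t0: "\<bar>omega \<alpha> x0 \<phi> j\<bar> * clock j t0 = gpi (real (\<alpha> j))" "0 < t0" "t0 < t1"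
  shows "\<exists>\<gamma> u. horizontal n \<alpha> t1 \<gamma> u \<and> (\<forall>k\<in>{1..n+1}. \<gamma> 0 k = x 0 k \<and> \<gamma> t1 k = x t1 k) \<and> ctrl_length n t1 u < t1"
proof -
  let ?s = "clock j" and ?\<sigma> = "clock (Suc j)" and ?a = "\<alpha> j" and ?I = "{0..t1}"
  define s1 where "s1 = ?s t1"
  have jn: "j \<le> n + 1" "j \<le> n + 2" "Suc j \<le> n + 1" "1 \<le> Suc j" "Suc j \<le> n + 2" using j by auto
  have t1: "0 < t1" using t0 by simp
  have T: "0 \<in> ?I" "t1 \<in> ?I" "t0 \<in> ?I" using t0 by auto
  have ms: "strict_mono_on ?I ?s" by (rule clock_strict_mono[OF j(1) jn(1)])
  have m\<sigma>: "strict_mono_on ?I ?\<sigma>" by (rule clock_strict_mono[OF jn(4,3)])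
  have smono: "?s a \<le> ?s b" if "a \<in> ?I" "b \<in> ?I" "a \<le> b" for a b by (rule strict_mono_on_leD[OF ms that])
  have S: "0 < ?s t0" "?s t0 < s1"
    using strict_mono_onD[OF ms T(1,3) t0(2)] strict_mono_onD[OF ms T(3,2) t0(3)] by (simp_all add: s1_def)
  have sI: "?s t \<in> {0..s1}" if "t \<in> ?I" for t
    using smono[OF T(1) that] smono[OF that T(2)] that by (simp add: s1_def)
  have ds: "(?s has_real_derivative (xi \<alpha> j (x t))\<^sup>2) (at t within ?I)" if "t \<in> ?I" for t
    by (rule clock_deriv[OF jn(2) that])
  have cs: "continuous_on ?I ?s" by (rule DERIV_continuous_on[OF ds])
  obtain y v z W b1 b2 \<kappa> E where E: "finite E" and cy: "continuous_on UNIV y"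
    and dy: "\<forall>s. s \<notin> E \<longrightarrow> (y has_real_derivative v s) (at s)"
    and cv: "continuous_on (- E) v" and cz: "continuous_on UNIV z" and cW: "continuous_on UNIV W"
    and zy: "\<forall>s. z s * y s ^ ?a = W s ^ (2 * ?a)"
    and y0: "y 0 = osc j 0" and y1: "y s1 = osc j s1" and intW: "integral {0..s1} (\<lambda>s. W s ^ (2 * ?a)) = osc_int j s1"
    and le: "\<forall>s. (v s)\<^sup>2 + (mom (Suc j))\<^sup>2 * (z s)\<^sup>2 \<le> (mom j)\<^sup>2"
    and b: "0 \<le> b1" "b1 < b2" "b2 \<le> s1" and \<kappa>: "\<kappa> > (0::real)"
    and gain: "\<forall>s. b1 \<le> s \<longrightarrow> s \<le> b2 \<longrightarrow> (v s)\<^sup>2 + (mom (Suc j))\<^sup>2 * (z s)\<^sup>2 \<le> (mom j)\<^sup>2 - \<kappa>"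
    using osc_reflection[OF j t0(1) S] by (elim exE conjE) (rule that)
  \<comment> \<open>Built from the uncut curve \<open>W\<close>: the relation
    \<open>z * y ^ \<alpha> j = W ^ (2 * \<alpha> j)\<close> lets the cut curve follow this
    schedule.\<close>
  define r where "r s = integral {0..s} (\<lambda>s. W s ^ (2 * ?a))" for s
  have dr: "(r has_real_derivative W s ^ (2 * ?a)) (at s within {0..s1})" if "s \<in> {0..s1}" for s
    unfolding r_def[abs_def]
    by (rule integral_has_real_derivative[OF _ that]) (intro continuous_intros continuous_on_subset[OF cW] subset_UNIV)
  have cr: "continuous_on {0..s1} r" by (rule DERIV_continuous_on[OF dr])
  have r0: "r 0 = 0" by (simp add: r_def)
  have r1: "r s1 = ?\<sigma> t1" using intW clock_Suc[OF j(1,2), of t1] t1 by (simp add: r_def s1_def)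
  have iW: "(\<lambda>s. W s ^ (2 * ?a)) integrable_on {0..s1}"
    by (intro integrable_continuous_real continuous_intros continuous_on_subset[OF cW] subset_UNIV)
  have rI: "r s \<in> {?\<sigma> 0..?\<sigma> t1}" if s: "s \<in> {0..s1}" for s
  proof -
    have s': "0 \<le> s" "s \<le> s1" using s by auto
    have "0 \<le> integral {0..s} (\<lambda>s. W s ^ (2 * ?a))"
      by (rule integral_nonneg[OF integral_difference(1)[OF iW order_refl s']]) (simp add: power_mult)
    moreover have "0 \<le> integral {s..s1} (\<lambda>s. W s ^ (2 * ?a))"
      by (rule integral_nonneg[OF integral_difference(1)[OF iW s' order_refl]]) (simp add: power_mult)
    ultimately show ?thesis
      using integral_difference(2)[OF iW s' order_refl] r1 by (simp add: r_def)
  qed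
  define \<tau> where "\<tau> = the_inv_into ?I ?\<sigma>"
  have \<tau>: "\<tau> (?\<sigma> t) = t" if "t \<in> ?I" for t
    unfolding \<tau>_def by (rule the_inv_into_f_f[OF strict_mono_on_imp_inj_on[OF m\<sigma>] that])
  have d\<sigma>: "(?\<sigma> has_real_derivative (xi \<alpha> (Suc j) (x t))\<^sup>2) (at t within ?I)" if "t \<in> ?I" for t
    by (rule clock_deriv[OF jn(5) that])
  \<comment> \<open>The velocity of \<open>x_k\<close> with respect to clock \<open>j + 1\<close>;
    it stays continuous where that clock has rate zero.\<close>
  define q where "q k t = (eta \<alpha> (Suc j) k (x t))\<^sup>2 * p t k" for k t
  have cq: "continuous_on ?I (q k)" if "Suc j \<le> k" "k \<le> n + 1" for k
    unfolding q_def using that by (intro continuous_intros continuous_eta continuous_p) auto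
  have dxk: "((\<lambda>t. x t k) has_real_derivative (xi \<alpha> (Suc j) (x t))\<^sup>2 * q k t) (at t within ?I)"
    if k: "Suc j \<le> k" "k \<le> n + 1" and t: "t \<in> ?I" for k t
  proof -
    have k1: "1 \<le> k" using k j by simp
    show ?thesis
      using x_deriv[OF k1 k(2) t] unfolding xi_mult[OF jn(4) k(1)] q_def by (simp add: power_mult_distrib mult.assoc)
  qed
  note rep = reparametrized_derivative[OF less_imp_le[OF t1] m\<sigma> d\<sigma> dxk cq \<tau>]
  have last: "Suc j \<le> n + 1" "n + 1 \<le> n + 1" using j by auto
  have c\<tau>: "continuous_on {?\<sigma> 0..?\<sigma> t1} \<tau>" by (rule rep(2)) (assumption | rule last)+
  have \<tau>I: "\<tau> \<rho> \<in> ?I" if "\<rho> \<in> {?\<sigma> 0..?\<sigma> t1}" for \<rho>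
  proof -
    have "\<tau> \<rho> \<in> ?I \<and> ?\<sigma> (\<tau> \<rho>) = \<rho>" by (rule rep(3)) (assumption | rule last that)+
    then show ?thesis ..
  qed
  have d\<tau>: "((\<lambda>r. x (\<tau> r) k) has_real_derivative q k (\<tau> \<rho>)) (at \<rho> within {?\<sigma> 0..?\<sigma> t1})"
    if "Suc j \<le> k" "k \<le> n + 1" "\<rho> \<in> {?\<sigma> 0..?\<sigma> t1}" for k \<rho>
    by (rule rep(4)) (assumption | rule that)+
  define \<theta> where "\<theta> t = \<tau> (r (?s t))" for t
  have \<theta>I: "\<theta> t \<in> ?I" if "t \<in> ?I" for t
    unfolding \<theta>_def by (rule \<tau>I[OF rI[OF sI[OF that]]])
  have c\<theta>: "continuous_on ?I \<theta>"
    unfolding \<theta>_def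
  proof (rule continuous_on_compose2[OF c\<tau>])
    show "continuous_on ?I (\<lambda>t. r (?s t))"
      by (rule continuous_on_compose2[OF cr cs]) (use sI in blast)
    show "(\<lambda>t. r (?s t)) ` ?I \<subseteq> {?\<sigma> 0..?\<sigma> t1}" using rI sI by blast
  qed
  have d\<theta>: "((\<lambda>t. x (\<theta> t) k) has_real_derivative q k (\<theta> t) * (W (?s t) ^ (2 * ?a) * (xi \<alpha> j (x t))\<^sup>2)) (at t within ?I)"
    if k: "Suc j \<le> k" "k \<le> n + 1" and t: "t \<in> ?I" for k t
  proof -
    have "((\<lambda>t. r (?s t)) has_real_derivative W (?s t) ^ (2 * ?a) * (xi \<alpha> j (x t))\<^sup>2) (at t within ?I)"
      by (rule DERIV_chain_within[where g = ?s, OF dr[OF sI[OF t]] ds[OF t]]) (use sI in blast)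
    then show ?thesis
      unfolding \<theta>_def
      by (rule DERIV_chain_within[where g = "\<lambda>t. r (?s t)", OF d\<tau>[OF k rI[OF sI[OF t]]]]) (use rI sI in blast)
  qed
  define \<gamma> where "\<gamma> t k = (if k < j then x t k else if k = j then y (?s t) else x (\<theta> t) k)" for t k
  define u where "u k t = (if k < j then ctrl k t else if k = j then xi \<alpha> j (x t) * v (?s t)
     else xi \<alpha> j (x t) * z (?s t) * eta \<alpha> (Suc j) k (x (\<theta> t)) * p (\<theta> t) k)" for k t
  have xi_le: "xi \<alpha> k (\<gamma> t) = xi \<alpha> k (x t)" if "k \<le> j" for k t
    unfolding xi_def by (rule prod.cong) (use that in \<open>auto simp: \<gamma>_def\<close>)
  have xi_gt: "xi \<alpha> k (\<gamma> t) = xi \<alpha> j (x t) * y (?s t) ^ ?a * eta \<alpha> (Suc j) k (x (\<theta> t))" if k: "Suc j \<le> k" for k t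
  proof -
    have "eta \<alpha> (Suc j) k (\<gamma> t) = eta \<alpha> (Suc j) k (x (\<theta> t))" by (rule eta_cong) (simp add: \<gamma>_def)
    then show ?thesis
      unfolding xi_mult[OF jn(4) k] xi_Suc[OF j(1)] xi_le[OF order_refl] by (simp add: \<gamma>_def)
  qed
  \<comment> \<open>The times at which clock \<open>j\<close> reaches a jump of \<open>v\<close>;
    finitely many because the clock is injective.\<close>
  define F where "F = ?s -` E \<inter> ?I"
  have F: "finite F" unfolding F_def by (rule finite_vimage_IntI[OF E strict_mono_on_imp_inj_on[OF ms]])
  have cxj: "continuous_on ?I (\<lambda>t. xi \<alpha> j (x t))" by (rule continuous_xi[OF jn(2)])
  have hor: "horizontal n \<alpha> t1 \<gamma> u"
    unfolding horizontal_def
  proof (intro conjI ballI)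
    show "0 \<le> t1" using t1 by simp
    fix k assume k: "k \<in> {1..n+1}"
    consider "k < j" | "k = j" | "Suc j \<le> k" by linarith
    then have "u k absolutely_integrable_on ?I \<and> (\<forall>t\<in>?I. ((\<lambda>s. u k s * xi \<alpha> k (\<gamma> s)) has_integral \<gamma> t k - \<gamma> 0 k) {0..t})"
    proof cases
      case 1
      have h: "horizontal n \<alpha> t1 x ctrl" by (rule horizontal_ctrl[OF less_imp_le[OF t1]])
      have "u k = ctrl k" "\<And>t. \<gamma> t k = x t k" "\<And>t. xi \<alpha> k (\<gamma> t) = xi \<alpha> k (x t)"
        using 1 xi_le[of k] by (auto simp: u_def \<gamma>_def)
      then show ?thesis using horizontalD(2)[OF h k] horizontalD(3)[OF h k] by (simp only:) blast
    next
      case 2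
      have uk: "u k = (\<lambda>t. xi \<alpha> j (x t) * v (?s t))" and gk: "\<And>t. \<gamma> t k = y (?s t)"
        using 2 by (auto simp: u_def \<gamma>_def)
      have "bounded ((\<lambda>t. xi \<alpha> j (x t)) ` ?I)" by (intro compact_imp_bounded compact_continuous_image cxj) simp
      then obtain C where C: "\<And>t. t \<in> ?I \<Longrightarrow> \<bar>xi \<alpha> j (x t)\<bar> \<le> C" unfolding bounded_iff by fastforce
      have vb: "\<bar>v s\<bar> \<le> \<bar>mom j\<bar>" for s
      proof -
        have "0 \<le> (mom (Suc j))\<^sup>2 * (z s)\<^sup>2" by simp
        then have "(v s)\<^sup>2 \<le> (mom j)\<^sup>2" using le[rule_format, of s] by linarith
        then show ?thesis by (simp only: abs_le_square_iff)
      qed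
      have "u k absolutely_integrable_on ?I"
        unfolding uk
      proof (rule absolutely_integrable_finite_discont[OF F])
        show "continuous_on (?I - F) (\<lambda>t. xi \<alpha> j (x t) * v (?s t))"
        proof (intro continuous_intros)
          show "continuous_on (?I - F) (\<lambda>t. xi \<alpha> j (x t))" by (rule continuous_on_subset[OF cxj]) blast
          show "continuous_on (?I - F) (\<lambda>t. v (?s t))"
            by (rule continuous_on_compose2[OF cv continuous_on_subset[OF cs]]) (auto simp: F_def)
        qed
        fix t assume t: "t \<in> ?I"
        show "\<bar>xi \<alpha> j (x t) * v (?s t)\<bar> \<le> C * \<bar>mom j\<bar>"
          unfolding abs_mult by (rule mult_mono[OF C[OF t] vb]) (use C[OF t] in auto)
      qed
      moreover have "((\<lambda>s. u k s * xi \<alpha> k (\<gamma> s)) has_integral \<gamma> t k - \<gamma> 0 k) {0..t}" if t: "t \<in> ?I" for t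
        unfolding gk
      proof (rule fundamental_theorem_of_calculus_interior_strong[OF F])
        show "0 \<le> t" using t by simp
        have "continuous_on ?I (\<lambda>t. y (?s t))" by (rule continuous_on_compose2[OF cy cs]) simp
        then show "continuous_on {0..t} (\<lambda>t. y (?s t))" by (rule continuous_on_subset) (use t in auto)
        fix s assume s: "s \<in> {0<..<t} - F"
        have sI': "s \<in> ?I" "0 < s" "s < t1" using s t by auto
        have "(?s has_real_derivative (xi \<alpha> j (x s))\<^sup>2) (at s)"
          using ds[OF sI'(1)] sI'(2,3) by (simp only: at_within_Icc_at)
        moreover have "(y has_real_derivative v (?s s)) (at (?s s))" using dy s sI' by (auto simp: F_def)
        ultimately have "((\<lambda>t. y (?s t)) has_real_derivative v (?s s) * (xi \<alpha> j (x s))\<^sup>2) (at s)" by (rule DERIV_chain2[rotated])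
        moreover have "u k s * xi \<alpha> k (\<gamma> s) = v (?s s) * (xi \<alpha> j (x s))\<^sup>2"
          unfolding uk using xi_le[of k s] 2 by (simp add: power2_eq_square)
        ultimately show "((\<lambda>t. y (?s t)) has_vector_derivative u k s * xi \<alpha> k (\<gamma> s)) (at s)"
          by (simp only: has_real_derivative_iff_has_vector_derivative)
      qed
      ultimately show ?thesis by blast
    next
      case 3
      have k': "1 \<le> k" "k \<le> n + 1" "k \<le> n + 2" using k by auto
      have uk: "u k = (\<lambda>t. xi \<alpha> j (x t) * z (?s t) * eta \<alpha> (Suc j) k (x (\<theta> t)) * p (\<theta> t) k)" and gk: "\<And>t. \<gamma> t k = x (\<theta> t) k"
        using 3 by (auto simp: u_def \<gamma>_def)
      have "continuous_on ?I (u k)"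
        unfolding uk
      proof (intro continuous_intros cxj)
        show "continuous_on ?I (\<lambda>t. z (?s t))" by (rule continuous_on_compose2[OF cz cs]) simp
        show "continuous_on ?I (\<lambda>t. eta \<alpha> (Suc j) k (x (\<theta> t)))"
          by (rule continuous_on_compose2[OF continuous_eta[OF jn(4) k'(3), of t1] c\<theta>]) (use \<theta>I in blast)
        show "continuous_on ?I (\<lambda>t. p (\<theta> t) k)"
          by (rule continuous_on_compose2[OF continuous_p[OF k'(1,2), of t1] c\<theta>]) (use \<theta>I in blast)
      qed
      then have "u k absolutely_integrable_on ?I" by (rule absolutely_integrable_continuous_real)
      moreover have "((\<lambda>s. u k s * xi \<alpha> k (\<gamma> s)) has_integral \<gamma> t k - \<gamma> 0 k) {0..t}" if t: "t \<in> ?I" for t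
        unfolding gk
      proof (rule fundamental_theorem_of_calculus)
        show "0 \<le> t" using t by simp
        fix s assume s: "s \<in> {0..t}"
        then have sI': "s \<in> ?I" using t by auto
        have "u k s * xi \<alpha> k (\<gamma> s) = q k (\<theta> s) * ((z (?s s) * y (?s s) ^ ?a) * (xi \<alpha> j (x s))\<^sup>2)"
          unfolding xi_gt[OF 3] uk q_def by (simp add: power2_eq_square mult_ac)
        then have e: "u k s * xi \<alpha> k (\<gamma> s) = q k (\<theta> s) * (W (?s s) ^ (2 * ?a) * (xi \<alpha> j (x s))\<^sup>2)"
          using zy by simp
        have "((\<lambda>t. x (\<theta> t) k) has_real_derivative u k s * xi \<alpha> k (\<gamma> s)) (at s within {0..t})"
          unfolding e by (rule DERIV_subset[OF d\<theta>[OF 3 k'(2) sI']]) (use t in auto)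
        then show "((\<lambda>t. x (\<theta> t) k) has_vector_derivative u k s * xi \<alpha> k (\<gamma> s)) (at s within {0..t})"
          by (simp only: has_real_derivative_iff_has_vector_derivative)
      qed
      ultimately show ?thesis by blast
    qed
    then show "u k absolutely_integrable_on ?I"
      "\<And>t. t \<in> ?I \<Longrightarrow> ((\<lambda>s. u k s * xi \<alpha> k (\<gamma> s)) has_integral \<gamma> t k - \<gamma> 0 k) {0..t}" by blast+
  qed
  have \<theta>0: "\<theta> 0 = 0" using \<tau>[OF T(1)] r0 by (simp add: \<theta>_def)
  have \<theta>1: "\<theta> t1 = t1" using \<tau>[OF T(2)] r1 by (simp add: \<theta>_def s1_def)
  have ends: "\<gamma> 0 k = x 0 k \<and> \<gamma> t1 k = x t1 k" for k
    using y0 y1 x_eq_osc(1)[OF j(1,2), of 0] x_eq_osc(1)[OF j(1,2), of t1] t1 \<theta>0 \<theta>1 by (simp add: \<gamma>_def s1_def)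
  have split: "(\<Sum>k\<in>{1..n+1}. f k) = (\<Sum>k\<in>{1..<j}. f k) + (\<Sum>k\<in>{j..n+1}. f k)" for f :: "nat \<Rightarrow> real"
  proof -
    have "{1..n+1} = {1..<j} \<union> {j..n+1}" "{1..<j} \<inter> {j..n+1} = {}" using j by auto
    then show ?thesis by (simp only: sum.union_disjoint finite_atLeastLessThan finite_atLeastAtMost)
  qed
  \<comment> \<open>The energy of level \<open>j + 1\<close> has the same value at time
    \<open>\<theta> t\<close> as at \<open>t\<close>, so the time change enters only through
    \<open>z\<close>; the coordinates before \<open>j\<close> keep their share.\<close>
  have speed: "(\<Sum>k\<in>{1..n+1}. (u k t)\<^sup>2) = 1 - (xi \<alpha> j (x t))\<^sup>2 * ((mom j)\<^sup>2 - ((v (?s t))\<^sup>2 + (mom (Suc j))\<^sup>2 * (z (?s t))\<^sup>2))"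
    if t: "t \<in> ?I" for t
  proof -
    have t': "0 \<le> t" "0 \<le> \<theta> t" using t \<theta>I[OF t] by auto
    have "(\<Sum>k\<in>{1..<j}. (u k t)\<^sup>2) = (\<Sum>k\<in>{1..<j}. (ctrl k t)\<^sup>2)"
      by (rule sum.cong) (simp_all add: u_def)
    also have "\<dots> = 1 - (xi \<alpha> j (x t))\<^sup>2 * (mom j)\<^sup>2"
      using split[of "\<lambda>k. (ctrl k t)\<^sup>2"] ctrl_unit[OF t'(1)] ctrl_sum[OF j(1) jn(1) t'(1)] by linarith
    finally have a: "(\<Sum>k\<in>{1..<j}. (u k t)\<^sup>2) = 1 - (xi \<alpha> j (x t))\<^sup>2 * (mom j)\<^sup>2" .
    have "(\<Sum>k\<in>{Suc j..n+1}. (u k t)\<^sup>2) = (\<Sum>k\<in>{Suc j..n+1}. ((xi \<alpha> j (x t))\<^sup>2 * (z (?s t))\<^sup>2) * ((eta \<alpha> (Suc j) k (x (\<theta> t)))\<^sup>2 * (p (\<theta> t) k)\<^sup>2))"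
      by (rule sum.cong) (auto simp: u_def power_mult_distrib)
    also have "\<dots> = ((xi \<alpha> j (x t))\<^sup>2 * (z (?s t))\<^sup>2) * tail_energy n \<alpha> (Suc j) (x (\<theta> t)) (p (\<theta> t))"
      unfolding tail_energy_def sum_distrib_left ..
    also have "\<dots> = ((xi \<alpha> j (x t))\<^sup>2 * (z (?s t))\<^sup>2) * (mom (Suc j))\<^sup>2"
      using energy_conserved[OF jn(4,3)] t'(2) by simp
    finally have c: "(\<Sum>k\<in>{Suc j..n+1}. (u k t)\<^sup>2) = ((xi \<alpha> j (x t))\<^sup>2 * (z (?s t))\<^sup>2) * (mom (Suc j))\<^sup>2" .
    have "(\<Sum>k\<in>{j..n+1}. (u k t)\<^sup>2) = (u j t)\<^sup>2 + (\<Sum>k\<in>{Suc j..n+1}. (u k t)\<^sup>2)"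
      by (rule sum.atLeast_Suc_atMost[OF jn(1)])
    also have "(u j t)\<^sup>2 = (xi \<alpha> j (x t))\<^sup>2 * (v (?s t))\<^sup>2" by (simp add: u_def power_mult_distrib)
    finally show ?thesis unfolding split[of "\<lambda>k. (u k t)\<^sup>2"] a c by (simp add: algebra_simps)
  qed
  let ?N = "\<lambda>t. sqrt (\<Sum>k\<in>{1..n+1}. (u k t)\<^sup>2)"
  have N1: "?N t \<le> 1" if t: "t \<in> ?I" for t
  proof -
    have "0 \<le> (xi \<alpha> j (x t))\<^sup>2 * ((mom j)\<^sup>2 - ((v (?s t))\<^sup>2 + (mom (Suc j))\<^sup>2 * (z (?s t))\<^sup>2))"
      using le[rule_format, of "?s t"] by (intro mult_nonneg_nonneg) auto
    then have "(\<Sum>k\<in>{1..n+1}. (u k t)\<^sup>2) \<le> 1" using speed[OF t] by linarith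
    then show ?thesis by (simp only: real_sqrt_le_1_iff)
  qed
  \<comment> \<open>This is \<open>sqrt (1 - h) \<le> 1 - h / 2\<close> with
    \<open>h = xi_j\<^sup>2 * \<kappa>\<close>. The gain is proportional to the rate of clock
    \<open>j\<close>, so it integrates to \<open>(b2 - b1) * (\<kappa> / 2)\<close> even if
    \<open>xi_j\<close> has zeros.\<close>
  have N2: "?N t \<le> 1 - (xi \<alpha> j (x t))\<^sup>2 * (\<kappa> / 2)" if t: "t \<in> ?I" "b1 \<le> ?s t" "?s t \<le> b2" for t
  proof -
    let ?X = "(xi \<alpha> j (x t))\<^sup>2"
    have "?X * \<kappa> \<le> ?X * ((mom j)\<^sup>2 - ((v (?s t))\<^sup>2 + (mom (Suc j))\<^sup>2 * (z (?s t))\<^sup>2))"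
      using gain[rule_format, OF t(2,3)] by (intro mult_left_mono) auto
    then have le1: "(\<Sum>k\<in>{1..n+1}. (u k t)\<^sup>2) \<le> 1 - ?X * \<kappa>" using speed[OF t(1)] by linarith
    have "0 \<le> (\<Sum>k\<in>{1..n+1}. (u k t)\<^sup>2)" by (rule sum_nonneg) simp
    then have "?X * \<kappa> \<le> 1" using le1 by linarith
    then have nn: "0 \<le> 1 - ?X * (\<kappa> / 2)" by simp
    have "(1 - ?X * (\<kappa> / 2))\<^sup>2 = 1 - ?X * \<kappa> + (?X * (\<kappa> / 2))\<^sup>2" by (simp add: power2_eq_square algebra_simps)
    then have "(\<Sum>k\<in>{1..n+1}. (u k t)\<^sup>2) \<le> (1 - ?X * (\<kappa> / 2))\<^sup>2"
      using le1 zero_le_power2[of "?X * (\<kappa> / 2)"] by linarith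
    then show ?thesis using nn by (intro real_le_lsqrt)
  qed
  have iN: "?N integrable_on ?I" by (rule ctrl_length_integrable[OF hor])
  have b1s: "?s 0 \<le> b1" "b1 \<le> ?s t1" and b2s: "b2 \<le> ?s t1" using b by (auto simp: s1_def)
  obtain c1 where c1: "0 \<le> c1" "c1 \<le> t1" "?s c1 = b1"
    using IVT'[of ?s 0 b1 t1, OF b1s less_imp_le[OF t1] cs] by blast
  have "?s c1 \<le> b2" using c1 b by simp
  moreover have "continuous_on {c1..t1} ?s" by (rule continuous_on_subset[OF cs]) (use c1 in auto)
  ultimately obtain c2 where c2: "c1 \<le> c2" "c2 \<le> t1" "?s c2 = b2"
    using IVT'[of ?s c1 b2 t1, OF _ b2s c1(2)] by blast
  have c12: "c1 \<in> ?I" "c2 \<in> ?I" "0 \<le> c2" using c1 c2 by auto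
  have i1: "integral {0..c1} ?N \<le> c1"
  proof -
    have "integral {0..c1} ?N \<le> integral {0..c1} (\<lambda>t. 1)"
      by (rule integral_le[OF integral_difference(1)[OF iN order_refl c1(1,2)] integrable_const_ivl N1]) (use c1 in auto)
    then show ?thesis using c1 by simp
  qed
  have i3: "integral {c2..t1} ?N \<le> t1 - c2"
  proof -
    have "integral {c2..t1} ?N \<le> integral {c2..t1} (\<lambda>t. 1)"
      by (rule integral_le[OF integral_difference(1)[OF iN c12(3) c2(2) order_refl] integrable_const_ivl N1]) (use c12 in auto)
    then show ?thesis using c2 by simp
  qed
  have i2: "integral {c1..c2} ?N \<le> (c2 - c1) - (b2 - b1) * (\<kappa> / 2)"
  proof -
    let ?X = "\<lambda>t. (xi \<alpha> j (x t))\<^sup>2"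
    have iX: "?X integrable_on ?I" by (intro integrable_continuous_real continuous_intros cxj)
    have iX': "?X integrable_on {c1..c2}" by (rule integral_difference(1)[OF iX c1(1) c2(1,2)])
    have "integral {c1..c2} ?N \<le> integral {c1..c2} (\<lambda>t. 1 - ?X t * (\<kappa> / 2))"
    proof (rule integral_le)
      show "?N integrable_on {c1..c2}" by (rule integral_difference(1)[OF iN c1(1) c2(1,2)])
      show "(\<lambda>t. 1 - ?X t * (\<kappa> / 2)) integrable_on {c1..c2}"
        by (intro integrable_diff integrable_const_ivl integrable_on_mult_left iX')
      fix t assume t: "t \<in> {c1..c2}"
      then have tI: "t \<in> ?I" using c12 by auto
      show "?N t \<le> 1 - ?X t * (\<kappa> / 2)"
        by (rule N2[OF tI]) (use smono[OF c12(1) tI] smono[OF tI c12(2)] t c1 c2 in auto)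
    qed
    also have "\<dots> = integral {c1..c2} (\<lambda>t. 1) - integral {c1..c2} (\<lambda>t. ?X t * (\<kappa> / 2))"
      by (intro integral_diff integrable_const_ivl integrable_on_mult_left iX')
    also have "integral {c1..c2} (\<lambda>t. ?X t * (\<kappa> / 2)) = integral {c1..c2} ?X * (\<kappa> / 2)" by (rule integral_mult_left)
    also have "integral {c1..c2} ?X = b2 - b1"
      using integral_difference(2)[OF iX c1(1) c2(1,2)] c1(3) c2(3) by (simp add: clock_def)
    also have "integral {c1..c2} (\<lambda>t. 1::real) = c2 - c1" using c2 by simp
    finally show ?thesis .
  qed
  have "ctrl_length n t1 u = integral {0..c1} ?N + integral {c1..c2} ?N + integral {c2..t1} ?N"
    unfolding ctrl_length_def
    using integral_difference(2)[OF iN c1(1) c2(1,2)] integral_difference(2)[OF iN c12(3) c2(2) order_refl] by linarith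
  also have "\<dots> \<le> t1 - (b2 - b1) * (\<kappa> / 2)" using i1 i2 i3 by linarith
  also have "\<dots> < t1" using b(2) \<kappa> by simp
  finally have "ctrl_length n t1 u < t1" .
  with hor ends show ?thesis by blast
qed

section \<open>Comparison with the distance and the bound on the cut time\<close>

lemma not_minimizing_after:
  assumes "1 \<le> j" "j \<le> n" "\<alpha> j \<noteq> 0"
    and "\<bar>omega \<alpha> x0 \<phi> j\<bar> * clock j t0 = gpi (real (\<alpha> j))" "0 < t0" "minimizing_on n \<alpha> x t1"
  shows "t1 \<le> t0"
proof (rule ccontr)
  assume "\<not> t1 \<le> t0"
  then obtain \<gamma> u where c: "horizontal n \<alpha> t1 \<gamma> u" "\<forall>k\<in>{1..n+1}. \<gamma> 0 k = x 0 k \<and> \<gamma> t1 k = x t1 k" "ctrl_length n t1 u < t1"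
    using shorter_competitor[OF assms(1-5), of t1] by auto
  let ?X = "{L. \<exists>T \<gamma> u. horizontal n \<alpha> T \<gamma> u \<and> (\<forall>k\<in>{1..n+1}. \<gamma> 0 k = x 0 k \<and> \<gamma> T k = x t1 k) \<and> L = ctrl_length n T u}"
  obtain w where w: "horizontal n \<alpha> t1 x w" "ctrl_length n t1 w = cc_dist n \<alpha> (x 0) (x t1)"
    using assms(6) unfolding minimizing_on_def by blast
  \<comment> \<open>The infimum of a set of reals lies below its elements only once the set is known
    to be bounded below.\<close>
  have "bdd_below ?X"
  proof (rule bdd_belowI[of _ 0])
    fix L assume "L \<in> ?X"
    then obtain T \<gamma> u where h: "horizontal n \<alpha> T \<gamma> u" "L = ctrl_length n T u" by blast
    show "0 \<le> L" unfolding h(2) ctrl_length_def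
      by (rule integral_nonneg[OF ctrl_length_integrable[OF h(1)]]) (intro real_sqrt_ge_zero sum_nonneg zero_le_power2)
  qed
  moreover have "ctrl_length n t1 u \<in> ?X" using c by blast
  ultimately have "Inf ?X \<le> ctrl_length n t1 u" by (rule cInf_lower[rotated])
  then have "cc_dist n \<alpha> (x 0) (x t1) < t1" using c(3) unfolding cc_dist_def by linarith
  then show False using horizontal_length_ge[OF w(1)] w(2) by linarith
qed

text \<open>Every time at which a half period has elapsed bounds all minimizing times, hence so does
  their infimum; without such a time the infimum is infinite.\<close>

lemma cut_time_le_tau:
  assumes "j \<in> Jset n \<alpha>"
  shows "cut_time n \<alpha> x \<le> tau_j \<alpha> x0 \<phi> x j"
  unfolding tau_j_def
proof (rule Inf_greatest)
  have j: "1 \<le> j" "j \<le> n" "\<alpha> j \<noteq> 0" using assms by (auto simp: Jset_def)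
  fix e assume "e \<in> ereal ` {t. t > 0 \<and> \<bar>omega \<alpha> x0 \<phi> j\<bar> * integral {0..t} (\<lambda>s. (xi \<alpha> j (x s))\<^sup>2) = gpi (\<alpha> j)}"
  then obtain t0 where t0: "e = ereal t0" "0 < t0" "\<bar>omega \<alpha> x0 \<phi> j\<bar> * clock j t0 = gpi (real (\<alpha> j))"
    by (auto simp: clock_def)
  show "cut_time n \<alpha> x \<le> e"
    unfolding cut_time_def t0(1)
  proof (rule Sup_least)
    fix e' assume "e' \<in> ereal ` {t. t > 0 \<and> minimizing_on n \<alpha> x t}"
    then obtain t where "e' = ereal t" "minimizing_on n \<alpha> x t" by blast
    with not_minimizing_after[OF j t0(3,2)] show "e' \<le> ereal t0" by simp
  qed
qed

end

theorem mainTheorem5: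
  fixes n :: nat and \<alpha> :: "nat \<Rightarrow> nat" and x0 \<phi> :: "nat \<Rightarrow> real"
    and x p :: "real \<Rightarrow> nat \<Rightarrow> real"
  assumes "n \<ge> 1"
    and "riemannian_point n \<alpha> x0"
    and "\<phi> \<in> R0_alpha n \<alpha>"
    and "hamilton_solution n \<alpha> x0 (p0_sph n \<alpha> x0 \<phi>) x p"
  shows "0 \<le> cut_time n \<alpha> x \<and>
         cut_time n \<alpha> x \<le> (INF j\<in>Jset n \<alpha>. tau_j \<alpha> x0 \<phi> x j)"
proof -
  interpret grushin_geodesic n \<alpha> x0 \<phi> x p
    using assms by unfold_locales
  show ?thesis
    using cut_time_nonneg cut_time_le_tau by (intro conjI INF_greatest)
qed

end
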